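(* For all $\mu_0,\mu_1\in\mathcal M$ there exists a triplet $(\mu_t,V_t,h_t)_{t\in[0,1]}\in\mathcal{CE}_p(\mu_0,\mu_1;[0,1])$ such that $$\mathcal W^{a,b}_p(\mu_0,\mu_1)^2=\mathfrak E^{a,b}_{\rm Quad}\big((\mu_t,V_t,h_t)_{t\in[0,1]}\big).$$
   Context: Setting. $\mathcal X$ is a finite set, $K:\mathcal X\times\mathcal X\to[0,\infty)$ an irreducible Markov kernel ($\sum_y K(x,y)=1$) with unique invariant probability $\varpi$ ($\varpi(x)=\sum_y\varpi(y)K(y,x)$, $\sum_y\varpi(y)=1$), assumed reversible: $K(x,y)\varpi(x)=K(y,x)\varpi(y)$. $\mathcal M$ is the set of $\mu:\mathcal X\to[0,\infty)$ and $\mathcal M_+$ the set of $\mu:\mathcal X\to(0,\infty)$. Fix $a,b>0$ and $p\in\mathcal M_+$ with $\sum_x p(x)\varpi(x)=1$. Notation. $(\nabla\cdot\Psi)(x)=\frac12\sum_y(\Psi(x,y)-\Psi(y,x))K(x,y)$ for $\Psi\in\mathbb R^{\mathcal X\times\mathcal X}$. Logarithmic mean: $\theta(u,v)=\int_0^1u^\xi v^{1-\xi}\,d\xi$ for $u,v\ge0$, i.e. $\theta(u,u)=u$, $\theta(u,v)=\frac{u-v}{\log u-\log v}$ for $u\ne v$ positive, and $\theta(u,v)=0$ if $u=0$ or $v=0$. $\hat\mu(x,y)=\theta(\mu(x),\mu(y))$. Metric. $\mathcal W^{a,b}_p(\mu_0,\mu_1)^2$ is the infimum of $a^2\int_0^1h_t^2\,dt+b^2\int_0^1\frac12\sum_{x,y}(\psi_t(y)-\psi_t(x))^2\hat\mu_t(x,y)K(x,y)\varpi(x)\,dt$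 over all triples $(\mu_t,\psi_t,h_t)_{t\in[0,1]}$ with $t\mapsto\mu_t\in\mathcal M$ absolutely continuous on $[0,1]$ with the given endpoints $\mu_0,\mu_1$, $\psi:[0,1]\to\mathbb R^{\mathcal X}$ and $h:[0,1]\to\mathbb R$ measurable, and $\dot\mu_t(x)+\sum_y(\psi_t(y)-\psi_t(x))\hat\mu_t(x,y)K(x,y)=h_tp(x)$ for a.e. $t$ and all $x$. It is known from earlier work that $\mathcal W^{a,b}_p$ is a (finite) metric on $\mathcal M$. Flux formulation. $\mathcal{CE}_p(\mu_0,\mu_1;[0,1])$ is the set of triples $(\mu_t,V_t,h_t)_{t\in[0,1]}$ with $t\mapsto\mu_t\in\mathcal M$ absolutely continuous with endpoints $\mu_0$ (at $t=0$) and $\mu_1$ (at $t=1$), $V:[0,1]\to\mathbb R^{\mathcal X\times\mathcal X}$ and $h:[0,1]\to\mathbb R$ measurable, and $\dot\mu_t+\nabla\cdot V_t=h_tp$ for a.e. $t$. Let $\alpha(v,s,t)=v^2/\theta(s,t)$ for $v\in\mathbb R$, $s,t\ge0$, with $v^2/0=0$ if $v=0$ and $v^2/0=+\infty$ if $v\neq0$; $A'(\mu,V)=\frac12\sum_{x,y}\alpha(V(x,y),\mu(x),\mu(y))K(x,y)\varpi(x)$ (with $0\cdot\infty=0$); and $\mathfrak E^{a,b}_{\rm Quad}((\mu_t,V_t,h_t)_{t\in[0,1]})=a^2\int_0^1|h_t|^2dt+b^2\int_0^1A'(\mu_t,V_t)\,dt\in[0,\infty]$. *)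

theory Defs
  imports "HOL-Analysis.Analysis"
begin

section \<open>Reversible Markov kernels on a finite set\<close>

definition markov_kernel :: "('x::finite \<Rightarrow> 'x \<Rightarrow> real) \<Rightarrow> bool" where
  "markov_kernel K \<longleftrightarrow> (\<forall>x y. 0 \<le> K x y) \<and> (\<forall>x. (\<Sum>y\<in>UNIV. K x y) = 1)"

primrec kernel_power :: "('x::finite \<Rightarrow> 'x \<Rightarrow> real) \<Rightarrow> nat \<Rightarrow> 'x \<Rightarrow> 'x \<Rightarrow> real" where
  "kernel_power K 0 x y = (if x = y then 1 else 0)"
| "kernel_power K (Suc n) x y = (\<Sum>z\<in>UNIV. K x z * kernel_power K n z y)"

definition irreducible_kernel :: "('x::finite \<Rightarrow> 'x \<Rightarrow> real) \<Rightarrow> bool" where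
  "irreducible_kernel K \<longleftrightarrow> (\<forall>x y. \<exists>n. 0 < kernel_power K n x y)"

text \<open>For an irreducible kernel there is exactly one such \<open>\<pi>\<close>.\<close>

definition invariant_probability :: "('x::finite \<Rightarrow> 'x \<Rightarrow> real) \<Rightarrow> ('x \<Rightarrow> real) \<Rightarrow> bool" where
  "invariant_probability K \<pi> \<longleftrightarrow>
     (\<forall>x. 0 \<le> \<pi> x) \<and> (\<Sum>x\<in>UNIV. \<pi> x) = 1 \<and>
     (\<forall>x. \<pi> x = (\<Sum>y\<in>UNIV. \<pi> y * K y x))"

definition reversible_kernel :: "('x::finite \<Rightarrow> 'x \<Rightarrow> real) \<Rightarrow> ('x \<Rightarrow> real) \<Rightarrow> bool" where
  "reversible_kernel K \<pi> \<longleftrightarrow> (\<forall>x y. K x y * \<pi> x = K y x * \<pi> y)"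

definition nonneg_densities :: "('x::finite \<Rightarrow> real) set" where
  "nonneg_densities = {\<mu>. \<forall>x. 0 \<le> \<mu> x}"

definition pos_densities :: "('x::finite \<Rightarrow> real) set" where
  "pos_densities = {\<mu>. \<forall>x. 0 < \<mu> x}"

definition discrete_divergence ::
    "('x::finite \<Rightarrow> 'x \<Rightarrow> real) \<Rightarrow> ('x \<Rightarrow> 'x \<Rightarrow> real) \<Rightarrow> 'x \<Rightarrow> real" where
  "discrete_divergence K \<Psi> x = 1/2 * (\<Sum>y\<in>UNIV. (\<Psi> x y - \<Psi> y x) * K x y)"

section \<open>The logarithmic mean\<close>

definition log_mean :: "real \<Rightarrow> real \<Rightarrow> real" where
  "log_mean u v = integral {0..1} (\<lambda>\<xi>. u powr \<xi> * v powr (1 - \<xi>))"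

lemma log_mean_zero [simp]: "log_mean 0 v = 0" "log_mean u 0 = 0"
  by (simp_all add: log_mean_def)

lemma log_mean_same:
  assumes "0 \<le> u"
  shows "log_mean u u = u"
proof (cases "u = 0")
  case False
  then have "u powr \<xi> * u powr (1 - \<xi>) = u" for \<xi>
    using assms by (simp flip: powr_add)
  then show ?thesis
    by (simp add: log_mean_def)
qed simp

lemma log_mean_distinct:
  assumes "0 < u" "0 < v" "u \<noteq> v"
  shows "log_mean u v = (u - v) / (ln u - ln v)"
proof -
  define c where "c = ln u - ln v"
  have c: "c \<noteq> 0"
    using assms by (simp add: c_def)
  have eq: "u powr \<xi> * v powr (1 - \<xi>) = v * exp (c * \<xi>)" for \<xi>
  proof -
    have "u powr \<xi> * v powr (1 - \<xi>) = exp (ln v + c * \<xi>)"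
      using assms by (simp add: powr_def c_def algebra_simps flip: exp_add)
    then show ?thesis
      using assms by (simp add: exp_add)
  qed
  have "((\<lambda>\<xi>. v * exp (c * \<xi>)) has_integral v * exp (c * 1) / c - v * exp (c * 0) / c) {0..1}"
    by (rule fundamental_theorem_of_calculus)
       (use c in \<open>auto intro!: derivative_eq_intros
          simp flip: has_real_derivative_iff_has_vector_derivative\<close>)
  moreover have "v * exp c = u"
    using assms by (simp add: c_def exp_diff)
  ultimately have "((\<lambda>\<xi>. v * exp (c * \<xi>)) has_integral (u - v) / c) {0..1}"
    by (simp add: diff_divide_distrib)
  then show ?thesis
    unfolding log_mean_def eq c_def by (rule integral_unique)
qed

section \<open>Absolutely continuous curves\<close>

definition absolutely_continuous_fun_on ::
    "real \<Rightarrow> real \<Rightarrow> (real \<Rightarrow> 'a::metric_space) \<Rightarrow> bool" where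
  "absolutely_continuous_fun_on c d f \<longleftrightarrow>
     (\<forall>\<epsilon>>0. \<exists>\<delta>>0. \<forall>(n::nat) l r.
        (\<forall>i<n. c \<le> l i \<and> l i \<le> r i \<and> r i \<le> d) \<and>
        disjoint_family_on (\<lambda>i. {l i<..<r i}) {..<n} \<and>
        (\<Sum>i<n. r i - l i) < \<delta> \<longrightarrow>
        (\<Sum>i<n. dist (f (l i)) (f (r i))) < \<epsilon>)"

text \<open>Curves are functions on all of \<open>\<real>\<close> of which only the restriction to \<open>{0..1}\<close> matters.
  Absolute continuity is required coordinatewise, which for the finitely many coordinates
  agrees with absolute continuity for any norm.\<close>

definition density_curve ::
    "('x::finite \<Rightarrow> real) \<Rightarrow> ('x \<Rightarrow> real) \<Rightarrow> (real \<Rightarrow> 'x \<Rightarrow> real) \<Rightarrow> bool" where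
  "density_curve \<mu>0 \<mu>1 \<mu> \<longleftrightarrow>
     (\<forall>t\<in>{0..1}. \<mu> t \<in> nonneg_densities) \<and>
     (\<forall>x. absolutely_continuous_fun_on 0 1 (\<lambda>t. \<mu> t x)) \<and>
     \<mu> 0 = \<mu>0 \<and> \<mu> 1 = \<mu>1"

section \<open>The transport metric\<close>

definition potential_triples ::
    "('x::finite \<Rightarrow> 'x \<Rightarrow> real) \<Rightarrow> ('x \<Rightarrow> real) \<Rightarrow> ('x \<Rightarrow> real) \<Rightarrow> ('x \<Rightarrow> real) \<Rightarrow>
     ((real \<Rightarrow> 'x \<Rightarrow> real) \<times> (real \<Rightarrow> 'x \<Rightarrow> real) \<times> (real \<Rightarrow> real)) set" where
  "potential_triples K p \<mu>0 \<mu>1 = {(\<mu>, \<psi>, h).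
     density_curve \<mu>0 \<mu>1 \<mu> \<and>
     (\<forall>x. (\<lambda>t. \<psi> t x) \<in> borel_measurable (lebesgue_on {0..1})) \<and>
     h \<in> borel_measurable (lebesgue_on {0..1}) \<and>
     (AE t in lebesgue_on {0..1}. \<forall>x. \<exists>\<mu>'.
        ((\<lambda>s. \<mu> s x) has_real_derivative \<mu>') (at t within {0..1}) \<and>
        \<mu>' + (\<Sum>y\<in>UNIV. (\<psi> t y - \<psi> t x) * log_mean (\<mu> t x) (\<mu> t y) * K x y) = h t * p x)}"

definition potential_energy ::
    "('x::finite \<Rightarrow> 'x \<Rightarrow> real) \<Rightarrow> ('x \<Rightarrow> real) \<Rightarrow> real \<Rightarrow> real \<Rightarrow>
     (real \<Rightarrow> 'x \<Rightarrow> real) \<times> (real \<Rightarrow> 'x \<Rightarrow> real) \<times> (real \<Rightarrow> real) \<Rightarrow> ennreal" where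
  "potential_energy K \<pi> a b = (\<lambda>(\<mu>, \<psi>, h).
     ennreal (a\<^sup>2) * (\<integral>\<^sup>+t. ennreal ((h t)\<^sup>2) \<partial>lebesgue_on {0..1}) +
     ennreal (b\<^sup>2) * (\<integral>\<^sup>+t. ennreal (1/2 * (\<Sum>x\<in>UNIV. \<Sum>y\<in>UNIV.
        (\<psi> t y - \<psi> t x)\<^sup>2 * log_mean (\<mu> t x) (\<mu> t y) * K x y * \<pi> x)) \<partial>lebesgue_on {0..1}))"

definition ennreal_sqrt :: "ennreal \<Rightarrow> ennreal" where
  "ennreal_sqrt u = (if u = \<infinity> then \<infinity> else ennreal (sqrt (enn2real u)))"

lemma ennreal_sqrt_power2 [simp]: "(ennreal_sqrt u)\<^sup>2 = u"
  by (cases u) (auto simp: ennreal_sqrt_def power2_eq_square simp flip: ennreal_mult)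

text \<open>The metric takes values in \<open>[0,\<infinity>]\<close>, so that an infinite infimum is not silently
  replaced by a real number; finiteness is a theorem, not part of the definition.\<close>

definition transport_metric ::
    "('x::finite \<Rightarrow> 'x \<Rightarrow> real) \<Rightarrow> ('x \<Rightarrow> real) \<Rightarrow> ('x \<Rightarrow> real) \<Rightarrow> real \<Rightarrow> real \<Rightarrow>
     ('x \<Rightarrow> real) \<Rightarrow> ('x \<Rightarrow> real) \<Rightarrow> ennreal" where
  "transport_metric K \<pi> p a b \<mu>0 \<mu>1 =
     ennreal_sqrt (INF \<tau>\<in>potential_triples K p \<mu>0 \<mu>1. potential_energy K \<pi> a b \<tau>)"

lemma transport_metric_power2:
  "(transport_metric K \<pi> p a b \<mu>0 \<mu>1)\<^sup>2 =
     (INF \<tau>\<in>potential_triples K p \<mu>0 \<mu>1. potential_energy K \<pi> a b \<tau>)"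
  by (simp add: transport_metric_def)

section \<open>The flux formulation\<close>

definition continuity_triples ::
    "('x::finite \<Rightarrow> 'x \<Rightarrow> real) \<Rightarrow> ('x \<Rightarrow> real) \<Rightarrow> ('x \<Rightarrow> real) \<Rightarrow> ('x \<Rightarrow> real) \<Rightarrow>
     ((real \<Rightarrow> 'x \<Rightarrow> real) \<times> (real \<Rightarrow> 'x \<Rightarrow> 'x \<Rightarrow> real) \<times> (real \<Rightarrow> real)) set" where
  "continuity_triples K p \<mu>0 \<mu>1 = {(\<mu>, V, h).
     density_curve \<mu>0 \<mu>1 \<mu> \<and>
     (\<forall>x y. (\<lambda>t. V t x y) \<in> borel_measurable (lebesgue_on {0..1})) \<and>
     h \<in> borel_measurable (lebesgue_on {0..1}) \<and>
     (AE t in lebesgue_on {0..1}. \<forall>x. \<exists>\<mu>'.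
        ((\<lambda>s. \<mu> s x) has_real_derivative \<mu>') (at t within {0..1}) \<and>
        \<mu>' + discrete_divergence K (V t) x = h t * p x)}"

text \<open>Division in \<^typ>\<open>ennreal\<close> follows the required conventions:
  \<open>0 / 0 = 0\<close> and \<open>u / 0 = \<infinity>\<close> for \<open>u \<noteq> 0\<close>; likewise \<open>0 * \<infinity> = 0\<close>.\<close>

definition action_density :: "real \<Rightarrow> real \<Rightarrow> real \<Rightarrow> ennreal" where
  "action_density v s t = ennreal (v\<^sup>2) / ennreal (log_mean s t)"

lemma action_density_zero_mean:
  assumes "log_mean s t = 0"
  shows "action_density v s t = (if v = 0 then 0 else \<infinity>)"
  using assms by (auto simp: action_density_def divide_ennreal_def ennreal_mult_top)

definition flux_action ::
    "('x::finite \<Rightarrow> 'x \<Rightarrow> real) \<Rightarrow> ('x \<Rightarrow> real) \<Rightarrow> ('x \<Rightarrow> real) \<Rightarrow> ('x \<Rightarrow> 'x \<Rightarrow> real) \<Rightarrow> ennreal" where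
  "flux_action K \<pi> \<mu> V = ennreal (1/2) * (\<Sum>x\<in>UNIV. \<Sum>y\<in>UNIV.
     action_density (V x y) (\<mu> x) (\<mu> y) * ennreal (K x y) * ennreal (\<pi> x))"

definition quad_energy ::
    "('x::finite \<Rightarrow> 'x \<Rightarrow> real) \<Rightarrow> ('x \<Rightarrow> real) \<Rightarrow> real \<Rightarrow> real \<Rightarrow>
     (real \<Rightarrow> 'x \<Rightarrow> real) \<times> (real \<Rightarrow> 'x \<Rightarrow> 'x \<Rightarrow> real) \<times> (real \<Rightarrow> real) \<Rightarrow> ennreal" where
  "quad_energy K \<pi> a b = (\<lambda>(\<mu>, V, h).
     ennreal (a\<^sup>2) * (\<integral>\<^sup>+t. ennreal (\<bar>h t\<bar>\<^sup>2) \<partial>lebesgue_on {0..1}) +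
     ennreal (b\<^sup>2) * (\<integral>\<^sup>+t. flux_action K \<pi> (\<mu> t) (V t) \<partial>lebesgue_on {0..1}))"

end

theory Submission
  imports Defs
begin

text \<open>
  The idea is to replace potentials by fluxes. In the variables \<open>(\<mu>, V, h)\<close> the continuity equation
  is linear, and the energy is jointly convex and lower semicontinuous, because \<open>v\<^sup>2 / \<theta>(s, t)\<close> is the
  composition of the convex function \<open>v\<^sup>2 / r\<close>, which decreases in \<open>r\<close>, with the concave and
  continuous logarithmic mean (\<open>action_density_midpoint\<close>, \<open>action_density_lower_semicontinuous\<close>).
  So the flux energy has a minimiser, and it remains to see that its minimum is the squared distance.

  \<^bold>\<open>Both infima agree\<close> (\<open>transport_metric_eq_INF_quad_energy\<close>). The flux
  \<open>V(x, y) = (\<psi>(y) - \<psi>(x)) \<theta>(\<mu>(x), \<mu>(y))\<close> turns a potential triple into a flux triple of the same energy.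
  Conversely, a flux triple of finite energy has finite action at almost every time. There \<open>V\<close> vanishes on
  all edges where the mean is zero, so that its divergence is orthogonal to the kernel of the weighted
  graph Laplacian and is therefore the divergence of a flux of gradient form. That flux is the orthogonal projection of \<open>V\<close> for the inner
  product behind the action, hence it has at most the action of \<open>V\<close>
  (\<open>gradient_action_le_flux_action\<close>). The potential depends measurably on time
  because it is a limit of regularised solutions, which Cramer's rule writes out explicitly
  (\<open>measurable_solution_symmetric_psd\<close>).

  \<^bold>\<open>The minimum is attained\<close> (\<open>quad_energy_minimum_attained\<close>). The sets of triples whose energy exceeds
  the infimum by at most \<open>1 / (n + 1)\<close> are nested and convex, and they are bounded for the
  \<open>L\<^sup>2\<close> norm of \<open>(V, h)\<close>: the total mass of \<open>\<mu>\<close> changes only through \<open>h\<close>, so a bound on the energy bounds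
  \<open>\<mu>\<close>, hence the mean \<open>\<theta>\<close>, hence \<open>V\<^sup>2\<close> by a multiple of \<open>V\<^sup>2 / \<theta>\<close>. Suitable elements of almost
  minimal \<open>L\<^sup>2\<close> norm in these sets form a Cauchy sequence by the parallelogram identity
  (\<open>nested_midpoint_convex_L2_limit\<close>); this gives strong convergence where the usual argument has weak
  compactness. The curves then converge by dominated convergence, and the energy
  passes to the limit by Fatou's lemma. If the infimum is infinite, every triple is a minimiser, and
  some triple exists because irreducibility makes the graph connected.

  Two facts of real analysis allow the differential equation to be handled as an integral equation: an
  absolutely continuous function is the integral of its almost everywhere derivative
  (\<open>has_integral_derivative_absolutely_continuous\<close>), and an indefinite integral is almost everywhere
  differentiable with the expected derivative (\<open>has_real_derivative_indefinite_integral_ae\<close>).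
\<close>

section \<open>Absolutely continuous functions of a real variable\<close>

text \<open>Divisions of an interval come as finite sets of tagged intervals rather than as sequences, so
absolute continuity is wanted for families over an arbitrary finite index set.\<close>

lemma absolutely_continuous_fun_on_finite_family:
  assumes "absolutely_continuous_fun_on c d f" "0 < \<epsilon>"
  obtains \<delta> where "0 < \<delta>"
    "\<And>P l r. \<lbrakk>finite P; \<And>i. i \<in> P \<Longrightarrow> c \<le> l i \<and> l i \<le> r i \<and> r i \<le> d;
        disjoint_family_on (\<lambda>i. {l i<..<r i}) P; (\<Sum>i\<in>P. r i - l i) < \<delta>\<rbrakk>
      \<Longrightarrow> (\<Sum>i\<in>P. dist (f (l i)) (f (r i))) < \<epsilon>"
proof -
  obtain \<delta> where \<delta>: "0 < \<delta>" and ac: "\<And>(n::nat) l r.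
        \<lbrakk>\<forall>i<n. c \<le> l i \<and> l i \<le> r i \<and> r i \<le> d;
        disjoint_family_on (\<lambda>i. {l i<..<r i}) {..<n};
        (\<Sum>i<n. r i - l i) < \<delta>\<rbrakk> \<Longrightarrow> (\<Sum>i<n. dist (f (l i)) (f (r i))) < \<epsilon>"
    using assms unfolding absolutely_continuous_fun_on_def by meson
  show thesis
  proof (rule that[OF \<delta>])
    fix P :: "'b set" and l r
    assume P: "finite P" "\<And>i. i \<in> P \<Longrightarrow> c \<le> l i \<and> l i \<le> r i \<and> r i \<le> d"
      "disjoint_family_on (\<lambda>i. {l i<..<r i}) P" "(\<Sum>i\<in>P. r i - l i) < \<delta>"
    obtain g where g: "bij_betw g {..<card P} P"
      using ex_bij_betw_nat_finite[OF P(1)] by (auto simp: atLeast0LessThan)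
    have "(\<Sum>k<card P. dist (f ((l \<circ> g) k)) (f ((r \<circ> g) k))) < \<epsilon>"
    proof (rule ac)
      show "\<forall>i<card P. c \<le> (l \<circ> g) i \<and> (l \<circ> g) i \<le> (r \<circ> g) i \<and> (r \<circ> g) i \<le> d"
        using g P(2) by (auto simp: bij_betw_def)
      show "disjoint_family_on (\<lambda>i. {(l \<circ> g) i<..<(r \<circ> g) i}) {..<card P}"
        unfolding disjoint_family_on_def
      proof (intro ballI impI)
        fix m n assume mn: "m \<in> {..<card P}" "n \<in> {..<card P}" "m \<noteq> n"
        then have "g m \<in> P" "g n \<in> P" "g m \<noteq> g n"
          using g by (auto simp: bij_betw_def inj_on_def)
        with P(3) show "{(l \<circ> g) m<..<(r \<circ> g) m} \<inter> {(l \<circ> g) n<..<(r \<circ> g) n} = {}"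
          unfolding disjoint_family_on_def by simp
      qed
      show "(\<Sum>i<card P. (r \<circ> g) i - (l \<circ> g) i) < \<delta>"
        using P(4) sum.reindex_bij_betw[OF g, of "\<lambda>i. r i - l i"] by simp
    qed
    then show "(\<Sum>i\<in>P. dist (f (l i)) (f (r i))) < \<epsilon>"
      using sum.reindex_bij_betw[OF g, of "\<lambda>i. dist (f (l i)) (f (r i))"] by simp
  qed
qed

text \<open>Supplies the smallness condition in the definition of absolute continuity: disjoint intervals
inside an open set of small measure have small total length.\<close>

lemma sum_interval_lengths_le:
  fixes l r :: "'i \<Rightarrow> real"
  assumes P: "finite P" "\<And>i. i \<in> P \<Longrightarrow> l i \<le> r i"
    and disj: "disjoint_family_on (\<lambda>i. {l i<..<r i}) P"
    and sub: "\<And>i. i \<in> P \<Longrightarrow> {l i<..<r i} \<subseteq> U"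
    and U: "U \<in> sets lebesgue" "emeasure lebesgue U < ennreal \<delta>"
  shows "(\<Sum>i\<in>P. r i - l i) < \<delta>"
proof -
  have "ennreal (\<Sum>i\<in>P. r i - l i) = (\<Sum>i\<in>P. ennreal (r i - l i))"
    using P by (intro sum_ennreal[symmetric]) auto
  also have "\<dots> = (\<Sum>i\<in>P. emeasure lebesgue {l i<..<r i})"
    using P by (intro sum.cong) auto
  also have "\<dots> = emeasure lebesgue (\<Union>i\<in>P. {l i<..<r i})"
    by (intro sum_emeasure disj P) auto
  also have "\<dots> \<le> emeasure lebesgue U"
    by (intro emeasure_mono U) (use sub in auto)
  finally have "ennreal (\<Sum>i\<in>P. r i - l i) < ennreal \<delta>"
    using U(2) by simp
  then show ?thesis
    using P by (subst (asm) ennreal_less_iff) (auto intro!: sum_nonneg)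
qed

text \<open>The exceptional null set \<open>N\<close> is covered by an open set \<open>U\<close> so small that, by absolute continuity,
the increments of \<open>f\<close> over disjoint intervals inside \<open>U\<close> have a small sum. A gauge which keeps intervals
with tag in \<open>N\<close> inside \<open>U\<close>, and all others so short that the derivative at the tag controls the
increment, then shows the Henstock--Kurzweil sums of the derivative to be close to \<open>f b - f a\<close>.\<close>

lemma has_integral_derivative_absolutely_continuous:
  fixes f g :: "real \<Rightarrow> real"
  assumes "a \<le> b" and ac: "absolutely_continuous_fun_on a b f"
    and N: "negligible N"
    and deriv: "\<And>x. x \<in> {a..b} - N \<Longrightarrow> (f has_real_derivative g x) (at x within {a..b})"
  shows "(g has_integral (f b - f a)) {a..b}"
proof -
  \<comment> \<open>With the value 0 on \<open>N\<close>, tags in \<open>N\<close> contribute only increments of \<open>f\<close>.\<close>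
  define g0 where "g0 = (\<lambda>x. if x \<in> N then 0 else g x)"
  have "(g0 has_integral (f b - f a)) {a..b}"
    unfolding has_integral_real
  proof (intro allI impI)
    fix \<epsilon> :: real assume "0 < \<epsilon>"
    \<comment> \<open>Good tags contribute at most \<open>e * (b - a) \<le> \<epsilon> / 2\<close>; the summand 1 avoids division by zero if \<open>a = b\<close>.\<close>
    define e where "e = \<epsilon> / (2 * (b - a + 1))"
    have e: "0 < e" "e * (b - a) \<le> \<epsilon> / 2"
      using \<open>0 < \<epsilon>\<close> \<open>a \<le> b\<close> by (auto simp: e_def field_simps)
    have "\<forall>x. \<exists>d>0. x \<in> {a..b} - N \<longrightarrow>
         (\<forall>y\<in>{a..b}. \<bar>y - x\<bar> < d \<longrightarrow> \<bar>f y - f x - g x * (y - x)\<bar> \<le> e * \<bar>y - x\<bar>)"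
    proof
      fix x
      show "\<exists>d>0. x \<in> {a..b} - N \<longrightarrow>
         (\<forall>y\<in>{a..b}. \<bar>y - x\<bar> < d \<longrightarrow> \<bar>f y - f x - g x * (y - x)\<bar> \<le> e * \<bar>y - x\<bar>)"
      proof (cases "x \<in> {a..b} - N")
        case True
        show ?thesis
          using deriv[OF True] e(1)
          unfolding has_field_derivative_def has_derivative_within_alt real_norm_def by blast
      next
        case False
        then show ?thesis by (intro exI[of _ 1]) auto
      qed
    qed
    then obtain d where d: "\<And>x. 0 < d x"
       "\<And>x y. \<lbrakk>x \<in> {a..b} - N; y \<in> {a..b}; \<bar>y - x\<bar> < d x\<rbrakk> \<Longrightarrow> \<bar>f y - f x - g x * (y - x)\<bar> \<le> e * \<bar>y - x\<bar>"
      unfolding choice_iff by blast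
    obtain \<delta> where \<delta>: "0 < \<delta>"
      "\<And>P l r. \<lbrakk>finite (P :: (real \<times> real set) set); \<And>i. i \<in> P \<Longrightarrow> a \<le> l i \<and> l i \<le> r i \<and> r i \<le> b;
        disjoint_family_on (\<lambda>i. {l i<..<r i}) P; (\<Sum>i\<in>P. r i - l i) < \<delta>\<rbrakk>
      \<Longrightarrow> (\<Sum>i\<in>P. dist (f (l i)) (f (r i))) < \<epsilon> / 2"
      using absolutely_continuous_fun_on_finite_family[OF ac half_gt_zero[OF \<open>0 < \<epsilon>\<close>]]
      by blast
    have N': "N \<in> null_sets lebesgue"
      using N by (simp add: negligible_iff_null_sets)
    obtain U where U: "open U" "N \<subseteq> U" "U - N \<in> lmeasurable" "emeasure lebesgue (U - N) < ennreal \<delta>"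
      using sets_lebesgue_outer_open[of N \<delta>] N' \<delta>(1) by blast
    have "emeasure lebesgue U = emeasure lebesgue (U - N)"
      using emeasure_Diff_null_set[OF N', of U] U(1) by simp
    with U have mU: "U \<in> sets lebesgue" "emeasure lebesgue U < ennreal \<delta>"
      by auto
    define \<gamma> where "\<gamma> x = (if x \<in> N then U else ball x (d x))" for x
    have "gauge \<gamma>"
      using U d(1) by (auto simp: gauge_def \<gamma>_def)
    have "norm (sum (\<lambda>(x,k). measure lborel k *\<^sub>R g0 x) p - (f b - f a)) < \<epsilon>"
      if p: "p tagged_division_of {a..b}" and fine: "\<gamma> fine p" for p
    proof -
      note pD = tagged_division_ofD[OF p]
      have K: "\<exists>u v. K = {u..v} \<and> a \<le> u \<and> u \<le> v \<and> v \<le> b \<and> u \<le> x \<and> x \<le> v" if xk: "(x, K) \<in> p" for x K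
      proof -
        obtain u v where uv: "K = cbox u v" using pD(4)[OF xk] by blast
        have "x \<in> {u..v}" "{u..v} \<subseteq> {a..b}" using pD(2,3)[OF xk] uv by auto
        then show ?thesis using uv by (intro exI[of _ u] exI[of _ v]) auto
      qed
      define B where "B = {i\<in>p. fst i \<in> N}"
      define G where "G = {i\<in>p. fst i \<notin> N}"
      have fin: "finite B" "finite G" "B \<inter> G = {}" "p = B \<union> G"
        using pD(1) by (auto simp: B_def G_def)
      have "(\<Sum>(x,k)\<in>p. measure lborel k *\<^sub>R g0 x) - (f b - f a) =
          (\<Sum>(x,k)\<in>p. measure lborel k *\<^sub>R g0 x - (f (Sup k) - f (Inf k)))"
        using additive_tagged_division_1[OF \<open>a \<le> b\<close> p, of f]
        by (simp add: sum_subtractf split_def)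
      also have "\<dots> = (\<Sum>(x,k)\<in>B. measure lborel k *\<^sub>R g0 x - (f (Sup k) - f (Inf k))) +
          (\<Sum>(x,k)\<in>G. measure lborel k *\<^sub>R g0 x - (f (Sup k) - f (Inf k)))" (is "_ = ?B + ?G")
        using fin by (simp add: sum.union_disjoint)
      finally have split: "(\<Sum>(x,k)\<in>p. measure lborel k *\<^sub>R g0 x) - (f b - f a) = ?B + ?G" .
      have "\<bar>?G\<bar> \<le> (\<Sum>(x,k)\<in>G. e * measure lborel k)"
        unfolding real_norm_def[symmetric]
      proof (rule sum_norm_le, safe)
        fix x k assume "(x, k) \<in> G"
        then have xk: "(x, k) \<in> p" "x \<notin> N" by (auto simp: G_def)
        obtain u v where uv: "k = {u..v}" "a \<le> u" "u \<le> v" "v \<le> b" "u \<le> x" "x \<le> v"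
          using K[OF xk(1)] by blast
        have "k \<subseteq> ball x (d x)" using fineD[OF fine xk(1)] xk(2) by (simp add: \<gamma>_def)
        moreover have "u \<in> k" "v \<in> k" using uv by auto
        ultimately have "u \<in> ball x (d x)" "v \<in> ball x (d x)" by blast+
        then have "\<bar>u - x\<bar> < d x" "\<bar>v - x\<bar> < d x" by (auto simp: dist_real_def)
        then have "\<bar>f u - f x - g x * (u - x)\<bar> \<le> e * \<bar>u - x\<bar>" "\<bar>f v - f x - g x * (v - x)\<bar> \<le> e * \<bar>v - x\<bar>"
          using d(2)[of x u] d(2)[of x v] uv xk by auto
        then have "\<bar>(v - u) * g x - (f v - f u)\<bar> \<le> e * (v - u)"
          using uv by (simp add: algebra_simps abs_if split: if_splits)
        then show "norm (measure lborel k *\<^sub>R g0 x - (f (Sup k) - f (Inf k))) \<le> e * measure lborel k"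
          using uv xk by (simp add: g0_def)
      qed
      also have "\<dots> \<le> (\<Sum>(x,k)\<in>p. e * measure lborel k)"
        using fin by (intro sum_mono2) (use e in auto)
      also have "\<dots> = e * (b - a)"
        using additive_content_tagged_division[of p a b] p \<open>a \<le> b\<close> by (simp add: sum_distrib_left[symmetric] split_def)
      finally have G: "\<bar>?G\<bar> \<le> \<epsilon> / 2" using e by simp
      have disj: "disjoint_family_on (\<lambda>i. {Inf (snd i)<..<Sup (snd i)}) B"
        unfolding disjoint_family_on_def
      proof (intro ballI impI)
        fix i j assume ij: "i \<in> B" "j \<in> B" "i \<noteq> j"
        obtain x k y m where eq: "i = (x, k)" "j = (y, m)" by (metis surj_pair)
        have in_p: "(x, k) \<in> p" "(y, m) \<in> p" using ij eq by (auto simp: B_def)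
        obtain u v u' v' where "k = {u..v}" "u \<le> v" "m = {u'..v'}" "u' \<le> v'"
          using K in_p by meson
        moreover have "interior k \<inter> interior m = {}" using pD(5)[OF in_p] ij eq by auto
        ultimately show "{Inf (snd i)<..<Sup (snd i)} \<inter> {Inf (snd j)<..<Sup (snd j)} = {}"
          using eq by simp
      qed
      have bnd: "a \<le> Inf (snd i) \<and> Inf (snd i) \<le> Sup (snd i) \<and> Sup (snd i) \<le> b" if "i \<in> B" for i
        using K[of "fst i" "snd i"] that by (auto simp: B_def)
      have "(\<Sum>i\<in>B. Sup (snd i) - Inf (snd i)) < \<delta>"
      proof (rule sum_interval_lengths_le[OF fin(1) _ disj _ mU])
        show "{Inf (snd i)<..<Sup (snd i)} \<subseteq> U" if "i \<in> B" for i
        proof -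
          have "snd i \<subseteq> U" using fineD[OF fine, of "fst i" "snd i"] that by (simp add: B_def \<gamma>_def)
          with K[of "fst i" "snd i"] that show ?thesis by (auto simp: B_def)
        qed
      qed (use bnd in auto)
      with \<delta>(2)[OF fin(1) bnd disj] have "(\<Sum>i\<in>B. dist (f (Inf (snd i))) (f (Sup (snd i)))) < \<epsilon> / 2"
        by blast
      moreover have "\<bar>?B\<bar> \<le> (\<Sum>i\<in>B. dist (f (Inf (snd i))) (f (Sup (snd i))))"
        unfolding real_norm_def[symmetric]
        by (rule sum_norm_le) (auto simp: B_def g0_def dist_real_def)
      ultimately show ?thesis unfolding split using G by simp
    qed
    with \<open>gauge \<gamma>\<close> show "\<exists>\<gamma>. gauge \<gamma> \<and> (\<forall>\<D>. \<D> tagged_division_of {a..b} \<and> \<gamma> fine \<D> \<longrightarrow>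
        norm ((\<Sum>(x, k)\<in>\<D>. measure lborel k *\<^sub>R g0 x) - (f b - f a)) < \<epsilon>)"
      by (intro exI[of _ \<gamma>] conjI allI impI) (auto simp only:)
  qed
  then show ?thesis
    by (rule has_integral_spike[OF N, rotated]) (auto simp: g0_def)
qed

text \<open>Lebesgue's differentiation theorem on the line. At a bad point \<open>x\<close> there are arbitrarily short
intervals with end point \<open>x\<close> on which the increment of the integral misses \<open>f x\<close> times the length by more
than \<open>e\<close> times the length. Vitali's theorem selects disjoint ones that still cover almost all bad points.
They form a partial tagged division, on which Henstock's lemma bounds the sum of these
errors, and hence \<open>e\<close> times the total length, by an arbitrarily small number.\<close>

lemma has_real_derivative_indefinite_integral_ae:
  fixes f :: "real \<Rightarrow> real"
  assumes f: "f integrable_on {a..b}"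
  shows "\<exists>N. negligible N \<and> (\<forall>x\<in>{a..b} - N.
    ((\<lambda>t. integral {a..t} f) has_real_derivative f x) (at x within {a..b}))"
proof -
  define F where "F = (\<lambda>t. integral {a..t} f)"
  define D where "D x y = \<bar>F y - F x - f x * (y - x)\<bar>" for x y
  define Bad where "Bad e = {x\<in>{a..b}. \<forall>d>0. \<exists>y\<in>{a..b}. \<bar>y - x\<bar> < d \<and> e * \<bar>y - x\<bar> < D x y}" for e
  have D_int: "D x y = norm (measure lborel {min x y..max x y} *\<^sub>R f x - integral {min x y..max x y} f)"
    if "x \<in> {a..b}" "y \<in> {a..b}" for x y
  proof -
    have *: "integral {u..v} f = F v - F u" if "a \<le> u" "u \<le> v" "v \<le> b" for u v
    proof -
      have "f integrable_on {a..v}"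
        by (rule integrable_subinterval_real[OF f]) (use that in auto)
      from Henstock_Kurzweil_Integration.integral_combine[OF that(1,2) this] show ?thesis by (simp add: F_def)
    qed
    show ?thesis
    proof (cases "x \<le> y")
      case True
      then show ?thesis using *[of x y] that by (simp add: D_def algebra_simps abs_minus_commute)
    next
      case False
      then show ?thesis using *[of y x] that by (simp add: D_def min_def max_def algebra_simps)
    qed
  qed
  have negl: "negligible (Bad e)" if "0 < e" for e
    unfolding negligible_outer_le
  proof (intro allI impI)
    fix \<eta> :: real assume "0 < \<eta>"
    then have "0 < e * \<eta>" using \<open>0 < e\<close> by simp
    then obtain \<gamma> where \<gamma>: "gauge \<gamma>"
      and hen: "\<And>p. \<lbrakk>p tagged_partial_division_of (cbox a b); \<gamma> fine p\<rbrakk> \<Longrightarrow>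
             sum (\<lambda>(x,k). norm (measure lborel k *\<^sub>R f x - integral k f)) p < e * \<eta>"
      using Henstock_lemma[of f a b "e * \<eta>"] f by auto
    \<comment> \<open>A pair \<open>z = (x, y)\<close> stands for the interval between the tag \<open>x\<close> and the witness \<open>y\<close>; \<open>Z\<close>
      collects the pairs that are fine for the gauge and violate the estimate.\<close>
    define I where "I z = {min (fst z) (snd z)..max (fst z) (snd z)}" for z :: "real \<times> real"
    define Z where "Z = {z. fst z \<in> {a..b} \<and> snd z \<in> {a..b} \<and> fst z \<noteq> snd z \<and> I z \<subseteq> \<gamma> (fst z) \<and>
        e * \<bar>snd z - fst z\<bar> < D (fst z) (snd z)}"
    define c where "c z = (fst z + snd z) / 2" for z :: "real \<times> real"
    define r where "r z = \<bar>snd z - fst z\<bar> / 2" for z :: "real \<times> real"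
    have I_eq: "cball (c z) (r z) = I z" for z
      by (auto simp: I_def c_def r_def cball_eq_atLeastAtMost min_def max_def abs_if field_simps)
    obtain C where C: "countable C" "C \<subseteq> Z"
      and pw: "pairwise (\<lambda>i j. disjnt (cball (c i) (r i)) (cball (c j) (r j))) C"
      and rest: "negligible (Bad e - (\<Union>i\<in>C. cball (c i) (r i)))"
    proof (rule Vitali_covering_theorem_cballs[of Z r "Bad e" c])
      show "0 < r z" if "z \<in> Z" for z using that by (auto simp: Z_def r_def)
    next
      fix x d :: real assume x: "x \<in> Bad e" and "0 < d"
      have "open (\<gamma> x)" "x \<in> \<gamma> x" using \<gamma> by (auto simp: gauge_def)
      then obtain d' where d': "0 < d'" "ball x d' \<subseteq> \<gamma> x" using open_contains_ball by blast
      have "0 < min d d'" using \<open>0 < d\<close> d' by simp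
      then obtain y where y: "y \<in> {a..b}" "\<bar>y - x\<bar> < min d d'" "e * \<bar>y - x\<bar> < D x y"
        using x unfolding Bad_def by blast
      have "x \<noteq> y" using y by (auto simp: D_def)
      moreover have "I (x, y) \<subseteq> \<gamma> x"
        using y(2) by (intro subset_trans[OF _ d'(2)]) (auto simp: I_def dist_real_def min_def max_def split: if_splits)
      moreover have "x \<in> I (x, y)" by (simp add: I_def)
      ultimately show "\<exists>z. z \<in> Z \<and> x \<in> cball (c z) (r z) \<and> r z < d"
        using x y unfolding I_eq by (intro exI[of _ "(x, y)"]) (auto simp: Z_def r_def Bad_def)
    qed auto
    have fin_bound: "measure lebesgue (\<Union>z\<in>J. I z) \<le> \<eta>" if J: "J \<subseteq> C" "finite J" for J
    proof -
      define p where "p = (\<lambda>z. (fst z, I z)) ` J"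
      have JZ: "J \<subseteq> Z" using J C by auto
      have disj: "I z \<inter> I w = {}" if "z \<in> J" "w \<in> J" "z \<noteq> w" for z w
        using pw that J unfolding pairwise_def I_eq disjnt_def by blast
      have inj: "inj_on (\<lambda>z. (fst z, I z)) J"
      proof (rule inj_onI)
        fix z w assume zw: "z \<in> J" "w \<in> J" "(fst z, I z) = (fst w, I w)"
        have "fst z \<in> I z" by (simp add: I_def)
        with zw disj[of z w] show "z = w" by auto
      qed
      have "p tagged_partial_division_of cbox a b"
        unfolding tagged_partial_division_of_def
      proof (intro conjI allI impI)
        show "finite p" using J by (simp add: p_def)
      next
        fix x k assume "(x, k) \<in> p"
        then obtain z where z: "z \<in> J" "x = fst z" "k = I z" by (auto simp: p_def)
        then have "z \<in> Z" using JZ by auto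
        show "x \<in> k" using z by (simp add: I_def)
        show "k \<subseteq> cbox a b" using z \<open>z \<in> Z\<close> by (auto simp: I_def Z_def)
        show "\<exists>u v. k = cbox u v" using z by (metis I_def interval_cbox)
      next
        fix x k x' k' assume k': "(x, k) \<in> p \<and> (x', k') \<in> p \<and> (x, k) \<noteq> (x', k')"
        then obtain z w where "z \<in> J" "(x, k) = (fst z, I z)" "w \<in> J" "(x', k') = (fst w, I w)"
          by (auto simp: p_def)
        moreover then have "z \<noteq> w" using k' by metis
        ultimately have "k \<inter> k' = {}" using disj by simp
        then show "interior k \<inter> interior k' = {}" using interior_subset by blast
      qed
      moreover have "\<gamma> fine p"
        using JZ by (auto simp: fine_def p_def Z_def)
      ultimately have less: "sum (\<lambda>(x,k). norm (measure lborel k *\<^sub>R f x - integral k f)) p < e * \<eta>"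
        by (rule hen)
      have "e * measure lebesgue (\<Union>z\<in>J. I z) \<le> e * (\<Sum>z\<in>J. measure lebesgue (I z))"
        using \<open>0 < e\<close> J by (intro mult_left_mono measure_UNION_le) (auto simp: I_def)
      also have "\<dots> = (\<Sum>z\<in>J. e * \<bar>snd z - fst z\<bar>)"
        by (simp add: sum_distrib_left I_def max_def min_def abs_if) (auto intro!: sum.cong)
      also have "\<dots> \<le> (\<Sum>z\<in>J. D (fst z) (snd z))"
        using JZ by (intro sum_mono) (auto simp: Z_def)
      also have "\<dots> = (\<Sum>z\<in>J. norm (measure lborel (I z) *\<^sub>R f (fst z) - integral (I z) f))"
        using JZ by (intro sum.cong) (auto simp: Z_def D_int I_def)
      also have "\<dots> = sum (\<lambda>(x,k). norm (measure lborel k *\<^sub>R f x - integral k f)) p"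
        unfolding p_def by (subst sum.reindex[OF inj]) simp
      finally have "e * measure lebesgue (\<Union>z\<in>J. I z) < e * \<eta>" using less by simp
      then show ?thesis using \<open>0 < e\<close> by simp
    qed
    have "(\<Union>z\<in>C. I z) \<in> lmeasurable" "measure lebesgue (\<Union>z\<in>C. I z) \<le> \<eta>"
      using fmeasurable_UN_bound[OF C(1), of I lebesgue \<eta>] measure_UN_bound[OF C(1), of I lebesgue \<eta>] fin_bound
      by (auto simp: I_def)
    moreover have "measure lebesgue ((\<Union>z\<in>C. I z) \<union> (Bad e - (\<Union>z\<in>C. I z))) = measure lebesgue (\<Union>z\<in>C. I z)"
      using rest calculation unfolding I_eq
      by (intro measure_Un_null_set) (auto simp: negligible_iff_null_sets fmeasurable_def)
    ultimately show "\<exists>T. Bad e \<subseteq> T \<and> T \<in> lmeasurable \<and> measure lebesgue T \<le> \<eta>"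
      using rest negligible_imp_measurable[OF rest] unfolding I_eq
      by (intro exI[of _ "(\<Union>z\<in>C. I z) \<union> (Bad e - (\<Union>z\<in>C. I z))"] conjI fmeasurable.Un) auto
  qed
  define N where "N = (\<Union>n. Bad (1 / real (Suc n)))"
  have "negligible N" unfolding N_def by (intro negligible_countable_Union) (auto intro: negl)
  moreover have "(F has_real_derivative f x) (at x within {a..b})" if x: "x \<in> {a..b} - N" for x
    unfolding has_field_derivative_def has_derivative_within_alt real_norm_def
  proof (intro conjI allI impI)
    fix e :: real assume "0 < e"
    then obtain n where n: "1 / real (Suc n) < e" using reals_Archimedean by (auto simp: inverse_eq_divide)
    have "x \<notin> Bad (1 / real (Suc n))" using x by (auto simp: N_def)
    then have "\<not> (\<forall>d>0. \<exists>y\<in>{a..b}. \<bar>y - x\<bar> < d \<and> 1 / real (Suc n) * \<bar>y - x\<bar> < D x y)"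
      using x by (simp add: Bad_def)
    then obtain d where "d > 0"
      and d: "\<forall>y\<in>{a..b}. \<not> (\<bar>y - x\<bar> < d \<and> 1 / real (Suc n) * \<bar>y - x\<bar> < D x y)"
      by blast
    have "D x y \<le> e * \<bar>y - x\<bar>" if "y \<in> {a..b}" "\<bar>y - x\<bar> < d" for y
    proof -
      have "D x y \<le> 1 / real (Suc n) * \<bar>y - x\<bar>" using bspec[OF d that(1)] that(2) by simp
      also have "\<dots> \<le> e * \<bar>y - x\<bar>" using n by (intro mult_right_mono) auto
      finally show ?thesis .
    qed
    then show "\<exists>d>0. \<forall>y\<in>{a..b}. \<bar>y - x\<bar> < d \<longrightarrow> \<bar>F y - F x - f x * (y - x)\<bar> \<le> e * \<bar>y - x\<bar>"
      using \<open>d > 0\<close> unfolding D_def by blast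
  qed (rule bounded_linear_mult_right)
  ultimately show ?thesis unfolding F_def by blast
qed

lemma integrable_lebesgue_on_subinterval:
  fixes f :: "real \<Rightarrow> real"
  assumes f: "integrable (lebesgue_on {a..b}) f" and "a \<le> u" "v \<le> b"
  shows "integrable (lebesgue_on {u..v}) f" "f integrable_on {u..v}"
    "integral {u..v} f = (\<integral>t. f t \<partial>lebesgue_on {u..v})"
proof -
  show *: "integrable (lebesgue_on {u..v}) f"
    by (rule integrable_subinterval[OF f]) (use assms in auto)
  then show "f integrable_on {u..v}" by (intro integrable_on_lebesgue_on) auto
  show "integral {u..v} f = (\<integral>t. f t \<partial>lebesgue_on {u..v})"
    using * by (intro lebesgue_integral_eq_integral[symmetric]) auto
qed

text \<open>Splitting \<open>\<bar>f\<bar>\<close> at a high level \<open>n\<close> leaves a bounded part, which contributes at most \<open>n\<close> times the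
total length, and an excess \<open>g n\<close>, which has small integral over the whole interval.\<close>

lemma absolutely_continuous_indefinite_integral:
  fixes f :: "real \<Rightarrow> real"
  assumes f: "integrable (lebesgue_on {a..b}) f"
  shows "absolutely_continuous_fun_on a b (\<lambda>t. c + integral {a..t} f)"
  unfolding absolutely_continuous_fun_on_def
proof (intro allI impI)
  fix \<epsilon> :: real assume "0 < \<epsilon>"
  define g where "g n t = \<bar>f t\<bar> - min \<bar>f t\<bar> (real n)" for n t
  have "(\<lambda>n. \<integral>t. g n t \<partial>lebesgue_on {a..b}) \<longlonglongrightarrow> (\<integral>t. 0 \<partial>lebesgue_on {a..b})"
  proof (rule integral_dominated_convergence[where w="\<lambda>t. \<bar>f t\<bar>"])
    show "AE t in lebesgue_on {a..b}. (\<lambda>n. g n t) \<longlonglongrightarrow> 0"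
    proof (rule AE_I2)
      fix t
      obtain n where "\<bar>f t\<bar> \<le> real n" using real_arch_simple by blast
      then have "\<And>k. n \<le> k \<Longrightarrow> g k t = 0" by (simp add: g_def)
      then show "(\<lambda>n. g n t) \<longlonglongrightarrow> 0"
        by (intro tendsto_eventually) (auto simp: eventually_sequentially)
    qed
    show "g n \<in> borel_measurable (lebesgue_on {a..b})" for n
      using borel_measurable_integrable[OF f] unfolding g_def by measurable
  qed (use f in \<open>auto simp: g_def\<close>)
  then have "\<forall>\<^sub>F n in sequentially. (\<integral>t. g n t \<partial>lebesgue_on {a..b}) < \<epsilon> / 2"
    using \<open>0 < \<epsilon>\<close> by (intro order_tendstoD) auto
  then obtain n where n: "(\<integral>t. g n t \<partial>lebesgue_on {a..b}) < \<epsilon> / 2"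
    by (auto simp: eventually_sequentially)
  have g_int: "integrable (lebesgue_on {a..b}) (g n)"
    unfolding g_def using f
    by (intro Bochner_Integration.integrable_diff integrable_abs integrable_min) auto
  define \<delta> where "\<delta> = \<epsilon> / (2 * (real n + 1))"
  have \<delta>: "0 < \<delta>" "real n * \<delta> \<le> \<epsilon> / 2" using \<open>0 < \<epsilon>\<close> by (auto simp: \<delta>_def field_simps)
  have key: "(\<Sum>i<m. dist (c + integral {a..l i} f) (c + integral {a..r i} f)) < \<epsilon>"
    if bnd: "\<forall>i<m. a \<le> l i \<and> l i \<le> r i \<and> r i \<le> b"
      and disj: "disjoint_family_on (\<lambda>i. {l i<..<r i}) {..<m}"
      and len: "(\<Sum>i<m. r i - l i) < \<delta>" for m :: nat and l r
  proof -
    have 1: "dist (c + integral {a..l i} f) (c + integral {a..r i} f) \<le> real n * (r i - l i) + integral {l i..r i} (g n)"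
      if "i < m" for i
    proof -
      have i: "a \<le> l i" "l i \<le> r i" "r i \<le> b" using bnd that by auto
      note sub = integrable_lebesgue_on_subinterval[OF f i(1,3)] integrable_lebesgue_on_subinterval[OF integrable_abs[OF f] i(1,3)]
        integrable_lebesgue_on_subinterval[OF g_int i(1,3)]
      have "integral {a..l i} f + integral {l i..r i} f = integral {a..r i} f"
        using integrable_lebesgue_on_subinterval(2)[OF f order_refl i(3)] i
        by (intro Henstock_Kurzweil_Integration.integral_combine) auto
      then have "dist (c + integral {a..l i} f) (c + integral {a..r i} f) = \<bar>integral {l i..r i} f\<bar>"
        by (simp add: dist_real_def)
      also have "\<dots> \<le> integral {l i..r i} (\<lambda>t. \<bar>f t\<bar>)"
        using sub by (metis integral_norm_bound_integral order_refl real_norm_def)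
      also have "\<dots> \<le> integral {l i..r i} (\<lambda>t. real n + g n t)"
        by (intro integral_le integrable_add sub integrable_const_ivl) (simp add: g_def)
      also have "\<dots> = real n * (r i - l i) + integral {l i..r i} (g n)"
        using i by (subst Henstock_Kurzweil_Integration.integral_add[OF integrable_const_ivl sub(8)]) auto
      finally show ?thesis .
    qed
    have 2: "((\<lambda>t. indicator {l i<..<r i} t * g n t) has_integral integral {l i..r i} (g n)) {a..b}" if "i < m" for i
    proof -
      have i: "a \<le> l i" "l i \<le> r i" "r i \<le> b" using bnd that by auto
      have "(g n has_integral integral {l i..r i} (g n)) {l i..r i}"
        using integrable_lebesgue_on_subinterval(2)[OF g_int i(1,3)] by (rule integrable_integral)
      then have "(g n has_integral integral {l i..r i} (g n)) {l i<..<r i}"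
        by (simp add: has_integral_Icc_iff_Ioo)
      then have "((\<lambda>t. if t \<in> {l i<..<r i} then g n t else 0) has_integral integral {l i..r i} (g n)) {a..b}"
        by (subst has_integral_restrict) (use i in auto)
      then show ?thesis by (rule has_integral_eq[rotated]) (auto simp: indicator_def)
    qed
    have "(\<Sum>i<m. integral {l i..r i} (g n)) \<le> integral {a..b} (g n)"
    proof (rule has_integral_le)
      show "((\<lambda>t. \<Sum>i<m. indicator {l i<..<r i} t * g n t) has_integral (\<Sum>i<m. integral {l i..r i} (g n))) {a..b}"
        by (intro has_integral_sum) (use 2 in auto)
      show "(g n has_integral integral {a..b} (g n)) {a..b}"
        using integrable_lebesgue_on_subinterval(2)[OF g_int order_refl order_refl] by (rule integrable_integral)
      fix t
      have "(\<Sum>i<m. indicator {l i<..<r i} t) = (indicator (\<Union>i<m. {l i<..<r i}) t :: real)"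
        using disj by (intro indicator_UN_disjoint[symmetric]) auto
      also have "\<dots> \<le> 1" by (simp add: indicator_def)
      finally have "(\<Sum>i<m. indicator {l i<..<r i} t) * g n t \<le> 1 * g n t"
        by (intro mult_right_mono) (auto simp: g_def)
      then show "(\<Sum>i<m. indicator {l i<..<r i} t * g n t) \<le> g n t"
        by (simp add: sum_distrib_right)
    qed
    also have "\<dots> < \<epsilon> / 2" using n integrable_lebesgue_on_subinterval(3)[OF g_int order_refl order_refl] by simp
    finally have 3: "(\<Sum>i<m. integral {l i..r i} (g n)) < \<epsilon> / 2" .
    have "(\<Sum>i<m. dist (c + integral {a..l i} f) (c + integral {a..r i} f)) \<le>
        (\<Sum>i<m. real n * (r i - l i) + integral {l i..r i} (g n))"
      using 1 by (intro sum_mono) auto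
    also have "\<dots> = real n * (\<Sum>i<m. r i - l i) + (\<Sum>i<m. integral {l i..r i} (g n))"
      by (simp add: sum.distrib sum_distrib_left)
    also have "\<dots> < real n * \<delta> + \<epsilon> / 2"
      using 3 len mult_left_mono[of "\<Sum>i<m. r i - l i" \<delta> "real n"] by linarith
    also have "\<dots> \<le> \<epsilon>" using \<delta> by simp
    finally show ?thesis .
  qed
  show "\<exists>\<delta>>0. \<forall>(m::nat) l r. (\<forall>i<m. a \<le> l i \<and> l i \<le> r i \<and> r i \<le> b) \<and>
      disjoint_family_on (\<lambda>i. {l i<..<r i}) {..<m} \<and> (\<Sum>i<m. r i - l i) < \<delta> \<longrightarrow>
      (\<Sum>i<m. dist (c + integral {a..l i} f) (c + integral {a..r i} f)) < \<epsilon>"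
  proof (intro exI conjI allI impI)
    show "0 < \<delta>" by (rule \<delta>(1))
  next
    fix m :: nat and l r
    assume "(\<forall>i<m. a \<le> l i \<and> l i \<le> r i \<and> r i \<le> b) \<and>
      disjoint_family_on (\<lambda>i. {l i<..<r i}) {..<m} \<and> (\<Sum>i<m. r i - l i) < \<delta>"
    then show "(\<Sum>i<m. dist (c + integral {a..l i} f) (c + integral {a..r i} f)) < \<epsilon>"
      using key by blast
  qed
qed

lemma absolutely_continuous_fun_on_subinterval:
  assumes ac: "absolutely_continuous_fun_on c d f" and "c \<le> c'" "d' \<le> d"
  shows "absolutely_continuous_fun_on c' d' f"
  unfolding absolutely_continuous_fun_on_def
proof (intro allI impI)
  fix \<epsilon> :: real assume "0 < \<epsilon>"
  then obtain \<delta> where "0 < \<delta>" and \<delta>: "\<And>(n::nat) l r.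
        (\<forall>i<n. c \<le> l i \<and> l i \<le> r i \<and> r i \<le> d) \<and>
        disjoint_family_on (\<lambda>i. {l i<..<r i}) {..<n} \<and>
        (\<Sum>i<n. r i - l i) < \<delta> \<Longrightarrow> (\<Sum>i<n. dist (f (l i)) (f (r i))) < \<epsilon>"
    using ac unfolding absolutely_continuous_fun_on_def by blast
  show "\<exists>\<delta>>0. \<forall>(n::nat) l r. (\<forall>i<n. c' \<le> l i \<and> l i \<le> r i \<and> r i \<le> d') \<and>
        disjoint_family_on (\<lambda>i. {l i<..<r i}) {..<n} \<and>
        (\<Sum>i<n. r i - l i) < \<delta> \<longrightarrow> (\<Sum>i<n. dist (f (l i)) (f (r i))) < \<epsilon>"
  proof (intro exI conjI allI impI)
    fix n :: nat and l r
    assume *: "(\<forall>i<n. c' \<le> l i \<and> l i \<le> r i \<and> r i \<le> d') \<and>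
        disjoint_family_on (\<lambda>i. {l i<..<r i}) {..<n} \<and> (\<Sum>i<n. r i - l i) < \<delta>"
    then have "\<forall>i<n. c \<le> l i \<and> l i \<le> r i \<and> r i \<le> d" using assms(2,3) by force
    with * show "(\<Sum>i<n. dist (f (l i)) (f (r i))) < \<epsilon>" by (intro \<delta>) blast
  qed fact
qed

lemma absolutely_continuous_fun_on_imp_continuous_on:
  assumes ac: "absolutely_continuous_fun_on c d f"
  shows "continuous_on {c..d} f"
  unfolding continuous_on_iff
proof (intro ballI allI impI)
  fix x \<epsilon> :: real assume x: "x \<in> {c..d}" and "0 < \<epsilon>"
  obtain \<delta> where \<delta>: "0 < \<delta>"
    "\<And>P l r. \<lbrakk>finite (P :: unit set); \<And>i. i \<in> P \<Longrightarrow> c \<le> l i \<and> l i \<le> r i \<and> r i \<le> d;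
        disjoint_family_on (\<lambda>i. {l i<..<r i}) P; (\<Sum>i\<in>P. r i - l i) < \<delta>\<rbrakk>
      \<Longrightarrow> (\<Sum>i\<in>P. dist (f (l i)) (f (r i))) < \<epsilon>"
    using absolutely_continuous_fun_on_finite_family[OF ac \<open>0 < \<epsilon>\<close>] by blast
  have one: "dist (f u) (f v) < \<epsilon>" if "c \<le> u" "u \<le> v" "v \<le> d" "v - u < \<delta>" for u v
    using \<delta>(2)[of "{()}" "\<lambda>_. u" "\<lambda>_. v"] that by (simp add: disjoint_family_on_def)
  have "dist (f y) (f x) < \<epsilon>" if "y \<in> {c..d}" "dist y x < \<delta>" for y
  proof (cases "x \<le> y")
    case True
    then show ?thesis using one[of x y] x that by (simp add: dist_real_def dist_commute)
  next
    case False
    then show ?thesis using one[of y x] x that by (simp add: dist_real_def)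
  qed
  then show "\<exists>\<delta>>0. \<forall>y\<in>{c..d}. dist y x < \<delta> \<longrightarrow> dist (f y) (f x) < \<epsilon>" using \<delta>(1) by blast
qed

section \<open>The logarithmic mean and the action\<close>

lemma log_mean_integrand_integrable:
  assumes "0 \<le> u" "0 \<le> v"
  shows "(\<lambda>\<xi>::real. u powr \<xi> * v powr (1 - \<xi>)) integrable_on {0..1}"
proof (cases "u = 0 \<or> v = 0")
  case False
  with assms show ?thesis
    by (intro integrable_continuous_real continuous_intros) auto
qed auto

lemma log_mean_nonneg: "0 \<le> log_mean u v"
  unfolding log_mean_def
  by (cases "(\<lambda>\<xi>. u powr \<xi> * v powr (1 - \<xi>)) integrable_on {0..1}")
     (auto intro: Henstock_Kurzweil_Integration.integral_nonneg simp: not_integrable_integral)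

lemma log_mean_commute:
  assumes "0 \<le> u" "0 \<le> v"
  shows "log_mean u v = log_mean v u"
proof (cases "u = 0 \<or> v = 0 \<or> u = v")
  case False
  with assms have pos: "0 < u" "0 < v" "u \<noteq> v" by auto
  then have "ln u - ln v \<noteq> 0" "ln v - ln u \<noteq> 0" by auto
  then have "(u - v) / (ln u - ln v) = (v - u) / (ln v - ln u)" by (simp add: field_simps)
  then show ?thesis using pos by (simp add: log_mean_distinct)
qed auto

lemma log_mean_scale:
  assumes "0 \<le> c"
  shows "log_mean (c * u) (c * v) = c * log_mean u v"
proof (cases "c = 0")
  case False
  then have "(c * u) powr \<xi> * (c * v) powr (1 - \<xi>) = c * (u powr \<xi> * v powr (1 - \<xi>))" for \<xi>
    using assms powr_add[of c \<xi> "1 - \<xi>"] by (simp add: powr_mult)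
  then show ?thesis by (simp add: log_mean_def)
qed simp

lemma log_mean_le:
  assumes "0 \<le> u" "0 \<le> v" "u \<le> M" "v \<le> M"
  shows "log_mean u v \<le> M"
proof -
  have "u powr \<xi> * v powr (1 - \<xi>) \<le> M powr \<xi> * M powr (1 - \<xi>)" if "\<xi> \<in> {0..1}" for \<xi>
    using that assms by (intro mult_mono powr_mono2) auto
  then have "log_mean u v \<le> log_mean M M"
    unfolding log_mean_def using assms by (intro integral_le log_mean_integrand_integrable) auto
  then show ?thesis using assms by (simp add: log_mean_same)
qed

text \<open>Both sides are homogeneous, so after division by \<open>(u + u') powr \<xi> * (v + v') powr (1 - \<xi>)\<close> the claim
follows by adding two instances of Young's inequality.\<close>

lemma weighted_geometric_mean_superadditive:
  fixes u v u' v' :: real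
  assumes "0 \<le> u" "0 \<le> v" "0 \<le> u'" "0 \<le> v'" "0 \<le> \<xi>" "\<xi> \<le> 1"
  shows "u powr \<xi> * v powr (1 - \<xi>) + u' powr \<xi> * v' powr (1 - \<xi>) \<le> (u + u') powr \<xi> * (v + v') powr (1 - \<xi>)"
proof (cases "u + u' = 0 \<or> v + v' = 0")
  case True
  with assms have "(u = 0 \<and> u' = 0) \<or> (v = 0 \<and> v' = 0)" by auto
  then show ?thesis by auto
next
  case False
  define s t where "s = u + u'" and "t = v + v'"
  have pos: "0 < s" "0 < t" using False assms by (auto simp: s_def t_def)
  have young: "x powr \<xi> * y powr (1 - \<xi>) \<le> s powr \<xi> * t powr (1 - \<xi>) * (\<xi> * (x / s) + (1 - \<xi>) * (y / t))"
    if "0 \<le> x" "0 \<le> y" for x y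
  proof (cases "x = 0 \<or> y = 0")
    case True
    then show ?thesis using pos assms that by auto
  next
    case False
    then have "(x / s) powr \<xi> * (y / t) powr (1 - \<xi>) \<le> \<xi> * (x / s) + (1 - \<xi>) * (y / t)"
      using pos assms that by (intro Youngs_inequality_0) auto
    then have "s powr \<xi> * t powr (1 - \<xi>) * ((x / s) powr \<xi> * (y / t) powr (1 - \<xi>)) \<le>
        s powr \<xi> * t powr (1 - \<xi>) * (\<xi> * (x / s) + (1 - \<xi>) * (y / t))"
      by (intro mult_left_mono) auto
    then show ?thesis using pos that by (simp add: powr_divide)
  qed
  have "u powr \<xi> * v powr (1 - \<xi>) + u' powr \<xi> * v' powr (1 - \<xi>) \<le>
      s powr \<xi> * t powr (1 - \<xi>) * (\<xi> * ((u + u') / s) + (1 - \<xi>) * ((v + v') / t))"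
    using young[of u v] young[of u' v'] assms by (simp add: algebra_simps add_divide_distrib)
  also have "\<dots> = s powr \<xi> * t powr (1 - \<xi>)"
    using pos unfolding s_def[symmetric] t_def[symmetric] by simp
  finally show ?thesis by (simp add: s_def t_def)
qed

lemma log_mean_superadditive:
  assumes "0 \<le> u" "0 \<le> v" "0 \<le> u'" "0 \<le> v'"
  shows "log_mean u v + log_mean u' v' \<le> log_mean (u + u') (v + v')"
proof -
  have "log_mean u v + log_mean u' v' =
      integral {0..1} (\<lambda>\<xi>. u powr \<xi> * v powr (1 - \<xi>) + u' powr \<xi> * v' powr (1 - \<xi>))"
    unfolding log_mean_def using assms
    by (intro Henstock_Kurzweil_Integration.integral_add[symmetric] log_mean_integrand_integrable)
  also have "\<dots> \<le> log_mean (u + u') (v + v')"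
    unfolding log_mean_def using assms
    by (intro integral_le integrable_add log_mean_integrand_integrable weighted_geometric_mean_superadditive) auto
  finally show ?thesis .
qed

text \<open>The form of concavity that convexity of the energy rests on: superadditivity together with
homogeneity of degree one.\<close>

lemma log_mean_midpoint:
  assumes "0 \<le> u" "0 \<le> v" "0 \<le> u'" "0 \<le> v'"
  shows "(log_mean u v + log_mean u' v') / 2 \<le> log_mean ((u + u') / 2) ((v + v') / 2)"
  using log_mean_superadditive[OF assms] log_mean_scale[of "1/2" "u + u'" "v + v'"] by simp

text \<open>At the end points of the integration variable the integrand \<open>u powr \<xi> * v powr (1 - \<xi>)\<close>
jumps when \<open>u\<close> or \<open>v\<close> tends to zero. On the open interval it is continuous in \<open>u\<close> and \<open>v\<close>, and there
dominated convergence applies.\<close>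

lemma tendsto_log_mean:
  assumes lim: "f \<longlonglongrightarrow> u" "g \<longlonglongrightarrow> v" and nonneg: "\<And>n. 0 \<le> f n" "\<And>n. 0 \<le> g n"
  shows "(\<lambda>n. log_mean (f n) (g n)) \<longlonglongrightarrow> log_mean u v"
proof -
  have uv: "0 \<le> u" "0 \<le> v"
    using lim nonneg by (auto intro: LIMSEQ_le_const)
  obtain B where B: "\<And>n. f n \<le> B" "\<And>n. g n \<le> B"
  proof -
    obtain A C where "\<And>n. norm (f n) \<le> A" "\<And>n. norm (g n) \<le> C"
      using lim[THEN convergentI, THEN convergent_imp_Bseq] unfolding Bseq_def by blast
    then have "f n \<le> max A C" "g n \<le> max A C" for n
      by (smt (verit) real_norm_def)+
    then show thesis using that by blast
  qed
  have eq: "log_mean x y = integral {0<..<1} (\<lambda>\<xi>. x powr \<xi> * y powr (1 - \<xi>))" for x y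
    unfolding log_mean_def by (rule integral_open_interval_real)
  have int: "(\<lambda>\<xi>::real. x powr \<xi> * y powr (1 - \<xi>)) integrable_on {0<..<1}" if "0 \<le> x" "0 \<le> y" for x y
    using log_mean_integrand_integrable[OF that] by (simp add: integrable_on_Icc_iff_Ioo)
  show ?thesis
    unfolding eq
  proof (rule dominated_convergence(2)[where h="\<lambda>_. B"])
    show "(\<lambda>\<xi>::real. f n powr \<xi> * g n powr (1 - \<xi>)) integrable_on {0<..<1}" for n
      by (intro int nonneg)
    show "(\<lambda>_::real. B) integrable_on {0<..<1}"
      using integrable_const_ivl[of B 0 1] by (rule integrable_on_Icc_iff_Ioo[THEN iffD1])
    fix \<xi> :: real assume \<xi>: "\<xi> \<in> {0<..<1}"
    have B0: "0 \<le> B" using nonneg(1)[of 0] B(1)[of 0] by simp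
    show "norm (f n powr \<xi> * g n powr (1 - \<xi>)) \<le> B" for n
    proof -
      have "f n powr \<xi> * g n powr (1 - \<xi>) \<le> B powr \<xi> * B powr (1 - \<xi>)"
        using \<xi> B nonneg by (intro mult_mono powr_mono2) auto
      also have "\<dots> = B" using B0 by (simp flip: powr_add)
      finally show ?thesis by simp
    qed
    show "(\<lambda>n. f n powr \<xi> * g n powr (1 - \<xi>)) \<longlonglongrightarrow> u powr \<xi> * v powr (1 - \<xi>)"
      using \<xi> nonneg lim by (intro tendsto_mult tendsto_powr' tendsto_const) auto
  qed
qed

text \<open>Clipping the arguments at zero extends the mean continuously from the closed quadrant to the plane,
which makes it Borel measurable.\<close>

lemma continuous_log_mean: "continuous_on UNIV (\<lambda>z. log_mean (max 0 (fst z)) (max 0 (snd z)))"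
  unfolding continuous_on_sequentially comp_def
  by (auto intro!: tendsto_log_mean tendsto_max dest: tendsto_fst tendsto_snd)

lemma borel_measurable_log_mean:
  assumes [measurable]: "f \<in> borel_measurable M" "g \<in> borel_measurable M"
    and nonneg: "\<And>t. t \<in> space M \<Longrightarrow> 0 \<le> f t" "\<And>t. t \<in> space M \<Longrightarrow> 0 \<le> g t"
  shows "(\<lambda>t. log_mean (f t) (g t)) \<in> borel_measurable M"
proof -
  have "(\<lambda>t. (\<lambda>z. log_mean (max 0 (fst z)) (max 0 (snd z))) (f t, g t)) \<in> borel_measurable M"
    by (rule measurable_compose[OF borel_measurable_Pair[OF assms(1,2)] borel_measurable_continuous_onI[OF continuous_log_mean]])
  then show ?thesis
    by (rule measurable_cong[THEN iffD1, rotated]) (simp add: nonneg)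
qed

text \<open>A single inequality of real numbers that covers the conventions for division by zero as well; both
convexity and lower semicontinuity of the action are read off from it.\<close>

lemma action_density_le_iff:
  assumes "0 \<le> e"
  shows "action_density v s t \<le> ennreal e \<longleftrightarrow> v\<^sup>2 \<le> e * log_mean s t"
proof (cases "log_mean s t = 0")
  case True
  then show ?thesis by (simp add: action_density_zero_mean top_unique)
next
  case False
  then have "0 < log_mean s t" using log_mean_nonneg[of s t] by simp
  then show ?thesis using assms
    by (simp add: action_density_def divide_ennreal ennreal_le_iff field_simps)
qed

text \<open>With \<open>v\<^sup>2 \<le> e a\<close> and \<open>v'\<^sup>2 \<le> e' b\<close>, where \<open>a\<close> and \<open>b\<close> are the two means, the Cauchy--Schwarz
inequality gives \<open>(v + v')\<^sup>2 \<le> (e + e') (a + b)\<close>, and concavity of the mean does the rest.\<close>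

lemma action_density_midpoint:
  assumes "0 \<le> s" "0 \<le> t" "0 \<le> s'" "0 \<le> t'"
  shows "2 * action_density ((v + v') / 2) ((s + s') / 2) ((t + t') / 2) \<le>
    action_density v s t + action_density v' s' t'"
proof (cases "action_density v s t = \<infinity> \<or> action_density v' s' t' = \<infinity>")
  case True
  then show ?thesis by (metis ennreal_add_eq_top infinity_ennreal_def top_greatest)
next
  case False
  then obtain e e' where e: "action_density v s t = ennreal e" "action_density v' s' t' = ennreal e'" "0 \<le> e" "0 \<le> e'"
    by (metis ennreal_cases infinity_ennreal_def)
  define a b where "a = log_mean s t" and "b = log_mean s' t'"
  have ab: "0 \<le> a" "0 \<le> b" by (simp_all add: a_def b_def log_mean_nonneg)
  have le: "v\<^sup>2 \<le> e * a" "v'\<^sup>2 \<le> e' * b"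
    using action_density_le_iff[OF e(3), of v s t] action_density_le_iff[OF e(4), of v' s' t'] e
    by (auto simp: a_def b_def)
  have "(2 * (v * v'))\<^sup>2 = 4 * (v\<^sup>2 * v'\<^sup>2)" by (simp add: power2_eq_square)
  also have "\<dots> \<le> 4 * ((e * a) * (e' * b))" using le by (intro mult_left_mono mult_mono) (auto simp: ab e)
  also have "\<dots> \<le> (e * b + e' * a)\<^sup>2"
    using zero_le_power2[of "e * b - e' * a"] by (simp add: power2_eq_square algebra_simps)
  finally have "2 * (v * v') \<le> e * b + e' * a" by (rule power2_le_imp_le) (auto simp: ab e)
  with le have "(v + v')\<^sup>2 \<le> (e + e') * (a + b)" by (simp add: power2_eq_square algebra_simps)
  then have "((v + v') / 2)\<^sup>2 \<le> (e + e') / 2 * ((a + b) / 2)" by (simp add: power_divide)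
  also have "\<dots> \<le> (e + e') / 2 * log_mean ((s + s') / 2) ((t + t') / 2)"
    using log_mean_midpoint[OF assms] e by (intro mult_left_mono) (auto simp: a_def b_def)
  finally have "action_density ((v + v') / 2) ((s + s') / 2) ((t + t') / 2) \<le> ennreal ((e + e') / 2)"
    using e by (subst action_density_le_iff) auto
  then have "2 * action_density ((v + v') / 2) ((s + s') / 2) ((t + t') / 2) \<le> ennreal 2 * ennreal ((e + e') / 2)"
    by (simp add: mult_left_mono)
  also have "\<dots> = ennreal (2 * ((e + e') / 2))" using e(3,4) by (intro ennreal_mult[symmetric]) auto
  also have "\<dots> = ennreal e + ennreal e'" using e(3,4) by (simp add: ennreal_plus del: distrib_left_numeral)
  finally show ?thesis by (simp add: e)
qed

text \<open>The action exceeds \<open>e\<close> exactly if \<open>v\<^sup>2 > e \<theta>(s, t)\<close>, which is an open condition since the mean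
is continuous.\<close>

lemma action_density_lower_semicontinuous:
  assumes lim: "v \<longlonglongrightarrow> v0" "s \<longlonglongrightarrow> s0" "t \<longlonglongrightarrow> t0"
    and nonneg: "\<And>n. 0 \<le> s n" "\<And>n. 0 \<le> t n"
  shows "action_density v0 s0 t0 \<le> liminf (\<lambda>n. action_density (v n) (s n) (t n))"
  unfolding le_Liminf_iff
proof (intro allI impI)
  fix y assume y: "y < action_density v0 s0 t0"
  then obtain e where e: "y = ennreal e" "0 \<le> e" by (metis ennreal_cases not_top_less top_greatest leD)
  have "(\<lambda>n. (v n)\<^sup>2 - e * log_mean (s n) (t n)) \<longlonglongrightarrow> v0\<^sup>2 - e * log_mean s0 t0"
    by (intro tendsto_intros lim tendsto_log_mean nonneg)
  moreover have "0 < v0\<^sup>2 - e * log_mean s0 t0"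
    using y action_density_le_iff[OF e(2), of v0 s0 t0] by (simp add: e not_le[symmetric])
  ultimately have "\<forall>\<^sub>F n in sequentially. 0 < (v n)\<^sup>2 - e * log_mean (s n) (t n)"
    by (rule order_tendstoD(1))
  then show "\<forall>\<^sub>F n in sequentially. y < action_density (v n) (s n) (t n)"
    by eventually_elim (simp add: e action_density_le_iff[OF e(2)] flip: not_le)
qed

lemma borel_measurable_action_density:
  assumes [measurable]: "v \<in> borel_measurable M" "f \<in> borel_measurable M" "g \<in> borel_measurable M"
    and nonneg: "\<And>t. t \<in> space M \<Longrightarrow> 0 \<le> f t" "\<And>t. t \<in> space M \<Longrightarrow> 0 \<le> g t"
  shows "(\<lambda>t. action_density (v t) (f t) (g t)) \<in> borel_measurable M"
proof -
  note [measurable] = borel_measurable_log_mean[OF assms(2,3) nonneg]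
  show ?thesis unfolding action_density_def by measurable
qed

text \<open>Fatou's lemma for the measure with masses \<open>w\<close> on a finite set.\<close>

lemma sum_liminf_le_liminf_sum:
  fixes f :: "nat \<Rightarrow> 'i::finite \<Rightarrow> ennreal" and w :: "'i \<Rightarrow> ennreal"
  shows "(\<Sum>i\<in>UNIV. w i * liminf (\<lambda>n. f n i)) \<le> liminf (\<lambda>n. \<Sum>i\<in>UNIV. w i * f n i)"
  using nn_integral_liminf[of f "point_measure UNIV w"]
  by (simp add: nn_integral_point_measure_finite)

lemma liminf_add_ennreal:
  fixes f g :: "nat \<Rightarrow> ennreal"
  shows "liminf f + liminf g \<le> liminf (\<lambda>n. f n + g n)"
  using sum_liminf_le_liminf_sum[of "\<lambda>_. 1" "\<lambda>n i. if i then f n else g n"]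
  by (simp add: UNIV_bool add.commute)

definition edge_weight :: "('x \<Rightarrow> 'x \<Rightarrow> real) \<Rightarrow> ('x \<Rightarrow> real) \<Rightarrow> 'x \<times> 'x \<Rightarrow> ennreal" where
  "edge_weight K \<pi> = (\<lambda>(x, y). ennreal (1/2) * ennreal (K x y) * ennreal (\<pi> x))"

lemma flux_action_eq_sum:
  "flux_action K \<pi> \<mu> V = (\<Sum>z\<in>UNIV. edge_weight K \<pi> z * action_density (V (fst z) (snd z)) (\<mu> (fst z)) (\<mu> (snd z)))"
  unfolding flux_action_def edge_weight_def
  by (simp add: sum_distrib_left sum.cartesian_product split_def mult_ac UNIV_Times_UNIV[symmetric] del: UNIV_Times_UNIV)

lemma flux_action_midpoint:
  assumes "\<And>x. 0 \<le> \<mu> x" "\<And>x. 0 \<le> \<mu>' x"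
  shows "2 * flux_action K \<pi> (\<lambda>x. (\<mu> x + \<mu>' x) / 2) (\<lambda>x y. (V x y + V' x y) / 2) \<le>
    flux_action K \<pi> \<mu> V + flux_action K \<pi> \<mu>' V'"
proof -
  have "edge_weight K \<pi> z * (2 * action_density ((V (fst z) (snd z) + V' (fst z) (snd z)) / 2)
        ((\<mu> (fst z) + \<mu>' (fst z)) / 2) ((\<mu> (snd z) + \<mu>' (snd z)) / 2)) \<le>
      edge_weight K \<pi> z * action_density (V (fst z) (snd z)) (\<mu> (fst z)) (\<mu> (snd z)) +
      edge_weight K \<pi> z * action_density (V' (fst z) (snd z)) (\<mu>' (fst z)) (\<mu>' (snd z))" for z
    unfolding distrib_left[symmetric]
    by (intro mult_left_mono action_density_midpoint assms) auto
  then show ?thesis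
    unfolding flux_action_eq_sum sum.distrib[symmetric] sum_distrib_left
    by (intro sum_mono) (metis mult.left_commute)
qed

lemma flux_action_lower_semicontinuous:
  assumes "\<And>x y. (\<lambda>n. V n x y) \<longlonglongrightarrow> V0 x y" "\<And>x. (\<lambda>n. \<mu> n x) \<longlonglongrightarrow> \<mu>0 x" "\<And>n x. 0 \<le> \<mu> n x"
  shows "flux_action K \<pi> \<mu>0 V0 \<le> liminf (\<lambda>n. flux_action K \<pi> (\<mu> n) (V n))"
proof -
  have "flux_action K \<pi> \<mu>0 V0 \<le> (\<Sum>z\<in>UNIV. edge_weight K \<pi> z *
      liminf (\<lambda>n. action_density (V n (fst z) (snd z)) (\<mu> n (fst z)) (\<mu> n (snd z))))"
    unfolding flux_action_eq_sum
    by (intro sum_mono mult_left_mono action_density_lower_semicontinuous assms) auto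
  also have "\<dots> \<le> liminf (\<lambda>n. flux_action K \<pi> (\<mu> n) (V n))"
    unfolding flux_action_eq_sum by (rule sum_liminf_le_liminf_sum)
  finally show ?thesis .
qed

lemma borel_measurable_flux_action:
  assumes "\<And>x y. (\<lambda>t. V t x y) \<in> borel_measurable M" "\<And>x. (\<lambda>t. \<mu> t x) \<in> borel_measurable M"
    and "\<And>t x. t \<in> space M \<Longrightarrow> 0 \<le> \<mu> t x"
  shows "(\<lambda>t. flux_action K \<pi> (\<mu> t) (V t)) \<in> borel_measurable M"
  unfolding flux_action_eq_sum
  by (intro borel_measurable_sum borel_measurable_times_ennreal borel_measurable_const
      borel_measurable_action_density assms)

lemma action_density_gradient:
  "action_density (d * log_mean s t) s t = ennreal (d\<^sup>2 * log_mean s t)"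
proof (cases "log_mean s t = 0")
  case False
  then have "0 < log_mean s t" using log_mean_nonneg[of s t] by simp
  moreover from this have "(d * log_mean s t)\<^sup>2 / log_mean s t = d\<^sup>2 * log_mean s t"
    by (simp add: power2_eq_square)
  ultimately show ?thesis by (simp add: action_density_def divide_ennreal)
qed (simp add: action_density_zero_mean)

lemma flux_action_ge_term:
  "edge_weight K \<pi> (x, y) * action_density (V x y) (\<mu> x) (\<mu> y) \<le> flux_action K \<pi> \<mu> V"
  unfolding flux_action_eq_sum
  using member_le_sum[of "(x, y)" UNIV "\<lambda>z. edge_weight K \<pi> z * action_density (V (fst z) (snd z)) (\<mu> (fst z)) (\<mu> (snd z))"]
  by simp

section \<open>Convex minimising sequences in \<open>L\<^sup>2\<close>\<close>

text \<open>Finiteness of the measure enters through \<open>x \<le> 1 + x\<^sup>2\<close>.\<close>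

lemma (in finite_measure) integrable_if_square_integrable:
  fixes u :: "'a \<Rightarrow> 'e::{banach, second_countable_topology}"
  assumes [measurable]: "u \<in> borel_measurable M" and fin: "(\<integral>\<^sup>+t. ennreal ((norm (u t))\<^sup>2) \<partial>M) < \<infinity>"
  shows "integrable M (\<lambda>t. (norm (u t))\<^sup>2)" "integrable M u"
proof -
  show sq: "integrable M (\<lambda>t. (norm (u t))\<^sup>2)"
    using fin by (intro integrableI_bounded) simp_all
  show "integrable M u"
  proof (rule Bochner_Integration.integrable_bound)
    show "integrable M (\<lambda>t. 1 + (norm (u t))\<^sup>2)"
      by (intro Bochner_Integration.integrable_add sq) auto
    have "x \<le> 1 + x\<^sup>2" for x :: real
      using zero_le_power2[of "x - 1/2"] by (simp add: power2_eq_square algebra_simps)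
    then show "AE t in M. norm (u t) \<le> norm (1 + (norm (u t))\<^sup>2)" by simp
  qed simp
qed

text \<open>The argument behind the completeness of \<open>L\<^sup>1\<close>: summable increments make the telescoping series
converge absolutely almost everywhere, and the sum of their norms is the common integrable bound.\<close>

lemma AE_summable_norm_increments:
  fixes u :: "nat \<Rightarrow> 'a \<Rightarrow> 'e::euclidean_space"
  assumes int: "\<And>n. integrable M (u n)"
    and sum: "summable (\<lambda>n. \<integral>t. norm (u (Suc n) t - u n t) \<partial>M)"
  obtains w g where "w \<in> borel_measurable M" "integrable M g"
    "AE t in M. (\<lambda>n. u n t) \<longlonglongrightarrow> w t" "AE t in M. \<forall>n. norm (u n t) \<le> g t"
proof -
  define \<delta> where "\<delta> = (\<lambda>n t. norm (u (Suc n) t - u n t))"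
  have \<delta>_int: "integrable M (\<delta> n)" for n
    unfolding \<delta>_def by (intro integrable_norm Bochner_Integration.integrable_diff int)
  note [measurable] = borel_measurable_integrable[OF \<delta>_int] borel_measurable_integrable[OF int]
  have "(\<integral>\<^sup>+t. (\<Sum>n. ennreal (\<delta> n t)) \<partial>M) = (\<Sum>n. \<integral>\<^sup>+t. ennreal (\<delta> n t) \<partial>M)"
    by (intro nn_integral_suminf) auto
  also have "\<dots> = (\<Sum>n. ennreal (\<integral>t. \<delta> n t \<partial>M))"
    by (intro suminf_cong nn_integral_eq_integral \<delta>_int) (auto simp: \<delta>_def)
  also have "\<dots> < \<infinity>"
    using sum by (subst suminf_ennreal2) (auto simp: \<delta>_def)
  finally have "AE t in M. (\<Sum>n. ennreal (\<delta> n t)) \<noteq> \<infinity>"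
    by (intro nn_integral_PInf_AE) auto
  then have summ: "AE t in M. summable (\<lambda>n. \<delta> n t)"
    by eventually_elim (intro summable_suminf_not_top, auto simp: \<delta>_def)
  define g where "g t = norm (u 0 t) + (\<Sum>n. \<delta> n t)" for t
  show thesis
  proof (rule that)
    show "(\<lambda>t. lim (\<lambda>n. u n t)) \<in> borel_measurable M" by measurable
    show "integrable M g"
      unfolding g_def using summ sum \<delta>_int int
      by (intro Bochner_Integration.integrable_add integrable_norm integrable_suminf) (auto simp: \<delta>_def)
    have tele: "u n t = u 0 t + (\<Sum>i<n. u (Suc i) t - u i t)" for n t
      by (simp add: sum_lessThan_telescope[of "\<lambda>i. u i t"])
    show "AE t in M. (\<lambda>n. u n t) \<longlonglongrightarrow> lim (\<lambda>n. u n t)"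
      using summ
    proof eventually_elim
      fix t assume "summable (\<lambda>n. \<delta> n t)"
      then have "summable (\<lambda>i. u (Suc i) t - u i t)"
        unfolding \<delta>_def by (rule summable_norm_cancel)
      then have "(\<lambda>n. u 0 t + (\<Sum>i<n. u (Suc i) t - u i t)) \<longlonglongrightarrow> u 0 t + (\<Sum>i. u (Suc i) t - u i t)"
        by (intro tendsto_intros summable_LIMSEQ)
      then show "(\<lambda>n. u n t) \<longlonglongrightarrow> lim (\<lambda>n. u n t)"
        unfolding tele[symmetric] by (metis convergentI convergent_LIMSEQ_iff)
    qed
    show "AE t in M. \<forall>n. norm (u n t) \<le> g t"
      using summ
    proof eventually_elim
      fix t assume s: "summable (\<lambda>n. \<delta> n t)"
      show "\<forall>n. norm (u n t) \<le> g t"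
      proof
        fix n
        have "norm (u n t) \<le> norm (u 0 t) + norm (\<Sum>i<n. u (Suc i) t - u i t)"
          by (subst tele) (rule norm_triangle_ineq)
        also have "norm (\<Sum>i<n. u (Suc i) t - u i t) \<le> (\<Sum>i<n. \<delta> i t)"
          unfolding \<delta>_def by (rule norm_sum)
        also have "\<dots> \<le> (\<Sum>i. \<delta> i t)"
          using s by (intro sum_le_suminf) (auto simp: \<delta>_def)
        finally show "norm (u n t) \<le> g t" by (simp add: g_def)
      qed
    qed
  qed
qed

text \<open>Substitutes for weak compactness. Let \<open>d n\<close> be the infimum of the squared norm on \<open>C n\<close>; these numbers
increase to a finite limit \<open>D\<close>. If \<open>u\<close> and \<open>v\<close> lie in \<open>C n\<close> and their squared norms hardly exceed
\<open>D\<close>, while that of their midpoint is at least \<open>d n\<close>, which is close to \<open>D\<close>, then the parallelogram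
identity forces \<open>u - v\<close> to be small. Choosing the elements fast enough makes the increments summable.\<close>

lemma nested_midpoint_convex_L2_limit:
  fixes C :: "nat \<Rightarrow> ('a \<Rightarrow> 'e::euclidean_space) set"
  assumes "finite_measure M"
    and nonempty: "\<And>n. C n \<noteq> {}"
    and dec: "\<And>n. C (Suc n) \<subseteq> C n"
    and mid: "\<And>n u v. u \<in> C n \<Longrightarrow> v \<in> C n \<Longrightarrow> (\<lambda>t. (1/2) *\<^sub>R (u t + v t)) \<in> C n"
    and meas: "\<And>u. u \<in> C 0 \<Longrightarrow> u \<in> borel_measurable M"
    and bound: "\<And>u. u \<in> C 0 \<Longrightarrow> (\<integral>\<^sup>+t. ennreal ((norm (u t))\<^sup>2) \<partial>M) \<le> ennreal B"
  obtains u w g where "\<And>n. u n \<in> C n" "w \<in> borel_measurable M" "integrable M g"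
    "AE t in M. (\<lambda>n. u n t) \<longlonglongrightarrow> w t" "AE t in M. \<forall>n. norm (u n t) \<le> g t"
proof -
  interpret finite_measure M by fact
  define N where "N u = (\<integral>t. (norm (u t))\<^sup>2 \<partial>M)" for u :: "'a \<Rightarrow> 'e"
  have anti: "C n \<subseteq> C m" if "m \<le> n" for m n
    using dec that by (rule lift_Suc_antimono_le)
  then have C0: "u \<in> C 0" if "u \<in> C n" for u n using that by blast
  have fin: "(\<integral>\<^sup>+t. ennreal ((norm (u t))\<^sup>2) \<partial>M) < \<infinity>" if "u \<in> C 0" for u
    using bound[OF that] le_less_trans by fastforce
  have sq_int: "integrable M (\<lambda>t. (norm (u t))\<^sup>2)" and int: "integrable M u" if "u \<in> C 0" for u
    using integrable_if_square_integrable[OF meas[OF that] fin[OF that]] by simp_all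
  have N_nonneg: "0 \<le> N u" for u unfolding N_def by simp
  have N_le: "N u \<le> max B 0" if "u \<in> C 0" for u
  proof -
    have "ennreal (N u) = (\<integral>\<^sup>+t. ennreal ((norm (u t))\<^sup>2) \<partial>M)"
      unfolding N_def by (intro nn_integral_eq_integral[symmetric] sq_int that) auto
    also have "\<dots> \<le> ennreal (max B 0)" using bound[OF that] by (auto simp: max_def ennreal_neg)
    finally show ?thesis by (subst (asm) ennreal_le_iff) auto
  qed
  define d where "d n = Inf (N ` C n)" for n
  have bdd: "bdd_below (N ` S)" for S by (intro bdd_belowI[of _ 0]) (use N_nonneg in auto)
  have d_le: "d n \<le> N u" if "u \<in> C n" for u n
    unfolding d_def using that bdd by (intro cInf_lower) auto
  have d_mono: "d m \<le> d n" if "m \<le> n" for m n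
    unfolding d_def using anti[OF that] nonempty bdd by (intro cInf_superset_mono) auto
  have d_bdd: "d n \<le> max B 0" for n
  proof -
    obtain u where "u \<in> C n" using nonempty by blast
    with d_le N_le C0 show ?thesis by (meson order_trans)
  qed
  then have bdd_d: "bdd_above (range d)" by (intro bdd_aboveI[of _ "max B 0"]) auto
  define D where "D = (SUP n. d n)"
  have d_le_D: "d n \<le> D" for n unfolding D_def using bdd_d by (intro cSUP_upper) auto
  have "\<exists>k\<ge>n. D - (1/4)^n < d k" for n
  proof -
    have "D - (1/4)^n < D" by simp
    then obtain k where "D - (1/4)^n < d k"
      unfolding D_def using bdd_d by (subst (asm) less_cSUP_iff) auto
    also have "d k \<le> d (max k n)" by (intro d_mono) simp
    finally show ?thesis by (intro exI[of _ "max k n"]) auto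
  qed
  then obtain k where k: "\<And>n. n \<le> k n" "\<And>n. D - (1/4)^n < d (k n)" by metis
  have "\<exists>u\<in>C (k n). N u < D + (1/4)^n" for n
  proof -
    have "(0::real) < (1/4)^n" by simp
    then have "Inf (N ` C (k n)) < D + (1/4)^n" using d_le_D[of "k n"] unfolding d_def by linarith
    then show ?thesis using nonempty bdd by (subst (asm) cInf_less_iff) auto
  qed
  then obtain u where u: "\<And>n. u n \<in> C (k n)" "\<And>n. N (u n) < D + (1/4)^n" by metis
  have u0: "u n \<in> C 0" for n using C0 u(1) by blast
  have diff: "(\<integral>t. (norm (u (Suc n) t - u n t))\<^sup>2 \<partial>M) \<le> 8 * (1/4)^n"
    and diff_int: "integrable M (\<lambda>t. (norm (u (Suc n) t - u n t))\<^sup>2)" for n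
  proof -
    define m where "m t = (1/2) *\<^sub>R (u n t + u (Suc n) t)" for t
    \<comment> \<open>Nestedness puts both elements into the larger set \<open>C \<kappa>\<close>, on which \<open>d \<kappa>\<close> bounds the norm of
      the midpoint from below.\<close>
    define \<kappa> where "\<kappa> = min (k n) (k (Suc n))"
    have "u n \<in> C \<kappa>" "u (Suc n) \<in> C \<kappa>" using u(1) anti unfolding \<kappa>_def by (meson min.cobounded1 min.cobounded2 subsetD)+
    then have mC: "m \<in> C \<kappa>" unfolding m_def by (rule mid)
    have "(1/4::real)^(Suc n) \<le> (1/4)^n" by simp
    then have "D - (1/4)^n \<le> d (k n)" "D - (1/4)^n \<le> d (k (Suc n))"
      using k(2)[of n] k(2)[of "Suc n"] by linarith+
    then have "D - (1/4)^n \<le> d \<kappa>" by (simp add: \<kappa>_def min_def)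
    also have "d \<kappa> \<le> N m" using mC by (rule d_le)
    finally have Nm: "D - (1/4)^n \<le> N m" .
    have "(norm (x - y))\<^sup>2 = 2 * (norm y)\<^sup>2 + 2 * (norm x)\<^sup>2 - 4 * (norm ((1/2) *\<^sub>R (y + x)))\<^sup>2" for x y :: 'e
      by (simp add: power2_norm_eq_inner algebra_simps inner_commute)
    then have eq: "(norm (u (Suc n) t - u n t))\<^sup>2 = 2 * (norm (u n t))\<^sup>2 + 2 * (norm (u (Suc n) t))\<^sup>2 - 4 * (norm (m t))\<^sup>2" for t
      unfolding m_def .
    note ints = sq_int[OF u0[of n]] sq_int[OF u0[of "Suc n"]] sq_int[OF C0[OF mC]]
    show "integrable M (\<lambda>t. (norm (u (Suc n) t - u n t))\<^sup>2)"
      unfolding eq using ints by (intro Bochner_Integration.integrable_add Bochner_Integration.integrable_diff integrable_mult_right) auto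
    have "(\<integral>t. (norm (u (Suc n) t - u n t))\<^sup>2 \<partial>M) = 2 * N (u n) + 2 * N (u (Suc n)) - 4 * N m"
      unfolding eq N_def using ints by simp
    also have "\<dots> \<le> 8 * (1/4)^n"
      using Nm u(2)[of n] u(2)[of "Suc n"] \<open>(1/4::real)^(Suc n) \<le> (1/4)^n\<close> by linarith
    finally show "(\<integral>t. (norm (u (Suc n) t - u n t))\<^sup>2 \<partial>M) \<le> 8 * (1/4)^n" .
  qed
  have L1: "(\<integral>t. norm (u (Suc n) t - u n t) \<partial>M) \<le> (8 + measure M (space M)) / 2 * (1/2)^n" for n
  proof -
    \<comment> \<open>The weight \<open>2^n\<close> balances \<open>\<integral> x\<^sup>2 = O(4^-n)\<close> against the total mass, so that both terms
      are of order \<open>2^-n\<close>.\<close>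
    have young: "x \<le> (2^n * x\<^sup>2 + (1/2)^n) / 2" for x :: real
    proof -
      have "0 \<le> 2^n * (x - (1/2)^n)\<^sup>2" by simp
      also have "\<dots> = 2^n * x\<^sup>2 - 2 * x * (2^n * (1/2)^n) + (2^n * (1/2)^n) * (1/2)^n"
        by (simp add: power2_eq_square algebra_simps)
      also have "(2::real)^n * (1/2)^n = 1" by (simp flip: power_mult_distrib)
      finally show ?thesis by simp
    qed
    have "(\<integral>t. norm (u (Suc n) t - u n t) \<partial>M) \<le> (\<integral>t. (2^n * (norm (u (Suc n) t - u n t))\<^sup>2 + (1/2)^n) / 2 \<partial>M)"
      using int[OF u0] diff_int[of n] young
      by (intro integral_mono integrable_norm Bochner_Integration.integrable_diff integrable_divide
          Bochner_Integration.integrable_add integrable_mult_right) auto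
    also have "\<dots> = (2^n * (\<integral>t. (norm (u (Suc n) t - u n t))\<^sup>2 \<partial>M) + (1/2)^n * measure M (space M)) / 2"
      using diff_int[of n] by simp
    also have "\<dots> \<le> (2^n * (8 * (1/4)^n) + (1/2)^n * measure M (space M)) / 2"
      using diff[of n] by (intro divide_right_mono add_right_mono mult_left_mono) auto
    also have "(2::real)^n * (8 * (1/4)^n) = 8 * (1/2)^n"
      by (simp add: mult.left_commute flip: power_mult_distrib)
    finally show ?thesis by (simp add: algebra_simps)
  qed
  have "summable (\<lambda>n. \<integral>t. norm (u (Suc n) t - u n t) \<partial>M)"
  proof (rule summable_comparison_test')
    show "summable (\<lambda>n. (8 + measure M (space M)) / 2 * (1/2::real)^n)"
      by (intro summable_mult summable_geometric) auto
  qed (use L1 in auto)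
  from AE_summable_norm_increments[OF int[OF u0] this] obtain w g where
    "w \<in> borel_measurable M" "integrable M g"
    "AE t in M. (\<lambda>n. u n t) \<longlonglongrightarrow> w t" "AE t in M. \<forall>n. norm (u n t) \<le> g t" .
  moreover have "u n \<in> C n" for n using u(1) k(1) anti by blast
  ultimately show thesis using that by blast
qed

section \<open>Positive semidefinite linear systems with a parameter\<close>

text \<open>For symmetric \<open>A\<close> the whole space is the orthogonal sum of range and kernel. So a vector orthogonal to the
kernel is some \<open>A *v y\<close>, and the component of \<open>y\<close> in the kernel can be dropped, which puts \<open>y\<close> in the
range of \<open>A\<close> as well. The double application is what makes the regularised solutions converge.\<close>

lemma symmetric_matrix_square_solvable:
  fixes A :: "real^'n^'n"
  assumes sym: "\<And>x y. (A *v x) \<bullet> y = x \<bullet> (A *v y)"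
    and orth: "\<And>x. A *v x = 0 \<Longrightarrow> b \<bullet> x = 0"
  obtains z where "A *v (A *v z) = b"
proof -
  have sub: "subspace (range ((*v) A))"
    by (rule linear_subspace_image[OF matrix_vector_mul_linear subspace_UNIV])
  have decomp: "\<exists>y z. A *v z = 0 \<and> x = A *v y + z" for x
  proof -
    obtain y z where yz: "y \<in> span (range ((*v) A))" "\<And>w. w \<in> span (range ((*v) A)) \<Longrightarrow> orthogonal z w" "x = y + z"
      using orthogonal_subspace_decomp_exists[of "range ((*v) A)" x] by metis
    obtain y' where "y = A *v y'" using yz(1) sub by (metis rangeE span_eq_iff)
    moreover have "z \<bullet> (A *v (A *v z)) = 0"
      using yz(2)[of "A *v (A *v z)"] by (simp add: orthogonal_def span_base)
    then have "A *v z = 0" using sym[of z "A *v z"] by simp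
    ultimately show ?thesis using yz(3) by blast
  qed
  obtain y z where b: "A *v z = 0" "b = A *v y + z" using decomp by blast
  have "(A *v y) \<bullet> z = 0" using sym[of y z] b by simp
  then have "z \<bullet> z = 0" using orth[OF b(1)] b(2) by (simp add: inner_add_left)
  then have "b = A *v y" using b(2) by simp
  moreover obtain y' z' where "A *v z' = 0" "y = A *v y' + z'" using decomp by blast
  ultimately have "A *v (A *v y') = b" by (simp add: matrix_vector_right_distrib)
  then show thesis by (rule that)
qed

text \<open>The error of the regularised solution is \<open>- \<epsilon> \<eta>\<close> with \<open>(A + \<epsilon>) \<eta> = A z\<close>. Positivity of \<open>A\<close> gives
\<open>norm \<eta> \<le> norm z\<close>, so the error is at most \<open>\<epsilon> * norm z\<close>.\<close>

lemma regularised_solution_tendsto: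
  fixes A :: "real^'n^'n" and \<psi> :: "nat \<Rightarrow> real^'n"
  assumes sym: "\<And>x y. (A *v x) \<bullet> y = x \<bullet> (A *v y)"
    and psd: "\<And>x. 0 \<le> (A *v x) \<bullet> x"
    and z: "A *v (A *v z) = b"
    and \<psi>: "\<And>n. A *v \<psi> n + (1 / real (Suc n)) *\<^sub>R \<psi> n = b"
  shows "\<psi> \<longlonglongrightarrow> A *v z"
proof -
  have "norm (\<psi> n - A *v z) \<le> norm z * (1 / real (Suc n))" for n
  proof -
    define \<epsilon> where "\<epsilon> = 1 / real (Suc n)"
    have \<epsilon>: "0 < \<epsilon>" by (simp add: \<epsilon>_def)
    \<comment> \<open>The error divided by \<open>- \<epsilon>\<close>; it solves \<open>(A + \<epsilon>) \<eta> = A z\<close>.\<close>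
    define \<eta> where "\<eta> = (- 1 / \<epsilon>) *\<^sub>R (\<psi> n - A *v z)"
    have \<eta>: "\<psi> n - A *v z = - \<epsilon> *\<^sub>R \<eta>" using \<epsilon> by (simp add: \<eta>_def)
    then have "\<psi> n = A *v z - \<epsilon> *\<^sub>R \<eta>" by (simp add: algebra_simps)
    with \<psi>[of n] z have "\<epsilon> *\<^sub>R (A *v z) = \<epsilon> *\<^sub>R (A *v \<eta> + \<epsilon> *\<^sub>R \<eta>)"
      unfolding \<epsilon>_def[symmetric]
      by (simp add: matrix_vector_mult_diff_distrib matrix_vector_mult_scaleR algebra_simps)
    then have "A *v z = A *v \<eta> + \<epsilon> *\<^sub>R \<eta>" using \<epsilon> by simp
    then have "A *v (z - \<eta>) = \<epsilon> *\<^sub>R \<eta>" by (simp add: matrix_vector_mult_diff_distrib)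
    with psd[of "z - \<eta>"] have "0 \<le> \<epsilon> * (\<eta> \<bullet> (z - \<eta>))" by simp
    then have "\<eta> \<bullet> \<eta> \<le> \<eta> \<bullet> z" using \<epsilon> by (simp add: zero_le_mult_iff inner_diff_right)
    also have "\<dots> \<le> norm \<eta> * norm z" by (rule norm_cauchy_schwarz)
    finally have "norm \<eta> * norm \<eta> \<le> norm \<eta> * norm z" by (simp add: dot_square_norm power2_eq_square)
    then have "norm \<eta> \<le> norm z" by (cases "\<eta> = 0") auto
    then have "\<epsilon> * norm \<eta> \<le> norm z * \<epsilon>" using \<epsilon> by (simp add: mult.commute)
    then show ?thesis using \<epsilon> by (simp only: \<eta> norm_scaleR) (simp add: \<epsilon>_def)
  qed
  moreover have "(\<lambda>n. norm z * (1 / real (Suc n))) \<longlonglongrightarrow> norm z * 0"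
    by (intro tendsto_intros LIMSEQ_Suc lim_1_over_n)
  ultimately have "(\<lambda>n. \<psi> n - A *v z) \<longlonglongrightarrow> 0"
    by (intro Lim_null_comparison[where f="\<lambda>n. \<psi> n - A *v z"]) auto
  then show ?thesis by (simp add: LIM_zero_iff)
qed

lemma borel_measurable_det:
  fixes B :: "'a \<Rightarrow> real^'n^'n"
  assumes [measurable]: "\<And>i j. (\<lambda>t. B t $ i $ j) \<in> borel_measurable M"
  shows "(\<lambda>t. det (B t)) \<in> borel_measurable M"
  unfolding det_def by measurable

text \<open>The matrix \<open>A t\<close> may be singular, with a kernel that varies with \<open>t\<close>. The regularised systems are
invertible, Cramer's rule exhibits their solutions as quotients of polynomials in the data, and
measurability survives the limit.\<close>

lemma measurable_solution_symmetric_psd: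
  fixes A :: "'a \<Rightarrow> real^'n^'n" and b :: "'a \<Rightarrow> real^'n"
  assumes A: "\<And>i j. (\<lambda>t. A t $ i $ j) \<in> borel_measurable M"
    and b: "\<And>i. (\<lambda>t. b t $ i) \<in> borel_measurable M"
  obtains \<psi> where "\<And>i. (\<lambda>t. \<psi> t $ i) \<in> borel_measurable M"
    "\<And>t. \<lbrakk>\<And>x y. (A t *v x) \<bullet> y = x \<bullet> (A t *v y); \<And>x. 0 \<le> (A t *v x) \<bullet> x;
      \<And>x. A t *v x = 0 \<Longrightarrow> b t \<bullet> x = 0\<rbrakk> \<Longrightarrow> A t *v \<psi> t = b t"
proof -
  \<comment> \<open>\<open>R n t\<close> is the regularised matrix and \<open>\<phi> n t\<close> the solution given by Cramer's rule.\<close>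
  define R where "R n t = A t + (1 / real (Suc n)) *\<^sub>R mat 1" for n t
  define \<phi> where "\<phi> n t k = det (\<chi> i j. if j = k then b t $ i else R n t $ i $ j) / det (R n t)" for n t k
  have R: "(\<lambda>t. R n t $ i $ j) \<in> borel_measurable M" for n i j
    using A unfolding R_def by simp
  have \<phi>: "(\<lambda>t. \<phi> n t k) \<in> borel_measurable M" for n k
    unfolding \<phi>_def using R b by (intro borel_measurable_divide borel_measurable_det) simp_all
  show thesis
  proof (rule that[of "\<lambda>t. \<chi> k. lim (\<lambda>n. \<phi> n t k)"])
    show "(\<lambda>t. (\<chi> k. lim (\<lambda>n. \<phi> n t k)) $ i) \<in> borel_measurable M" for i
      using \<phi> by simp
    fix t
    assume sym: "\<And>x y. (A t *v x) \<bullet> y = x \<bullet> (A t *v y)" and psd: "\<And>x. 0 \<le> (A t *v x) \<bullet> x"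
      and orth: "\<And>x. A t *v x = 0 \<Longrightarrow> b t \<bullet> x = 0"
    obtain z where z: "A t *v (A t *v z) = b t" using symmetric_matrix_square_solvable[OF sym orth] by blast
    have Rv: "R n t *v x = A t *v x + (1 / real (Suc n)) *\<^sub>R x" for n x
      by (simp add: R_def matrix_vector_mult_add_rdistrib scaleR_matrix_vector_assoc[symmetric])
    have "det (R n t) \<noteq> 0" for n
    proof -
      have "x = 0" if "R n t *v x = 0" for x
      proof -
        have "0 = (A t *v x + (1 / real (Suc n)) *\<^sub>R x) \<bullet> x" using that Rv by simp
        also have "\<dots> = (A t *v x) \<bullet> x + (x \<bullet> x) / real (Suc n)" by (simp add: inner_add_left)
        finally have "(x \<bullet> x) / real (Suc n) \<le> 0" using psd[of x] by linarith
        then have "x \<bullet> x \<le> 0" by (simp add: divide_le_0_iff del: of_nat_Suc)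
        then show ?thesis using inner_ge_zero[of x] by (metis antisym inner_eq_zero_iff)
      qed
      then have "invertible (R n t)"
        by (simp only: invertible_left_inverse matrix_left_invertible_ker) blast
      then show ?thesis by (simp add: invertible_det_nz)
    qed
    then have "R n t *v (\<chi> k. \<phi> n t k) = b t" for n
      by (subst cramer) (simp_all add: \<phi>_def fun_eq_iff)
    then have "(\<lambda>n. \<chi> k. \<phi> n t k) \<longlonglongrightarrow> A t *v z"
      by (intro regularised_solution_tendsto[OF sym psd z]) (simp add: Rv)
    then have "(\<lambda>n. \<phi> n t k) \<longlonglongrightarrow> (A t *v z) $ k" for k
      using tendsto_vec_nth by fastforce
    then have "(\<chi> k. lim (\<lambda>n. \<phi> n t k)) = A t *v z"
      by (simp add: vec_eq_iff limI)
    then show "A t *v (\<chi> k. lim (\<lambda>n. \<phi> n t k)) = b t" using z by simp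
  qed
qed

section \<open>Weighted graph Laplacians\<close>

definition laplacian :: "('x::finite \<Rightarrow> 'x \<Rightarrow> real) \<Rightarrow> real^'x^'x" where
  "laplacian c = (\<chi> x y. (if x = y then \<Sum>z\<in>UNIV. c x z else 0) - c x y)"

lemma laplacian_apply: "(laplacian c *v \<phi>) $ x = (\<Sum>y\<in>UNIV. c x y * (\<phi> $ x - \<phi> $ y))"
  unfolding laplacian_def matrix_vector_mult_def
  by (simp add: left_diff_distrib sum_subtractf right_diff_distrib sum_distrib_right
      if_distrib[of "\<lambda>a. a * _"] sum.delta cong: if_cong)

text \<open>Summation by parts, with every edge counted in both directions.\<close>

lemma laplacian_inner:
  assumes sym: "\<And>x y. c x y = c y x"
  shows "(laplacian c *v \<phi>) \<bullet> \<psi> = 1/2 * (\<Sum>x\<in>UNIV. \<Sum>y\<in>UNIV. c x y * (\<phi> $ x - \<phi> $ y) * (\<psi> $ x - \<psi> $ y))"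
proof -
  have eq: "(laplacian c *v \<phi>) \<bullet> \<psi> = (\<Sum>x\<in>UNIV. \<Sum>y\<in>UNIV. c x y * (\<phi> $ x - \<phi> $ y) * \<psi> $ x)"
    by (simp add: inner_vec_def laplacian_apply sum_distrib_right)
  also have "\<dots> = (\<Sum>y\<in>UNIV. \<Sum>x\<in>UNIV. c x y * (\<phi> $ x - \<phi> $ y) * \<psi> $ x)"
    by (rule sum.swap)
  also have "\<dots> = (\<Sum>x\<in>UNIV. \<Sum>y\<in>UNIV. - (c x y * (\<phi> $ x - \<phi> $ y) * \<psi> $ y))"
  proof (intro sum.cong refl)
    fix x y show "c y x * (\<phi> $ y - \<phi> $ x) * \<psi> $ y = - (c x y * (\<phi> $ x - \<phi> $ y) * \<psi> $ y)"
      by (simp add: sym[of y x] algebra_simps)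
  qed
  finally have "2 * ((laplacian c *v \<phi>) \<bullet> \<psi>) =
      (\<Sum>x\<in>UNIV. \<Sum>y\<in>UNIV. c x y * (\<phi> $ x - \<phi> $ y) * \<psi> $ x) + (\<Sum>x\<in>UNIV. \<Sum>y\<in>UNIV. - (c x y * (\<phi> $ x - \<phi> $ y) * \<psi> $ y))"
    using eq by simp
  also have "\<dots> = (\<Sum>x\<in>UNIV. \<Sum>y\<in>UNIV. c x y * (\<phi> $ x - \<phi> $ y) * (\<psi> $ x - \<psi> $ y))"
    by (simp add: sum.distrib[symmetric] right_diff_distrib sum_subtractf sum_negf)
  finally show ?thesis by simp
qed

lemma laplacian_symmetric:
  assumes "\<And>x y. c x y = c y x"
  shows "(laplacian c *v \<phi>) \<bullet> \<psi> = \<phi> \<bullet> (laplacian c *v \<psi>)"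
  unfolding inner_commute[of \<phi>] laplacian_inner[of c, OF assms] by (simp add: mult_ac)

lemma laplacian_nonneg:
  assumes "\<And>x y. c x y = c y x" "\<And>x y. 0 \<le> c x y"
  shows "0 \<le> (laplacian c *v \<phi>) \<bullet> \<phi>"
proof -
  have "0 \<le> c x y * (\<phi> $ x - \<phi> $ y) * (\<phi> $ x - \<phi> $ y)" for x y
    by (simp add: mult.assoc assms(2))
  then show ?thesis
    unfolding laplacian_inner[of c, OF assms(1)] by (simp add: sum_nonneg)
qed

lemma laplacian_kernel:
  assumes "\<And>x y. c x y = c y x" "\<And>x y. 0 \<le> c x y" "laplacian c *v \<phi> = 0" "c x y \<noteq> 0"
  shows "\<phi> $ x = \<phi> $ y"
proof -
  have "(\<Sum>x\<in>UNIV. \<Sum>y\<in>UNIV. c x y * ((\<phi> $ x - \<phi> $ y) * (\<phi> $ x - \<phi> $ y))) = 0"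
    using laplacian_inner[of c \<phi> \<phi>, OF assms(1)] assms(3) by (simp add: mult.assoc)
  then have "c x y * ((\<phi> $ x - \<phi> $ y) * (\<phi> $ x - \<phi> $ y)) = 0"
    using assms(2) by (simp add: sum_nonneg_eq_0_iff sum_nonneg)
  then show ?thesis using assms(4) by simp
qed

locale reversible_chain =
  fixes K :: "'x::finite \<Rightarrow> 'x \<Rightarrow> real" and \<pi> :: "'x \<Rightarrow> real"
  assumes markov: "markov_kernel K" and irreducible: "irreducible_kernel K"
    and invariant: "invariant_probability K \<pi>" and reversible: "reversible_kernel K \<pi>"
begin

lemma K_nonneg: "0 \<le> K x y"
  using markov by (simp add: markov_kernel_def)

definition conductance :: "'x \<Rightarrow> 'x \<Rightarrow> real" where
  "conductance x y = K x y * \<pi> x"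

lemma conductance_commute: "conductance x y = conductance y x"
  using reversible by (simp add: conductance_def reversible_kernel_def)

lemma kernel_power_nonneg: "0 \<le> kernel_power K n x y"
  by (induction n arbitrary: x) (auto intro!: sum_nonneg mult_nonneg_nonneg K_nonneg)

lemma invariant_eq: "(\<Sum>x\<in>UNIV. \<pi> x * K x y) = \<pi> y"
  using invariant unfolding invariant_probability_def by (metis (lifting))

lemma invariant_nonneg: "0 \<le> \<pi> x"
  using invariant unfolding invariant_probability_def by blast

lemma invariant_sum: "(\<Sum>x\<in>UNIV. \<pi> x) = 1"
  using invariant unfolding invariant_probability_def by blast

lemma invariant_kernel_power: "(\<Sum>x\<in>UNIV. \<pi> x * kernel_power K n x y) = \<pi> y"
proof (induction n)
  case 0
  have "(\<Sum>x\<in>UNIV. \<pi> x * kernel_power K 0 x y) = (\<Sum>x\<in>UNIV. if x = y then \<pi> x else 0)"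
    by (intro sum.cong) auto
  then show ?case by simp
next
  case (Suc n)
  have "(\<Sum>x\<in>UNIV. \<pi> x * kernel_power K (Suc n) x y) = (\<Sum>x\<in>UNIV. \<Sum>z\<in>UNIV. \<pi> x * K x z * kernel_power K n z y)"
    by (simp add: sum_distrib_left mult_ac)
  also have "\<dots> = (\<Sum>z\<in>UNIV. (\<Sum>x\<in>UNIV. \<pi> x * K x z) * kernel_power K n z y)"
    by (subst sum.swap) (simp add: sum_distrib_right)
  also have "\<dots> = (\<Sum>z\<in>UNIV. \<pi> z * kernel_power K n z y)"
    by (simp only: invariant_eq)
  finally show ?case using Suc.IH by simp
qed

text \<open>Some state carries mass, and iterating the kernel transports part of it to any other state.\<close>

lemma invariant_pos: "0 < \<pi> x"
proof -
  obtain y where "\<pi> y \<noteq> 0" using invariant_sum by (metis sum.neutral zero_neq_one)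
  then have y: "0 < \<pi> y" using invariant_nonneg[of y] by simp
  obtain n where n: "0 < kernel_power K n y x" using irreducible by (auto simp: irreducible_kernel_def)
  have "0 < \<pi> y * kernel_power K n y x" using y n by simp
  also have "\<dots> \<le> (\<Sum>z\<in>UNIV. \<pi> z * kernel_power K n z x)"
    by (intro member_le_sum) (auto intro!: mult_nonneg_nonneg invariant_nonneg kernel_power_nonneg)
  finally show ?thesis by (simp add: invariant_kernel_power)
qed

lemma conductance_nonneg: "0 \<le> conductance x y"
  unfolding conductance_def by (intro mult_nonneg_nonneg K_nonneg invariant_nonneg)

lemma conductance_eq_0_iff: "conductance x y = 0 \<longleftrightarrow> K x y = 0"
  using invariant_pos[of x] by (simp add: conductance_def)

lemma constant_if_constant_along_edges:
  assumes edge: "\<And>x y. K x y \<noteq> 0 \<Longrightarrow> f x = f y"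
  shows "f x = f y"
proof -
  have *: "kernel_power K n x y \<noteq> 0 \<Longrightarrow> f x = f y" for n x
  proof (induction n arbitrary: x)
    case 0
    then show ?case by (simp split: if_splits)
  next
    case (Suc n)
    then have "(\<Sum>z\<in>UNIV. K x z * kernel_power K n z y) \<noteq> 0" by simp
    then obtain z where "K x z * kernel_power K n z y \<noteq> 0" by (meson sum.neutral)
    then show ?case using Suc.IH[of z] edge[of x z] by simp
  qed
  obtain n where "0 < kernel_power K n x y" using irreducible by (auto simp: irreducible_kernel_def)
  then show ?thesis by (intro *[of n x]) simp
qed

text \<open>The divergence is, up to sign, adjoint to the gradient with respect to \<open>\<pi>\<close>; symmetry of the
conductances allows the two orientations of an edge to be exchanged.\<close>

lemma sum_discrete_divergence:
  "(\<Sum>x\<in>UNIV. \<phi> x * (\<pi> x * discrete_divergence K V x)) =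
    1/2 * (\<Sum>x\<in>UNIV. \<Sum>y\<in>UNIV. V x y * conductance x y * (\<phi> x - \<phi> y))"
proof -
  have "(\<Sum>x\<in>UNIV. \<phi> x * (\<pi> x * discrete_divergence K V x)) =
      1/2 * (\<Sum>x\<in>UNIV. \<Sum>y\<in>UNIV. V x y * conductance x y * \<phi> x - V y x * conductance x y * \<phi> x)"
    unfolding discrete_divergence_def sum_distrib_left
    by (intro sum.cong refl) (simp add: conductance_def algebra_simps)
  also have "(\<Sum>x\<in>UNIV. \<Sum>y\<in>UNIV. V x y * conductance x y * \<phi> x - V y x * conductance x y * \<phi> x) =
      (\<Sum>x\<in>UNIV. \<Sum>y\<in>UNIV. V x y * conductance x y * \<phi> x) - (\<Sum>x\<in>UNIV. \<Sum>y\<in>UNIV. V y x * conductance x y * \<phi> x)"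
    by (simp add: sum_subtractf)
  also have "(\<Sum>x\<in>UNIV. \<Sum>y\<in>UNIV. V y x * conductance x y * \<phi> x) = (\<Sum>y\<in>UNIV. \<Sum>x\<in>UNIV. V y x * conductance x y * \<phi> x)"
    by (rule sum.swap)
  also have "\<dots> = (\<Sum>x\<in>UNIV. \<Sum>y\<in>UNIV. V x y * conductance x y * \<phi> y)"
    by (simp add: conductance_commute)
  also have "(\<Sum>x\<in>UNIV. \<Sum>y\<in>UNIV. V x y * conductance x y * \<phi> x) - \<dots> =
      (\<Sum>x\<in>UNIV. \<Sum>y\<in>UNIV. V x y * conductance x y * (\<phi> x - \<phi> y))"
    by (simp add: sum_subtractf right_diff_distrib)
  finally show ?thesis .
qed

lemma sum_discrete_divergence_zero: "(\<Sum>x\<in>UNIV. \<pi> x * discrete_divergence K V x) = 0"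
  using sum_discrete_divergence[of "\<lambda>_. 1" V] by simp

lemma discrete_divergence_gradient:
  assumes "\<And>x y. m x y = m y x"
  shows "discrete_divergence K (\<lambda>x y. (\<psi> y - \<psi> x) * m x y) x = (\<Sum>y\<in>UNIV. (\<psi> y - \<psi> x) * m x y * K x y)"
proof -
  have "((\<psi> y - \<psi> x) * m x y - (\<psi> x - \<psi> y) * m y x) * K x y = 2 * ((\<psi> y - \<psi> x) * m x y * K x y)" for y
    by (simp add: assms[of y x] algebra_simps)
  then show ?thesis unfolding discrete_divergence_def by (simp only: sum_distrib_left[symmetric])
qed

text \<open>The kernel of the Laplacian consists of constants, because the graph is connected. So mean zero with
respect to \<open>\<pi>\<close> is the only obstruction to solving Poisson's equation.\<close>

lemma exists_potential_with_divergence: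
  assumes "(\<Sum>x\<in>UNIV. \<pi> x * f x) = 0"
  obtains \<psi> where "\<And>x. discrete_divergence K (\<lambda>x y. \<psi> y - \<psi> x) x = f x"
proof -
  define b :: "real^'x" where "b = (\<chi> x. - (\<pi> x * f x))"
  note sym = laplacian_symmetric[of conductance, OF conductance_commute]
  have "b \<bullet> \<phi> = 0" if "laplacian conductance *v \<phi> = 0" for \<phi>
  proof -
    have edge: "\<phi> $ x = \<phi> $ y" if "K x y \<noteq> 0" for x y
      using that conductance_eq_0_iff[of x y]
      by (intro laplacian_kernel[OF conductance_commute conductance_nonneg \<open>laplacian conductance *v \<phi> = 0\<close>]) blast
    obtain r where r: "\<And>x. \<phi> $ x = r"
      using constant_if_constant_along_edges[of "\<lambda>x. \<phi> $ x", OF edge] by blast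
    have "b \<bullet> \<phi> = (\<Sum>x\<in>UNIV. b $ x) * r"
      unfolding inner_vec_def sum_distrib_right by (simp add: r)
    then show ?thesis using assms by (simp add: b_def sum_negf)
  qed
  from symmetric_matrix_square_solvable[OF sym this] obtain z where
    "laplacian conductance *v (laplacian conductance *v z) = b" by blast
  then obtain \<psi> where \<psi>: "laplacian conductance *v \<psi> = b" by blast
  have "discrete_divergence K (\<lambda>x y. \<psi> $ y - \<psi> $ x) x = f x" for x
  proof -
    have "discrete_divergence K (\<lambda>x y. \<psi> $ y - \<psi> $ x) x = (\<Sum>y\<in>UNIV. (\<psi> $ y - \<psi> $ x) * K x y)"
      using discrete_divergence_gradient[of "\<lambda>_ _. 1" "\<lambda>x. \<psi> $ x"] by simp
    then have "\<pi> x * discrete_divergence K (\<lambda>x y. \<psi> $ y - \<psi> $ x) x = - (laplacian conductance *v \<psi>) $ x"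
      by (simp add: laplacian_apply conductance_def sum_distrib_left sum_negf[symmetric] algebra_simps)
    then show ?thesis using \<psi> invariant_pos[of x] by (simp add: b_def)
  qed
  then show thesis by (rule that)
qed

end

section \<open>Fluxes and potentials\<close>

lemma density_curveD:
  assumes "density_curve \<mu>0 \<mu>1 \<mu>"
  shows "\<And>t x. t \<in> {0..1} \<Longrightarrow> 0 \<le> \<mu> t x" "\<And>x. continuous_on {0..1} (\<lambda>t. \<mu> t x)"
    "\<And>x. (\<lambda>t. \<mu> t x) \<in> borel_measurable (lebesgue_on {0..1})"
proof -
  show "0 \<le> \<mu> t x" if "t \<in> {0..1}" for t x
    using assms that by (auto simp: density_curve_def nonneg_densities_def)
  show *: "continuous_on {0..1} (\<lambda>t. \<mu> t x)" for x
    using assms by (intro absolutely_continuous_fun_on_imp_continuous_on) (simp add: density_curve_def)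
  show "(\<lambda>t. \<mu> t x) \<in> borel_measurable (lebesgue_on {0..1})" for x
    using * by (rule continuous_imp_measurable_on_sets_lebesgue) auto
qed

context reversible_chain
begin

lemma flux_action_eq_real:
  assumes "\<And>x y. 0 \<le> q x y" "\<And>x y. K x y \<noteq> 0 \<Longrightarrow> action_density (V x y) (\<mu> x) (\<mu> y) = ennreal (q x y)"
  shows "flux_action K \<pi> \<mu> V = ennreal (1/2 * (\<Sum>x\<in>UNIV. \<Sum>y\<in>UNIV. q x y * K x y * \<pi> x))"
proof -
  have "action_density (V x y) (\<mu> x) (\<mu> y) * ennreal (K x y) * ennreal (\<pi> x) = ennreal (q x y * K x y * \<pi> x)" for x y
    using assms K_nonneg invariant_nonneg by (cases "K x y = 0") (simp_all add: ennreal_mult)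
  then have "flux_action K \<pi> \<mu> V = ennreal (1/2) * (\<Sum>x\<in>UNIV. \<Sum>y\<in>UNIV. ennreal (q x y * K x y * \<pi> x))"
    unfolding flux_action_def by simp
  also have "\<dots> = ennreal (1/2) * ennreal (\<Sum>x\<in>UNIV. \<Sum>y\<in>UNIV. q x y * K x y * \<pi> x)"
    using assms(1) K_nonneg invariant_nonneg by (simp add: sum_nonneg sum_ennreal)
  also have "\<dots> = ennreal (1/2 * (\<Sum>x\<in>UNIV. \<Sum>y\<in>UNIV. q x y * K x y * \<pi> x))"
    using assms(1) K_nonneg invariant_nonneg by (intro ennreal_mult[symmetric]) (auto intro!: sum_nonneg)
  finally show ?thesis .
qed

lemma flux_action_finite_imp_zero:
  assumes "flux_action K \<pi> \<mu> V < \<infinity>" "K x y \<noteq> 0" "log_mean (\<mu> x) (\<mu> y) = 0"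
  shows "V x y = 0"
proof (rule ccontr)
  assume "V x y \<noteq> 0"
  then have "action_density (V x y) (\<mu> x) (\<mu> y) = \<infinity>" using assms(3) by (simp add: action_density_zero_mean)
  moreover have "edge_weight K \<pi> (x, y) \<noteq> 0"
    using assms(2) K_nonneg[of x y] invariant_pos[of x] by (simp add: edge_weight_def ennreal_eq_0_iff)
  ultimately have "edge_weight K \<pi> (x, y) * action_density (V x y) (\<mu> x) (\<mu> y) = \<infinity>"
    by (simp add: ennreal_mult_top)
  then show False using flux_action_ge_term[of K \<pi> x y V \<mu>] assms(1) by (simp add: top_unique)
qed

lemma potential_to_flux:
  assumes "(\<mu>, \<psi>, h) \<in> potential_triples K p \<mu>0 \<mu>1"
  obtains V where "(\<mu>, V, h) \<in> continuity_triples K p \<mu>0 \<mu>1"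
    "quad_energy K \<pi> a b (\<mu>, V, h) = potential_energy K \<pi> a b (\<mu>, \<psi>, h)"
proof -
  have dc: "density_curve \<mu>0 \<mu>1 \<mu>"
    and [measurable]: "\<And>x. (\<lambda>t. \<psi> t x) \<in> borel_measurable (lebesgue_on {0..1})" "h \<in> borel_measurable (lebesgue_on {0..1})"
    and ae: "AE t in lebesgue_on {0..1}. \<forall>x. \<exists>\<mu>'.
        ((\<lambda>s. \<mu> s x) has_real_derivative \<mu>') (at t within {0..1}) \<and>
        \<mu>' + (\<Sum>y\<in>UNIV. (\<psi> t y - \<psi> t x) * log_mean (\<mu> t x) (\<mu> t y) * K x y) = h t * p x"
    using assms by (auto simp: potential_triples_def)
  note \<mu> = density_curveD[OF dc]
  define V where "V t x y = (\<psi> t y - \<psi> t x) * log_mean (\<mu> t x) (\<mu> t y)" for t x y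
  have [measurable]: "(\<lambda>t. log_mean (\<mu> t x) (\<mu> t y)) \<in> borel_measurable (lebesgue_on {0..1})" for x y
    by (intro borel_measurable_log_mean \<mu>) auto
  have div: "discrete_divergence K (V t) x = (\<Sum>y\<in>UNIV. (\<psi> t y - \<psi> t x) * log_mean (\<mu> t x) (\<mu> t y) * K x y)"
    if "t \<in> {0..1}" for t x
    unfolding V_def by (intro discrete_divergence_gradient log_mean_commute \<mu> that)
  show thesis
  proof (rule that[of V])
    have "AE t in lebesgue_on {0..1}. \<forall>x. \<exists>\<mu>'.
        ((\<lambda>s. \<mu> s x) has_real_derivative \<mu>') (at t within {0..1}) \<and>
        \<mu>' + discrete_divergence K (V t) x = h t * p x"
      using ae by (rule AE_mp) (rule AE_I2, simp add: div)
    then show "(\<mu>, V, h) \<in> continuity_triples K p \<mu>0 \<mu>1"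
      using dc unfolding continuity_triples_def V_def by simp
    have "flux_action K \<pi> (\<mu> t) (V t) = ennreal (1/2 * (\<Sum>x\<in>UNIV. \<Sum>y\<in>UNIV.
        (\<psi> t y - \<psi> t x)\<^sup>2 * log_mean (\<mu> t x) (\<mu> t y) * K x y * \<pi> x))" for t
      by (intro flux_action_eq_real) (simp_all add: V_def action_density_gradient log_mean_nonneg)
    then show "quad_energy K \<pi> a b (\<mu>, V, h) = potential_energy K \<pi> a b (\<mu>, \<psi>, h)"
      by (simp add: quad_energy_def potential_energy_def)
  qed
qed

text \<open>Testing both fluxes, which have equal divergence, against \<open>\<psi>\<close> shows that the squared norm \<open>S\<close> of
the gradient flux equals its inner product with \<open>V\<close>. Young's inequality bounds the latter by half of
\<open>S\<close> plus half of the squared norm of \<open>V\<close>.\<close>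

lemma gradient_action_le_flux_action:
  assumes nonneg: "\<And>x. 0 \<le> \<mu> x" and fin: "flux_action K \<pi> \<mu> V < \<infinity>"
    and div: "\<And>x. (\<Sum>y\<in>UNIV. (\<psi> y - \<psi> x) * log_mean (\<mu> x) (\<mu> y) * K x y) = discrete_divergence K V x"
  shows "ennreal (1/2 * (\<Sum>x\<in>UNIV. \<Sum>y\<in>UNIV. (\<psi> y - \<psi> x)\<^sup>2 * log_mean (\<mu> x) (\<mu> y) * K x y * \<pi> x)) \<le> flux_action K \<pi> \<mu> V"
proof -
  define \<theta> where "\<theta> x y = log_mean (\<mu> x) (\<mu> y)" for x y
  have \<theta>: "\<theta> x y = \<theta> y x" "0 \<le> \<theta> x y" for x y
    using nonneg by (simp_all add: \<theta>_def log_mean_nonneg log_mean_commute)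
  \<comment> \<open>On edges of mean zero the flux vanishes as well, so a real-valued action loses nothing.\<close>
  define q where "q x y = (if \<theta> x y = 0 then 0 else (V x y)\<^sup>2 / \<theta> x y)" for x y
  have q: "0 \<le> q x y" for x y using \<theta> by (simp add: q_def)
  have V0: "V x y = 0" if "K x y \<noteq> 0" "\<theta> x y = 0" for x y
    using flux_action_finite_imp_zero[OF fin that(1)] that(2) by (simp add: \<theta>_def)
  have flux: "flux_action K \<pi> \<mu> V = ennreal (1/2 * (\<Sum>x\<in>UNIV. \<Sum>y\<in>UNIV. q x y * K x y * \<pi> x))"
  proof (rule flux_action_eq_real[OF q])
    fix x y assume "K x y \<noteq> 0"
    then show "action_density (V x y) (\<mu> x) (\<mu> y) = ennreal (q x y)"
      using V0[of x y] \<theta>(2)[of x y]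
      by (cases "\<theta> x y = 0")
         (auto simp: q_def action_density_zero_mean \<theta>_def action_density_def divide_ennreal)
  qed
  define S where "S = (\<Sum>x\<in>UNIV. \<Sum>y\<in>UNIV. (\<psi> y - \<psi> x)\<^sup>2 * \<theta> x y * K x y * \<pi> x)"
  define Q where "Q = (\<Sum>x\<in>UNIV. \<Sum>y\<in>UNIV. q x y * K x y * \<pi> x)"
  have "1/2 * (\<Sum>x\<in>UNIV. \<Sum>y\<in>UNIV. V x y * conductance x y * (\<psi> x - \<psi> y)) =
      (\<Sum>x\<in>UNIV. \<psi> x * (\<pi> x * discrete_divergence K V x))"
    by (simp add: sum_discrete_divergence)
  also have "\<dots> = (\<Sum>x\<in>UNIV. \<psi> x * (\<pi> x * discrete_divergence K (\<lambda>x y. (\<psi> y - \<psi> x) * \<theta> x y) x))"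
    unfolding discrete_divergence_gradient[of \<theta>, OF \<theta>(1)] by (simp only: \<theta>_def div)
  also have "\<dots> = 1/2 * (\<Sum>x\<in>UNIV. \<Sum>y\<in>UNIV. (\<psi> y - \<psi> x) * \<theta> x y * conductance x y * (\<psi> x - \<psi> y))"
    by (simp add: sum_discrete_divergence)
  also have "(\<Sum>x\<in>UNIV. \<Sum>y\<in>UNIV. (\<psi> y - \<psi> x) * \<theta> x y * conductance x y * (\<psi> x - \<psi> y)) = - S"
    unfolding S_def sum_negf[symmetric]
    by (intro sum.cong refl) (simp add: conductance_def power2_eq_square algebra_simps)
  finally have "S = - (\<Sum>x\<in>UNIV. \<Sum>y\<in>UNIV. V x y * conductance x y * (\<psi> x - \<psi> y))" by simp
  also have "\<dots> = (\<Sum>x\<in>UNIV. \<Sum>y\<in>UNIV. V x y * (\<psi> y - \<psi> x) * (K x y * \<pi> x))"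
    unfolding sum_negf[symmetric] by (intro sum.cong refl) (simp add: conductance_def algebra_simps)
  also have "\<dots> \<le> (\<Sum>x\<in>UNIV. \<Sum>y\<in>UNIV. 1/2 * (q x y * K x y * \<pi> x) + 1/2 * ((\<psi> y - \<psi> x)\<^sup>2 * \<theta> x y * K x y * \<pi> x))"
  proof (intro sum_mono)
    fix x y
    show "V x y * (\<psi> y - \<psi> x) * (K x y * \<pi> x) \<le>
        1/2 * (q x y * K x y * \<pi> x) + 1/2 * ((\<psi> y - \<psi> x)\<^sup>2 * \<theta> x y * K x y * \<pi> x)"
    proof (cases "\<theta> x y = 0")
      case True
      then show ?thesis using V0[of x y] by (cases "K x y = 0") (auto simp: q_def)
    next
      case False
      then have pos: "0 < \<theta> x y" using \<theta>(2)[of x y] by simp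
      have "0 \<le> (V x y - (\<psi> y - \<psi> x) * \<theta> x y)\<^sup>2 / \<theta> x y" using pos by simp
      also have "\<dots> = q x y + (\<psi> y - \<psi> x)\<^sup>2 * \<theta> x y - 2 * (V x y * (\<psi> y - \<psi> x))"
        using pos by (simp add: q_def power2_eq_square field_simps)
      finally have "V x y * (\<psi> y - \<psi> x) \<le> 1/2 * q x y + 1/2 * ((\<psi> y - \<psi> x)\<^sup>2 * \<theta> x y)" by simp
      from mult_right_mono[OF this, of "K x y * \<pi> x"] show ?thesis
        using K_nonneg invariant_nonneg by (simp add: algebra_simps)
    qed
  qed
  also have "\<dots> = 1/2 * Q + 1/2 * S"
    by (simp only: sum.distrib sum_distrib_left Q_def S_def)
  finally have "1/2 * S \<le> 1/2 * Q" by simp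
  then show ?thesis unfolding flux S_def Q_def \<theta>_def by (rule ennreal_leI)
qed

text \<open>At each time of finite action, \<open>\<phi> t\<close> solves the Poisson equation for the conductances multiplied by the
mean. The right-hand side is orthogonal to the kernel: a vector in the kernel is constant along the edges
with positive weight, and \<open>V\<close> vanishes on the others.\<close>

lemma flux_to_potential:
  assumes ce: "(\<mu>, V, h) \<in> continuity_triples K p \<mu>0 \<mu>1"
    and fin: "quad_energy K \<pi> a b (\<mu>, V, h) < \<infinity>" and "0 < b"
  obtains \<psi> where "(\<mu>, \<psi>, h) \<in> potential_triples K p \<mu>0 \<mu>1"
    "potential_energy K \<pi> a b (\<mu>, \<psi>, h) \<le> quad_energy K \<pi> a b (\<mu>, V, h)"
proof -
  define M where "M = lebesgue_on {0..1::real}"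
  have dc: "density_curve \<mu>0 \<mu>1 \<mu>"
    and V [measurable]: "\<And>x y. (\<lambda>t. V t x y) \<in> borel_measurable M"
    and h: "h \<in> borel_measurable M"
    and ae: "AE t in M. \<forall>x. \<exists>\<mu>'.
        ((\<lambda>s. \<mu> s x) has_real_derivative \<mu>') (at t within {0..1}) \<and>
        \<mu>' + discrete_divergence K (V t) x = h t * p x"
    using ce unfolding continuity_triples_def M_def by auto
  note \<mu> = density_curveD[OF dc, folded M_def]
  have sp: "t \<in> {0..1}" if "t \<in> space M" for t using that by (simp add: M_def)
  have lm [measurable]: "(\<lambda>t. log_mean (\<mu> t x) (\<mu> t y)) \<in> borel_measurable M" for x y
    by (intro borel_measurable_log_mean \<mu>) (auto simp: M_def)
  define c where "c t x y = log_mean (\<mu> t x) (\<mu> t y) * conductance x y" for t x y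
  define f :: "real \<Rightarrow> real^'x" where "f t = (\<chi> x. - (\<pi> x * discrete_divergence K (V t) x))" for t
  have "(\<lambda>t. laplacian (c t) $ x $ y) \<in> borel_measurable M" for x y
    unfolding laplacian_def c_def by simp
  moreover have "(\<lambda>t. f t $ x) \<in> borel_measurable M" for x
    unfolding f_def discrete_divergence_def by simp
  ultimately obtain \<phi> where \<phi>m: "\<And>x. (\<lambda>t. \<phi> t $ x) \<in> borel_measurable M"
    and \<phi>: "\<And>t. \<lbrakk>\<And>x y. (laplacian (c t) *v x) \<bullet> y = x \<bullet> (laplacian (c t) *v y); \<And>x. 0 \<le> (laplacian (c t) *v x) \<bullet> x;
      \<And>x. laplacian (c t) *v x = 0 \<Longrightarrow> f t \<bullet> x = 0\<rbrakk> \<Longrightarrow> laplacian (c t) *v \<phi> t = f t"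
    using measurable_solution_symmetric_psd[of "\<lambda>t. laplacian (c t)" M f] by blast
  have solves: "(\<Sum>y\<in>UNIV. (\<phi> t $ y - \<phi> t $ x) * log_mean (\<mu> t x) (\<mu> t y) * K x y) = discrete_divergence K (V t) x"
    if t: "t \<in> {0..1}" and act: "flux_action K \<pi> (\<mu> t) (V t) < \<infinity>" for t x
  proof -
    have c: "c t x y = c t y x" "0 \<le> c t x y" for x y
      using log_mean_commute[OF \<mu>(1)[OF t] \<mu>(1)[OF t], of x y] conductance_commute[of x y]
      by (simp_all add: c_def log_mean_nonneg conductance_nonneg)
    have orth: "f t \<bullet> \<eta> = 0" if \<eta>: "laplacian (c t) *v \<eta> = 0" for \<eta>
    proof -
      have "V t x y * conductance x y * (\<eta> $ x - \<eta> $ y) = 0" for x y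
      proof (cases "c t x y = 0")
        case True
        then show ?thesis
          using flux_action_finite_imp_zero[OF act, of x y] conductance_eq_0_iff[of x y] by (auto simp: c_def)
      next
        case False
        then show ?thesis using laplacian_kernel[OF c \<eta>] by simp
      qed
      then have "(\<Sum>x\<in>UNIV. \<eta> $ x * (\<pi> x * discrete_divergence K (V t) x)) = 0"
        by (simp only: sum_discrete_divergence sum.neutral_const mult_zero_right)
      then show ?thesis by (simp add: f_def inner_vec_def sum_negf mult_ac)
    qed
    have "laplacian (c t) *v \<phi> t = f t"
      by (rule \<phi>) (use laplacian_symmetric[of "c t", OF c(1)] laplacian_nonneg[of "c t", OF c] orth in auto)
    then have "(laplacian (c t) *v \<phi> t) $ x = f t $ x" by simp
    then have "(\<Sum>y\<in>UNIV. c t x y * (\<phi> t $ x - \<phi> t $ y)) = - (\<pi> x * discrete_divergence K (V t) x)"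
      by (simp add: laplacian_apply f_def)
    moreover have "(\<Sum>y\<in>UNIV. c t x y * (\<phi> t $ x - \<phi> t $ y)) =
        - (\<pi> x * (\<Sum>y\<in>UNIV. (\<phi> t $ y - \<phi> t $ x) * log_mean (\<mu> t x) (\<mu> t y) * K x y))"
      unfolding sum_distrib_left sum_negf[symmetric]
      by (intro sum.cong refl) (simp add: c_def conductance_def algebra_simps)
    ultimately show ?thesis using invariant_pos[of x] by simp
  qed
  have meas_act: "(\<lambda>t. flux_action K \<pi> (\<mu> t) (V t)) \<in> borel_measurable M"
    by (intro borel_measurable_flux_action V \<mu>) (auto simp: M_def)
  have "(\<integral>\<^sup>+t. flux_action K \<pi> (\<mu> t) (V t) \<partial>M) \<noteq> \<infinity>"
  proof
    assume "(\<integral>\<^sup>+t. flux_action K \<pi> (\<mu> t) (V t) \<partial>M) = \<infinity>"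
    then show False using fin \<open>0 < b\<close> by (simp add: quad_energy_def M_def ennreal_mult_top)
  qed
  with meas_act have act: "AE t in M. flux_action K \<pi> (\<mu> t) (V t) \<noteq> \<infinity>"
    by (rule nn_integral_PInf_AE)
  have space: "AE t in M. t \<in> {0..1}" by (rule AE_I2) (simp add: M_def)
  show thesis
  proof (rule that[of "\<lambda>t x. \<phi> t $ x"])
    have "AE t in M. \<forall>x. \<exists>\<mu>'.
        ((\<lambda>s. \<mu> s x) has_real_derivative \<mu>') (at t within {0..1}) \<and>
        \<mu>' + (\<Sum>y\<in>UNIV. (\<phi> t $ y - \<phi> t $ x) * log_mean (\<mu> t x) (\<mu> t y) * K x y) = h t * p x"
      using ae act space by eventually_elim (simp add: solves less_top)
    then show "(\<mu>, \<lambda>t x. \<phi> t $ x, h) \<in> potential_triples K p \<mu>0 \<mu>1"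
      using dc \<phi>m h unfolding potential_triples_def M_def by simp
    have "AE t in M. ennreal (1/2 * (\<Sum>x\<in>UNIV. \<Sum>y\<in>UNIV.
        (\<phi> t $ y - \<phi> t $ x)\<^sup>2 * log_mean (\<mu> t x) (\<mu> t y) * K x y * \<pi> x)) \<le> flux_action K \<pi> (\<mu> t) (V t)"
      using act space
      by eventually_elim (intro gradient_action_le_flux_action solves \<mu>, simp_all add: less_top)
    then show "potential_energy K \<pi> a b (\<mu>, \<lambda>t x. \<phi> t $ x, h) \<le> quad_energy K \<pi> a b (\<mu>, V, h)"
      unfolding potential_energy_def quad_energy_def M_def
      by (auto intro!: add_mono mult_left_mono nn_integral_mono_AE)
  qed
qed

end

section \<open>The direct method for the flux energy\<close>

lemma borel_measurable_vec_lambda2: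
  fixes f :: "'a \<Rightarrow> 'i::finite \<Rightarrow> 'j::finite \<Rightarrow> real"
  assumes "\<And>x y. (\<lambda>t. f t x y) \<in> borel_measurable M"
  shows "(\<lambda>t. \<chi> x y. f t x y) \<in> borel_measurable M"
  by (subst borel_measurable_euclidean_space) (auto simp: Basis_vec_def inner_axis assms)

text \<open>The variables of the optimisation are controls: functions of time with values in the Euclidean space
of pairs \<open>(V, h)\<close>. The curve of densities is determined by its starting point and the control.\<close>

locale transport_problem = reversible_chain +
  fixes p :: "'a \<Rightarrow> real" and a b :: real
  assumes a_pos: "0 < a" and b_pos: "0 < b" and p_normalised: "(\<Sum>x\<in>UNIV. p x * \<pi> x) = 1"
begin

definition flux :: "(real^'a^'a) \<times> real \<Rightarrow> 'a \<Rightarrow> 'a \<Rightarrow> real" where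
  "flux z x y = fst z $ x $ y"

definition velocity :: "(real^'a^'a) \<times> real \<Rightarrow> 'a \<Rightarrow> real" where
  "velocity z x = snd z * p x - discrete_divergence K (flux z) x"

definition trajectory :: "('a \<Rightarrow> real) \<Rightarrow> (real \<Rightarrow> (real^'a^'a) \<times> real) \<Rightarrow> real \<Rightarrow> 'a \<Rightarrow> real" where
  "trajectory \<mu>0 u t x = \<mu>0 x + integral {0..t} (\<lambda>s. velocity (u s) x)"

definition admissible :: "('a \<Rightarrow> real) \<Rightarrow> ('a \<Rightarrow> real) \<Rightarrow> (real \<Rightarrow> (real^'a^'a) \<times> real) \<Rightarrow> bool" where
  "admissible \<mu>0 \<mu>1 u \<longleftrightarrow> integrable (lebesgue_on {0..1}) u \<and>
     (\<forall>t\<in>{0..1}. \<forall>x. 0 \<le> trajectory \<mu>0 u t x) \<and> trajectory \<mu>0 u 1 = \<mu>1"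

definition running_cost :: "('a \<Rightarrow> real) \<Rightarrow> (real^'a^'a) \<times> real \<Rightarrow> ennreal" where
  "running_cost \<mu> z = ennreal (a\<^sup>2) * ennreal ((snd z)\<^sup>2) + ennreal (b\<^sup>2) * flux_action K \<pi> \<mu> (flux z)"

definition total_cost :: "('a \<Rightarrow> real) \<Rightarrow> (real \<Rightarrow> (real^'a^'a) \<times> real) \<Rightarrow> ennreal" where
  "total_cost \<mu>0 u = (\<integral>\<^sup>+t. running_cost (trajectory \<mu>0 u t) (u t) \<partial>lebesgue_on {0..1})"

text \<open>Values of a flux off the edges of the graph do not enter the action, so they must be normalised before
the action can bound the norm.\<close>

definition edge_supported :: "(real^'a^'a) \<times> real \<Rightarrow> bool" where
  "edge_supported z \<longleftrightarrow> (\<forall>x y. K x y = 0 \<longrightarrow> flux z x y = 0)"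

lemma linear_velocity: "linear (\<lambda>z. velocity z x)"
proof (rule linearI)
  fix z z' :: "(real^'a^'a) \<times> real" and r :: real
  have "discrete_divergence K (flux (z + z')) x = discrete_divergence K (flux z) x + discrete_divergence K (flux z') x"
    unfolding discrete_divergence_def flux_def distrib_left[symmetric] sum.distrib[symmetric]
    by (simp add: algebra_simps)
  then show "velocity (z + z') x = velocity z x + velocity z' x" by (simp add: velocity_def algebra_simps)
  have "discrete_divergence K (flux (r *\<^sub>R z)) x = r * discrete_divergence K (flux z) x"
    unfolding discrete_divergence_def flux_def by (simp add: sum_distrib_left algebra_simps)
  then show "velocity (r *\<^sub>R z) x = r *\<^sub>R velocity z x" by (simp add: velocity_def algebra_simps)
qed

lemma linear_flux: "linear (\<lambda>z. flux z x y)"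
  unfolding flux_def by (rule linearI) auto

lemma integrable_linear_image:
  fixes T :: "'e::euclidean_space \<Rightarrow> real"
  shows "linear T \<Longrightarrow> integrable M u \<Longrightarrow> integrable M (\<lambda>t. T (u t))"
  by (rule integrable_bounded_linear) (auto simp: linear_conv_bounded_linear)

lemma integrable_velocity:
  "integrable M u \<Longrightarrow> integrable M (\<lambda>t. velocity (u t) x)"
  by (rule integrable_linear_image[OF linear_velocity])

lemma borel_measurable_control:
  assumes "u \<in> borel_measurable M"
  shows "(\<lambda>t. flux (u t) x y) \<in> borel_measurable M" "(\<lambda>t. snd (u t)) \<in> borel_measurable M"
proof -
  have "(\<lambda>z. flux z x y) \<in> borel_measurable borel"
    by (intro borel_measurable_continuous_onI linear_continuous_on) (simp add: linear_flux flip: linear_conv_bounded_linear)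
  from measurable_compose[OF assms this] show "(\<lambda>t. flux (u t) x y) \<in> borel_measurable M" .
  have "(snd :: (real^'a^'a) \<times> real \<Rightarrow> real) \<in> borel_measurable borel"
    by (intro borel_measurable_continuous_onI continuous_on_snd continuous_on_id)
  from measurable_compose[OF assms this] show "(\<lambda>t. snd (u t)) \<in> borel_measurable M" .
qed

lemma absolutely_continuous_trajectory:
  assumes "integrable (lebesgue_on {0..1}) u"
  shows "absolutely_continuous_fun_on 0 1 (\<lambda>t. trajectory \<mu>0 u t x)"
  unfolding trajectory_def
  by (intro absolutely_continuous_indefinite_integral integrable_velocity assms)

lemma density_curve_trajectory:
  assumes "admissible \<mu>0 \<mu>1 u"
  shows "density_curve \<mu>0 \<mu>1 (trajectory \<mu>0 u)"
  using assms absolutely_continuous_trajectory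
  by (auto simp: density_curve_def admissible_def nonneg_densities_def trajectory_def fun_eq_iff)

lemma borel_measurable_running_cost:
  assumes "density_curve \<mu>0 \<mu>1 \<mu>" and u: "u \<in> borel_measurable (lebesgue_on {0..1})"
  shows "(\<lambda>t. running_cost (\<mu> t) (u t)) \<in> borel_measurable (lebesgue_on {0..1})"
proof -
  note [measurable] = borel_measurable_control[OF u]
  have [measurable]: "(\<lambda>t. flux_action K \<pi> (\<mu> t) (flux (u t))) \<in> borel_measurable (lebesgue_on {0..1})"
    by (intro borel_measurable_flux_action borel_measurable_control u density_curveD[OF assms(1)]) auto
  show ?thesis unfolding running_cost_def by measurable
qed

lemma quad_energy_eq_integral_running_cost:
  assumes dc: "density_curve \<mu>0 \<mu>1 \<mu>" and u: "u \<in> borel_measurable (lebesgue_on {0..1})"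
  shows "quad_energy K \<pi> a b (\<mu>, \<lambda>t. flux (u t), \<lambda>t. snd (u t)) = (\<integral>\<^sup>+t. running_cost (\<mu> t) (u t) \<partial>lebesgue_on {0..1})"
proof -
  note [measurable] = borel_measurable_control[OF u]
  have [measurable]: "(\<lambda>t. flux_action K \<pi> (\<mu> t) (flux (u t))) \<in> borel_measurable (lebesgue_on {0..1})"
    by (intro borel_measurable_flux_action borel_measurable_control u density_curveD[OF dc]) auto
  show ?thesis
    unfolding quad_energy_def running_cost_def
    by (simp add: nn_integral_add nn_integral_cmult)
qed

text \<open>Lebesgue's differentiation theorem turns the integral equation back into the differential one.\<close>

lemma admissible_imp_continuity_triple:
  assumes adm: "admissible \<mu>0 \<mu>1 u"
  shows "(trajectory \<mu>0 u, \<lambda>t. flux (u t), \<lambda>t. snd (u t)) \<in> continuity_triples K p \<mu>0 \<mu>1"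
    and "quad_energy K \<pi> a b (trajectory \<mu>0 u, \<lambda>t. flux (u t), \<lambda>t. snd (u t)) = total_cost \<mu>0 u"
proof -
  have int: "integrable (lebesgue_on {0..1}) u" using adm by (simp add: admissible_def)
  then have u: "u \<in> borel_measurable (lebesgue_on {0..1})" by simp
  note dc = density_curve_trajectory[OF adm]
  have "\<forall>x. \<exists>N. negligible N \<and> (\<forall>t\<in>{0..1} - N.
      ((\<lambda>t. integral {0..t} (\<lambda>s. velocity (u s) x)) has_real_derivative velocity (u t) x) (at t within {0..1}))"
    using integrable_lebesgue_on_subinterval(2)[OF integrable_velocity[OF int] order_refl order_refl]
    by (intro allI has_real_derivative_indefinite_integral_ae)
  then obtain N where N: "\<And>x. negligible (N x)" "\<And>x t. t \<in> {0..1} - N x \<Longrightarrow>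
      ((\<lambda>t. integral {0..t} (\<lambda>s. velocity (u s) x)) has_real_derivative velocity (u t) x) (at t within {0..1})"
    by metis
  have "negligible (\<Union>x. N x)"
    by (intro negligible_Union) (use N(1) in auto)
  then have "AE t in lebesgue. t \<notin> (\<Union>x. N x)"
    by (intro AE_not_in) (simp add: negligible_iff_null_sets)
  then have "AE t in lebesgue. t \<in> {0..1} \<longrightarrow> (\<forall>x. \<exists>\<mu>'.
        ((\<lambda>s. trajectory \<mu>0 u s x) has_real_derivative \<mu>') (at t within {0..1}) \<and>
        \<mu>' + discrete_divergence K (flux (u t)) x = snd (u t) * p x)"
  proof eventually_elim
    fix t assume t: "t \<notin> (\<Union>x. N x)"
    show "t \<in> {0..1} \<longrightarrow> (\<forall>x. \<exists>\<mu>'.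
        ((\<lambda>s. trajectory \<mu>0 u s x) has_real_derivative \<mu>') (at t within {0..1}) \<and>
        \<mu>' + discrete_divergence K (flux (u t)) x = snd (u t) * p x)"
    proof (intro impI allI exI conjI)
      fix x assume "t \<in> {0..1}"
      then have "((\<lambda>s. \<mu>0 x + integral {0..s} (\<lambda>s. velocity (u s) x)) has_real_derivative 0 + velocity (u t) x) (at t within {0..1})"
        using N(2)[of t x] t by (intro DERIV_add DERIV_const) auto
      then show "((\<lambda>s. trajectory \<mu>0 u s x) has_real_derivative velocity (u t) x) (at t within {0..1})"
        by (simp add: trajectory_def)
      show "velocity (u t) x + discrete_divergence K (flux (u t)) x = snd (u t) * p x" by (simp add: velocity_def)
    qed
  qed
  then show "(trajectory \<mu>0 u, \<lambda>t. flux (u t), \<lambda>t. snd (u t)) \<in> continuity_triples K p \<mu>0 \<mu>1"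
    using dc borel_measurable_control[OF u] by (simp add: continuity_triples_def AE_restrict_space_iff)
  show "quad_energy K \<pi> a b (trajectory \<mu>0 u, \<lambda>t. flux (u t), \<lambda>t. snd (u t)) = total_cost \<mu>0 u"
    unfolding total_cost_def by (rule quad_energy_eq_integral_running_cost[OF dc u])
qed

text \<open>The mean is at most \<open>B\<close>, so \<open>V\<^sup>2 \<le> B * (V\<^sup>2 / \<theta>)\<close> on every edge. Dividing by the weight of the
edge bounds \<open>V\<^sup>2\<close> by a multiple of the total action.\<close>

lemma norm_le_running_cost:
  assumes "0 < B"
  obtains C where "0 \<le> C"
    "\<And>\<mu> z. \<lbrakk>\<And>x. 0 \<le> \<mu> x; \<And>x. \<mu> x \<le> B; edge_supported z\<rbrakk> \<Longrightarrow>
      ennreal ((norm z)\<^sup>2) \<le> ennreal C * running_cost \<mu> z"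
proof -
  \<comment> \<open>The real number behind \<open>edge_weight\<close>.\<close>
  define w where "w x y = 1/2 * K x y * \<pi> x" for x y
  define D where "D = (\<Sum>x\<in>UNIV. \<Sum>y\<in>UNIV. if K x y = 0 then 0 else B / w x y)"
  have w: "0 < w x y" if "K x y \<noteq> 0" for x y
    using that K_nonneg[of x y] invariant_pos[of x] by (simp add: w_def)
  have D: "0 \<le> D" using w assms unfolding D_def by (intro sum_nonneg) (simp add: less_imp_le)
  have flux_le: "ennreal ((norm (fst z))\<^sup>2) \<le> ennreal D * flux_action K \<pi> \<mu> (flux z)"
    if \<mu>: "\<And>x. 0 \<le> \<mu> x" "\<And>x. \<mu> x \<le> B" and z: "edge_supported z" for \<mu> z
  proof -
    have edge: "ennreal ((flux z x y)\<^sup>2) \<le> ennreal (if K x y = 0 then 0 else B / w x y) * flux_action K \<pi> \<mu> (flux z)" for x y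
    proof (cases "K x y = 0")
      case True
      then show ?thesis using z by (simp add: edge_supported_def)
    next
      case False
      have "ennreal ((flux z x y)\<^sup>2) \<le> ennreal B * action_density (flux z x y) (\<mu> x) (\<mu> y)"
      proof (cases "action_density (flux z x y) (\<mu> x) (\<mu> y) = \<infinity>")
        case True
        then show ?thesis using assms by (simp add: ennreal_mult_top)
      next
        case False
        then obtain e where e: "action_density (flux z x y) (\<mu> x) (\<mu> y) = ennreal e" "0 \<le> e"
          by (metis ennreal_cases infinity_ennreal_def)
        then have "(flux z x y)\<^sup>2 \<le> e * log_mean (\<mu> x) (\<mu> y)"
          using action_density_le_iff[OF e(2), of "flux z x y" "\<mu> x" "\<mu> y"] by simp
        also have "\<dots> \<le> e * B" using e \<mu> by (intro mult_left_mono log_mean_le) auto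
        finally show ?thesis using e assms by (simp add: ennreal_mult[symmetric] mult.commute ennreal_leI)
      qed
      also have "ennreal B = ennreal (B / w x y) * edge_weight K \<pi> (x, y)"
      proof -
        have "ennreal (1/2 * K x y * \<pi> x) = ennreal (1/2 * K x y) * ennreal (\<pi> x)"
          by (intro ennreal_mult) (simp_all add: K_nonneg invariant_nonneg)
        also have "ennreal (1/2 * K x y) = ennreal (1/2) * ennreal (K x y)"
          by (intro ennreal_mult) (simp_all add: K_nonneg)
        finally have "edge_weight K \<pi> (x, y) = ennreal (w x y)"
          by (simp only: edge_weight_def w_def split_conv)
        then show ?thesis using w[OF False] assms by (simp add: ennreal_mult[symmetric])
      qed
      also have "\<dots> * action_density (flux z x y) (\<mu> x) (\<mu> y) \<le> ennreal (B / w x y) * flux_action K \<pi> \<mu> (flux z)"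
        unfolding mult.assoc by (intro mult_left_mono flux_action_ge_term) auto
      finally show ?thesis using False by simp
    qed
    have "(norm (fst z))\<^sup>2 = (\<Sum>x\<in>UNIV. \<Sum>y\<in>UNIV. (flux z x y)\<^sup>2)"
      unfolding power2_norm_eq_inner inner_vec_def flux_def by (simp add: power2_eq_square)
    then have "ennreal ((norm (fst z))\<^sup>2) = (\<Sum>x\<in>UNIV. \<Sum>y\<in>UNIV. ennreal ((flux z x y)\<^sup>2))"
      by (simp add: sum_nonneg sum_ennreal)
    also have "\<dots> \<le> (\<Sum>x\<in>UNIV. \<Sum>y\<in>UNIV. ennreal (if K x y = 0 then 0 else B / w x y) * flux_action K \<pi> \<mu> (flux z))"
      by (intro sum_mono edge)
    also have "\<dots> = ennreal D * flux_action K \<pi> \<mu> (flux z)"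
    proof -
      have nn: "0 \<le> (if K x y = 0 then 0 else B / w x y)" for x y using w[of x y] assms by (simp add: less_imp_le)
      have "ennreal D = (\<Sum>x\<in>UNIV. \<Sum>y\<in>UNIV. ennreal (if K x y = 0 then 0 else B / w x y))"
        unfolding D_def using nn by (simp only: sum_ennreal sum_nonneg)
      then show ?thesis by (simp only: sum_distrib_right)
    qed
    finally show ?thesis .
  qed
  show thesis
  proof (rule that[of "D / b\<^sup>2 + 1 / a\<^sup>2"])
    show "0 \<le> D / b\<^sup>2 + 1 / a\<^sup>2" using D by simp
    fix \<mu> :: "'a \<Rightarrow> real" and z :: "(real^'a^'a) \<times> real"
    assume \<mu>: "\<And>x. 0 \<le> \<mu> x" "\<And>x. \<mu> x \<le> B" and z: "edge_supported z"
    have "ennreal ((norm z)\<^sup>2) = ennreal ((norm (fst z))\<^sup>2) + ennreal ((snd z)\<^sup>2)"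
      by (simp add: norm_prod_def)
    also have "\<dots> \<le> ennreal D * flux_action K \<pi> \<mu> (flux z) + ennreal ((snd z)\<^sup>2)"
      by (intro add_right_mono flux_le \<mu> z)
    also have "ennreal D * flux_action K \<pi> \<mu> (flux z) = ennreal (D / b\<^sup>2) * (ennreal (b\<^sup>2) * flux_action K \<pi> \<mu> (flux z))"
      using D b_pos by (simp add: mult.assoc[symmetric] ennreal_mult[symmetric])
    also have "\<dots> \<le> ennreal (D / b\<^sup>2) * running_cost \<mu> z"
      unfolding running_cost_def by (intro mult_left_mono) auto
    also have "ennreal ((snd z)\<^sup>2) = ennreal (1 / a\<^sup>2) * (ennreal (a\<^sup>2) * ennreal ((snd z)\<^sup>2))"
      using a_pos by (simp add: ennreal_mult[symmetric])
    also have "\<dots> \<le> ennreal (1 / a\<^sup>2) * running_cost \<mu> z"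
      unfolding running_cost_def by (intro mult_left_mono) auto
    finally show "ennreal ((norm z)\<^sup>2) \<le> ennreal (D / b\<^sup>2 + 1 / a\<^sup>2) * running_cost \<mu> z"
      using D by (simp add: distrib_right add_left_mono add_right_mono ennreal_plus)
  qed
qed

lemma admissible_integrable: "admissible \<mu>0 \<mu>1 u \<Longrightarrow> integrable (lebesgue_on {0..1}) u"
  by (simp add: admissible_def)

text \<open>The values of \<open>V\<close> off the edges are set to zero, which affects neither divergence nor action. A curve of
densities is continuous, hence bounded, so finite energy makes the control square integrable; the
integral equation is then the fundamental theorem of calculus for absolutely continuous functions.\<close>

lemma continuity_triple_imp_admissible:
  assumes ce: "(\<mu>, V, h) \<in> continuity_triples K p \<mu>0 \<mu>1"
    and fin: "quad_energy K \<pi> a b (\<mu>, V, h) < \<infinity>"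
  obtains u where "admissible \<mu>0 \<mu>1 u" "\<And>t. edge_supported (u t)"
    "total_cost \<mu>0 u = quad_energy K \<pi> a b (\<mu>, V, h)"
proof -
  define M where "M = lebesgue_on {0..1::real}"
  interpret finite_measure M
    unfolding M_def by (rule finite_measure_lebesgue_on) auto
  have dc: "density_curve \<mu>0 \<mu>1 \<mu>"
    and V: "\<And>x y. (\<lambda>t. V t x y) \<in> borel_measurable M"
    and h: "h \<in> borel_measurable M"
    and ae: "AE t in M. \<forall>x. \<exists>\<mu>'.
        ((\<lambda>s. \<mu> s x) has_real_derivative \<mu>') (at t within {0..1}) \<and>
        \<mu>' + discrete_divergence K (V t) x = h t * p x"
    using ce unfolding continuity_triples_def M_def by auto
  note \<mu> = density_curveD[OF dc, folded M_def]
  define u :: "real \<Rightarrow> (real^'a^'a) \<times> real" where "u t = ((\<chi> x y. if K x y = 0 then 0 else V t x y), h t)" for t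
  have flux_u: "flux (u t) x y = (if K x y = 0 then 0 else V t x y)" for t x y by (simp add: flux_def u_def)
  have snd_u: "snd (u t) = h t" for t by (simp add: u_def)
  have supp: "edge_supported (u t)" for t by (simp add: edge_supported_def flux_u)
  have K0: "K x y = 0 \<longleftrightarrow> K y x = 0" for x y
    using conductance_eq_0_iff[of x y] conductance_eq_0_iff[of y x] conductance_commute[of x y] by simp
  have div_u: "discrete_divergence K (flux (u t)) x = discrete_divergence K (V t) x" for t x
  proof -
    have "(flux (u t) x y - flux (u t) y x) * K x y = (V t x y - V t y x) * K x y" for y
      using K0[of x y] by (simp add: flux_u)
    then show ?thesis unfolding discrete_divergence_def by (simp only:)
  qed
  have act_u: "flux_action K \<pi> (\<mu> t) (flux (u t)) = flux_action K \<pi> (\<mu> t) (V t)" for t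
  proof -
    have "action_density (flux (u t) x y) (\<mu> t x) (\<mu> t y) * ennreal (K x y) * ennreal (\<pi> x) =
        action_density (V t x y) (\<mu> t x) (\<mu> t y) * ennreal (K x y) * ennreal (\<pi> x)" for x y
      by (cases "K x y = 0") (simp_all add: flux_u)
    then show ?thesis unfolding flux_action_def by (simp only:)
  qed
  have um: "u \<in> borel_measurable M"
    unfolding u_def using V h by (intro borel_measurable_Pair borel_measurable_vec_lambda2) auto
  have cost: "(\<integral>\<^sup>+t. running_cost (\<mu> t) (u t) \<partial>M) = quad_energy K \<pi> a b (\<mu>, V, h)"
    using quad_energy_eq_integral_running_cost[OF dc um[unfolded M_def]]
    by (simp add: quad_energy_def act_u snd_u M_def)
  obtain B where "0 < B" and B: "\<And>t x. t \<in> {0..1} \<Longrightarrow> \<mu> t x \<le> B"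
  proof -
    have "\<forall>x. \<exists>B. \<forall>t\<in>{0..1}. \<bar>\<mu> t x\<bar> \<le> B"
      using compact_imp_bounded[OF compact_continuous_image[OF \<mu>(2) compact_Icc]]
      by (auto simp: bounded_iff)
    then obtain B where B: "\<And>x t. t \<in> {0..1} \<Longrightarrow> \<bar>\<mu> t x\<bar> \<le> B x" by metis
    have "\<mu> t x \<le> 1 + (\<Sum>x\<in>UNIV. \<bar>B x\<bar>)" if "t \<in> {0..1}" for t x
      using B[OF that, of x] member_le_sum[of x UNIV "\<lambda>x. \<bar>B x\<bar>"] by simp
    moreover have "0 < 1 + (\<Sum>x\<in>UNIV. \<bar>B x\<bar>)" by (intro add_pos_nonneg sum_nonneg) simp_all
    ultimately show thesis using that by blast
  qed
  obtain C where C: "\<And>\<mu> z. \<lbrakk>\<And>x. 0 \<le> \<mu> x; \<And>x. \<mu> x \<le> B; edge_supported z\<rbrakk> \<Longrightarrow>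
      ennreal ((norm z)\<^sup>2) \<le> ennreal C * running_cost \<mu> z"
    using norm_le_running_cost[OF \<open>0 < B\<close>] by blast
  have "(\<integral>\<^sup>+t. ennreal ((norm (u t))\<^sup>2) \<partial>M) \<le> (\<integral>\<^sup>+t. ennreal C * running_cost (\<mu> t) (u t) \<partial>M)"
    using \<mu>(1) B supp by (intro nn_integral_mono C) (auto simp: M_def)
  also have "\<dots> = ennreal C * quad_energy K \<pi> a b (\<mu>, V, h)"
    using borel_measurable_running_cost[OF dc um[unfolded M_def]] by (simp add: nn_integral_cmult cost[symmetric] M_def)
  also have "\<dots> < \<infinity>" using fin by (simp add: ennreal_mult_less_top)
  finally have int: "integrable M u" using um by (intro integrable_if_square_integrable)
  define D where "D t \<longleftrightarrow> (\<forall>x. ((\<lambda>s. \<mu> s x) has_real_derivative velocity (u t) x) (at t within {0..1}))" for t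
  have "AE t in M. D t"
    using ae
  proof eventually_elim
    fix t assume ex: "\<forall>x. \<exists>\<mu>'. ((\<lambda>s. \<mu> s x) has_real_derivative \<mu>') (at t within {0..1}) \<and>
        \<mu>' + discrete_divergence K (V t) x = h t * p x"
    show "D t"
      unfolding D_def
    proof
      fix x
      obtain \<mu>' where "((\<lambda>s. \<mu> s x) has_real_derivative \<mu>') (at t within {0..1})"
        "\<mu>' + discrete_divergence K (V t) x = h t * p x" using ex by blast
      moreover from this have "\<mu>' = velocity (u t) x" by (simp add: velocity_def snd_u div_u)
      ultimately show "((\<lambda>s. \<mu> s x) has_real_derivative velocity (u t) x) (at t within {0..1})" by simp
    qed
  qed
  then have "AE t in lebesgue. t \<in> {0..1} \<longrightarrow> D t" unfolding M_def by (subst (asm) AE_restrict_space_iff) auto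
  then obtain N where "N \<in> null_sets lebesgue" and ND: "{t \<in> space lebesgue. \<not> (t \<in> {0..1} \<longrightarrow> D t)} \<subseteq> N"
    unfolding eventually_ae_filter by blast
  then have N: "negligible N" by (simp add: negligible_iff_null_sets)
  have deriv: "((\<lambda>s. \<mu> s x) has_real_derivative velocity (u t) x) (at t within {0..1})" if "t \<in> {0..1} - N" for t x
  proof -
    have "D t" using ND that by auto
    then show ?thesis by (simp add: D_def)
  qed
  have ac: "absolutely_continuous_fun_on 0 1 (\<lambda>s. \<mu> s x)" and ends: "\<mu> 0 = \<mu>0" "\<mu> 1 = \<mu>1" for x
    using dc unfolding density_curve_def by blast+
  have traj: "trajectory \<mu>0 u t x = \<mu> t x" if t: "t \<in> {0..1}" for t x
  proof -
    have "((\<lambda>s. velocity (u s) x) has_integral (\<mu> t x - \<mu> 0 x)) {0..t}"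
    proof (rule has_integral_derivative_absolutely_continuous[OF _ _ N])
      show "absolutely_continuous_fun_on 0 t (\<lambda>s. \<mu> s x)"
        using t by (intro absolutely_continuous_fun_on_subinterval[OF ac]) simp_all
      show "((\<lambda>s. \<mu> s x) has_real_derivative velocity (u s) x) (at s within {0..t})" if "s \<in> {0..t} - N" for s
        using that t by (intro DERIV_subset[OF deriv]) auto
    qed (use t in auto)
    then show ?thesis by (simp add: trajectory_def integral_unique ends)
  qed
  show thesis
  proof (rule that[OF _ supp])
    show "admissible \<mu>0 \<mu>1 u"
      unfolding admissible_def
    proof (intro conjI ballI allI ext)
      show "integrable (lebesgue_on {0..1}) u" using int by (simp add: M_def)
      show "0 \<le> trajectory \<mu>0 u t x" if "t \<in> {0..1}" for t x using traj[OF that] \<mu>(1)[OF that] by simp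
      show "trajectory \<mu>0 u 1 x = \<mu>1 x" for x using traj[of 1 x] ends by simp
    qed
    have "total_cost \<mu>0 u = (\<integral>\<^sup>+t. running_cost (\<mu> t) (u t) \<partial>M)"
      unfolding total_cost_def M_def
    proof (rule nn_integral_cong)
      fix t assume "t \<in> space (lebesgue_on {0..1::real})"
      then have "trajectory \<mu>0 u t = \<mu> t" using traj by (auto simp: fun_eq_iff)
      then show "running_cost (trajectory \<mu>0 u t) (u t) = running_cost (\<mu> t) (u t)" by simp
    qed
    then show "total_cost \<mu>0 u = quad_energy K \<pi> a b (\<mu>, V, h)" using cost by simp
  qed
qed

text \<open>Transport conserves mass, so the total mass changes at rate \<open>h\<close>; this uses the normalisation of \<open>p\<close>.\<close>

lemma sum_velocity: "(\<Sum>x\<in>UNIV. \<pi> x * velocity z x) = snd z"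
proof -
  have "(\<Sum>x\<in>UNIV. \<pi> x * velocity z x) = snd z * (\<Sum>x\<in>UNIV. p x * \<pi> x) - (\<Sum>x\<in>UNIV. \<pi> x * discrete_divergence K (flux z) x)"
    by (simp add: velocity_def right_diff_distrib sum_subtractf sum_distrib_left mult_ac)
  then show ?thesis by (simp add: p_normalised sum_discrete_divergence_zero)
qed

text \<open>The mass changes at rate \<open>h\<close>, and \<open>h \<le> 1 + h\<^sup>2\<close>, where the energy controls the integral of \<open>h\<^sup>2\<close>.\<close>

lemma trajectory_mass_le:
  assumes adm: "admissible \<mu>0 \<mu>1 u" and cost: "total_cost \<mu>0 u \<le> ennreal E" and "0 \<le> E" and t: "t \<in> {0..1}"
  shows "(\<Sum>x\<in>UNIV. \<pi> x * trajectory \<mu>0 u t x) \<le> (\<Sum>x\<in>UNIV. \<pi> x * \<mu>0 x) + (1 + E / a\<^sup>2)"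
proof -
  define M where "M = lebesgue_on {0..1::real}"
  interpret finite_measure M
    unfolding M_def by (rule finite_measure_lebesgue_on) auto
  have int: "integrable M u" using adm by (simp add: admissible_def M_def)
  have hm [measurable]: "(\<lambda>t. snd (u t)) \<in> borel_measurable M" using int by (intro borel_measurable_control) simp
  have "ennreal (a\<^sup>2) * (\<integral>\<^sup>+t. ennreal ((snd (u t))\<^sup>2) \<partial>M) = (\<integral>\<^sup>+t. ennreal (a\<^sup>2) * ennreal ((snd (u t))\<^sup>2) \<partial>M)"
    by (simp add: nn_integral_cmult)
  also have "\<dots> \<le> total_cost \<mu>0 u"
    unfolding total_cost_def running_cost_def M_def by (intro nn_integral_mono) simp
  finally have "ennreal (a\<^sup>2) * (\<integral>\<^sup>+t. ennreal ((snd (u t))\<^sup>2) \<partial>M) \<le> ennreal E" using cost by simp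
  then have "ennreal (1 / a\<^sup>2) * (ennreal (a\<^sup>2) * (\<integral>\<^sup>+t. ennreal ((snd (u t))\<^sup>2) \<partial>M)) \<le> ennreal (1 / a\<^sup>2) * ennreal E"
    by (rule mult_left_mono) simp
  then have sq: "(\<integral>\<^sup>+t. ennreal ((norm (snd (u t)))\<^sup>2) \<partial>M) \<le> ennreal (E / a\<^sup>2)"
    using a_pos \<open>0 \<le> E\<close> by (simp add: mult.assoc[symmetric] ennreal_mult[symmetric])
  then have fin: "(\<integral>\<^sup>+t. ennreal ((norm (snd (u t)))\<^sup>2) \<partial>M) < \<infinity>" using le_less_trans by fastforce
  note sq_int = integrable_if_square_integrable[OF hm fin]
  have "ennreal (\<integral>t. (norm (snd (u t)))\<^sup>2 \<partial>M) = (\<integral>\<^sup>+t. ennreal ((norm (snd (u t)))\<^sup>2) \<partial>M)"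
    using sq_int(1) by (intro nn_integral_eq_integral[symmetric]) auto
  with sq have "ennreal (\<integral>t. (snd (u t))\<^sup>2 \<partial>M) \<le> ennreal (E / a\<^sup>2)" by simp
  then have h2: "(\<integral>t. (snd (u t))\<^sup>2 \<partial>M) \<le> E / a\<^sup>2"
    using \<open>0 \<le> E\<close> by (subst (asm) ennreal_le_iff) simp_all
  have int_t: "(\<lambda>s. velocity (u s) x) integrable_on {0..t}" for x
    using integrable_lebesgue_on_subinterval(2)[OF integrable_velocity, of 0 1 u 0 t x] int t by (simp add: M_def)
  have "(\<Sum>x\<in>UNIV. \<pi> x * trajectory \<mu>0 u t x) =
      (\<Sum>x\<in>UNIV. \<pi> x * \<mu>0 x) + (\<Sum>x\<in>UNIV. integral {0..t} (\<lambda>s. \<pi> x * velocity (u s) x))"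
    by (simp add: trajectory_def distrib_left sum.distrib)
  also have "(\<Sum>x\<in>UNIV. integral {0..t} (\<lambda>s. \<pi> x * velocity (u s) x)) = integral {0..t} (\<lambda>s. snd (u s))"
    using int_t by (subst integral_sum[symmetric]) (auto simp: sum_velocity intro: integrable_on_mult_right)
  also have "\<dots> \<le> integral {0..1} (\<lambda>s. 1 + (snd (u s))\<^sup>2)"
  proof -
    have sq': "integrable (lebesgue_on {0..1}) (\<lambda>s. 1 + (snd (u s))\<^sup>2)"
      using sq_int(1) by (intro Bochner_Integration.integrable_add) (auto simp: M_def)
    have "x \<le> 1 + x\<^sup>2" for x :: real
      using zero_le_power2[of "x - 1/2"] by (simp add: power2_eq_square algebra_simps)
    then have "integral {0..t} (\<lambda>s. snd (u s)) \<le> integral {0..t} (\<lambda>s. 1 + (snd (u s))\<^sup>2)"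
      using t sq_int(2) by (intro integral_le integrable_lebesgue_on_subinterval(2)[OF sq'] integrable_lebesgue_on_subinterval(2)) (auto simp: M_def)
    also have "\<dots> \<le> integral {0..1} (\<lambda>s. 1 + (snd (u s))\<^sup>2)"
      using t by (intro integral_subset_le integrable_lebesgue_on_subinterval(2)[OF sq']) auto
    finally show ?thesis .
  qed
  also have "\<dots> = (\<integral>s. 1 + (snd (u s))\<^sup>2 \<partial>M)"
    using sq_int(1) unfolding M_def
    by (intro lebesgue_integral_eq_integral[symmetric] Bochner_Integration.integrable_add) auto
  also have "\<dots> = 1 + (\<integral>s. (snd (u s))\<^sup>2 \<partial>M)"
    using sq_int(1) by (subst Bochner_Integration.integral_add) (auto simp: M_def measure_restrict_space)
  finally show ?thesis using h2 by simp
qed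

text \<open>The mass estimate bounds the densities in terms of the starting point and the energy only, whereas
the bound that a single curve has by continuity would depend on the curve.\<close>

lemma uniform_square_bound:
  assumes "0 \<le> E"
  obtains B where "\<And>\<mu>1 u. \<lbrakk>admissible \<mu>0 \<mu>1 u; \<And>t. edge_supported (u t); total_cost \<mu>0 u \<le> ennreal E\<rbrakk> \<Longrightarrow>
      (\<integral>\<^sup>+t. ennreal ((norm (u t))\<^sup>2) \<partial>lebesgue_on {0..1}) \<le> ennreal B"
proof -
  define R where "R = (\<Sum>x\<in>UNIV. \<pi> x * \<mu>0 x) + (1 + E / a\<^sup>2)"
  \<comment> \<open>\<open>R\<close> bounds the total mass, hence \<open>R / \<pi> x\<close> bounds the density at \<open>x\<close>.\<close>
  define B where "B = 1 + (\<Sum>x\<in>UNIV. \<bar>R / \<pi> x\<bar>)"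
  have "0 < B" unfolding B_def by (intro add_pos_nonneg sum_nonneg) simp_all
  then obtain C where "0 \<le> C" and C: "\<And>\<mu> z. \<lbrakk>\<And>x. 0 \<le> \<mu> x; \<And>x. \<mu> x \<le> B; edge_supported z\<rbrakk> \<Longrightarrow>
      ennreal ((norm z)\<^sup>2) \<le> ennreal C * running_cost \<mu> z"
    using norm_le_running_cost by blast
  show thesis
  proof (rule that[of "C * E"])
    fix \<mu>1 u
    assume adm: "admissible \<mu>0 \<mu>1 u" and supp: "\<And>t. edge_supported (u t)" and cost: "total_cost \<mu>0 u \<le> ennreal E"
    have nonneg: "0 \<le> trajectory \<mu>0 u t x" if "t \<in> {0..1}" for t x using adm that by (simp add: admissible_def)
    have le: "trajectory \<mu>0 u t x \<le> B" if t: "t \<in> {0..1}" for t x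
    proof -
      have "\<pi> x * trajectory \<mu>0 u t x \<le> (\<Sum>x\<in>UNIV. \<pi> x * trajectory \<mu>0 u t x)"
        using nonneg[OF t] invariant_nonneg by (intro member_le_sum) auto
      also have "\<dots> \<le> R" unfolding R_def by (rule trajectory_mass_le[OF adm cost assms t])
      finally have "trajectory \<mu>0 u t x \<le> R / \<pi> x" using invariant_pos[of x] by (simp add: field_simps)
      also have "\<dots> \<le> \<bar>R / \<pi> x\<bar>" by (rule abs_ge_self)
      also have "\<dots> \<le> (\<Sum>x\<in>UNIV. \<bar>R / \<pi> x\<bar>)"
        by (rule member_le_sum[of x UNIV "\<lambda>x. \<bar>R / \<pi> x\<bar>"]) auto
      finally show ?thesis by (simp add: B_def)
    qed
    have "(\<integral>\<^sup>+t. ennreal ((norm (u t))\<^sup>2) \<partial>lebesgue_on {0..1}) \<le>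
        (\<integral>\<^sup>+t. ennreal C * running_cost (trajectory \<mu>0 u t) (u t) \<partial>lebesgue_on {0..1})"
      using nonneg le supp by (intro nn_integral_mono C) auto
    also have "\<dots> = ennreal C * total_cost \<mu>0 u"
      unfolding total_cost_def
      by (intro nn_integral_cmult borel_measurable_running_cost[OF density_curve_trajectory[OF adm]])
         (use admissible_integrable[OF adm] in simp)
    also have "\<dots> \<le> ennreal C * ennreal E" using cost by (rule mult_left_mono) simp
    finally show "(\<integral>\<^sup>+t. ennreal ((norm (u t))\<^sup>2) \<partial>lebesgue_on {0..1}) \<le> ennreal (C * E)"
      using \<open>0 \<le> C\<close> assms by (simp add: ennreal_mult)
  qed
qed

lemma trajectory_midpoint:
  assumes u: "integrable (lebesgue_on {0..1}) u" and v: "integrable (lebesgue_on {0..1}) v" and t: "t \<in> {0..1}"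
  shows "trajectory \<mu>0 (\<lambda>t. (1/2) *\<^sub>R (u t + v t)) t = (\<lambda>x. (trajectory \<mu>0 u t x + trajectory \<mu>0 v t x) / 2)"
proof
  fix x
  have int: "(\<lambda>s. velocity (w s) x) integrable_on {0..t}" if "integrable (lebesgue_on {0..1}) w" for w
    using integrable_lebesgue_on_subinterval(2)[OF integrable_velocity[OF that], of 0 t] t by simp
  have "velocity ((1/2) *\<^sub>R (z + z')) x = (velocity z x + velocity z' x) / 2" for z z'
    by (simp only: linear_scale[OF linear_velocity] linear_add[OF linear_velocity]) simp
  then have "integral {0..t} (\<lambda>s. velocity ((1/2) *\<^sub>R (u s + v s)) x) = integral {0..t} (\<lambda>s. (velocity (u s) x + velocity (v s) x) / 2)"
    by (simp only:)
  also have "\<dots> = (integral {0..t} (\<lambda>s. velocity (u s) x) + integral {0..t} (\<lambda>s. velocity (v s) x)) / 2"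
    using int[OF u] int[OF v] by (simp add: Henstock_Kurzweil_Integration.integral_add)
  finally show "trajectory \<mu>0 (\<lambda>t. (1/2) *\<^sub>R (u t + v t)) t x = (trajectory \<mu>0 u t x + trajectory \<mu>0 v t x) / 2"
    by (simp add: trajectory_def)
qed

lemma admissible_midpoint:
  assumes u: "admissible \<mu>0 \<mu>1 u" and v: "admissible \<mu>0 \<mu>1 v"
  shows "admissible \<mu>0 \<mu>1 (\<lambda>t. (1/2) *\<^sub>R (u t + v t))"
  unfolding admissible_def
proof (intro conjI ballI allI)
  note int = admissible_integrable[OF u] admissible_integrable[OF v]
  show "integrable (lebesgue_on {0..1}) (\<lambda>t. (1/2) *\<^sub>R (u t + v t))"
    using int by simp
  show "0 \<le> trajectory \<mu>0 (\<lambda>t. (1/2) *\<^sub>R (u t + v t)) t x" if "t \<in> {0..1}" for t x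
    using u v that by (simp add: trajectory_midpoint[OF int that] admissible_def)
  show "trajectory \<mu>0 (\<lambda>t. (1/2) *\<^sub>R (u t + v t)) 1 = \<mu>1"
    using u v by (simp add: trajectory_midpoint[OF int] admissible_def)
qed

lemma running_cost_midpoint:
  assumes "\<And>x. 0 \<le> \<mu> x" "\<And>x. 0 \<le> \<mu>' x"
  shows "2 * running_cost (\<lambda>x. (\<mu> x + \<mu>' x) / 2) ((1/2) *\<^sub>R (z + z')) \<le> running_cost \<mu> z + running_cost \<mu>' z'"
proof -
  have "2 * ((snd z + snd z') / 2)\<^sup>2 \<le> (snd z)\<^sup>2 + (snd z')\<^sup>2"
    using zero_le_power2[of "snd z - snd z'"] by (simp add: power2_eq_square field_simps)
  then have "ennreal (2 * ((snd z + snd z') / 2)\<^sup>2) \<le> ennreal ((snd z)\<^sup>2 + (snd z')\<^sup>2)" by (rule ennreal_leI)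
  then have h: "2 * ennreal ((snd ((1/2) *\<^sub>R (z + z')))\<^sup>2) \<le> ennreal ((snd z)\<^sup>2) + ennreal ((snd z')\<^sup>2)"
    by (simp add: ennreal_mult ennreal_plus)
  have "flux ((1/2) *\<^sub>R (z + z')) = (\<lambda>x y. (flux z x y + flux z' x y) / 2)"
    by (simp add: fun_eq_iff flux_def)
  then have f: "2 * flux_action K \<pi> (\<lambda>x. (\<mu> x + \<mu>' x) / 2) (flux ((1/2) *\<^sub>R (z + z'))) \<le>
      flux_action K \<pi> \<mu> (flux z) + flux_action K \<pi> \<mu>' (flux z')"
    using flux_action_midpoint[of \<mu> \<mu>' K \<pi> "flux z" "flux z'"] assms by simp
  have "2 * running_cost (\<lambda>x. (\<mu> x + \<mu>' x) / 2) ((1/2) *\<^sub>R (z + z')) =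
      ennreal (a\<^sup>2) * (2 * ennreal ((snd ((1/2) *\<^sub>R (z + z')))\<^sup>2)) +
      ennreal (b\<^sup>2) * (2 * flux_action K \<pi> (\<lambda>x. (\<mu> x + \<mu>' x) / 2) (flux ((1/2) *\<^sub>R (z + z'))))"
    unfolding running_cost_def by (simp only: distrib_left mult.left_commute)
  also have "\<dots> \<le> ennreal (a\<^sup>2) * (ennreal ((snd z)\<^sup>2) + ennreal ((snd z')\<^sup>2)) +
      ennreal (b\<^sup>2) * (flux_action K \<pi> \<mu> (flux z) + flux_action K \<pi> \<mu>' (flux z'))"
    by (intro add_mono mult_left_mono h f) auto
  also have "\<dots> = running_cost \<mu> z + running_cost \<mu>' z'"
    unfolding running_cost_def by (simp only: distrib_left add_ac)
  finally show ?thesis .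
qed

lemma borel_measurable_admissible_cost:
  assumes "admissible \<mu>0 \<mu>1 u"
  shows "(\<lambda>t. running_cost (trajectory \<mu>0 u t) (u t)) \<in> borel_measurable (lebesgue_on {0..1})"
  using admissible_integrable[OF assms]
  by (intro borel_measurable_running_cost[OF density_curve_trajectory[OF assms]]) simp

lemma total_cost_midpoint:
  assumes u: "admissible \<mu>0 \<mu>1 u" and v: "admissible \<mu>0 \<mu>1 v"
    and "total_cost \<mu>0 u \<le> c" "total_cost \<mu>0 v \<le> c"
  shows "total_cost \<mu>0 (\<lambda>t. (1/2) *\<^sub>R (u t + v t)) \<le> c"
proof -
  define w where "w t = (1/2) *\<^sub>R (u t + v t)" for t
  have w: "admissible \<mu>0 \<mu>1 w" unfolding w_def by (rule admissible_midpoint[OF u v])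
  note meas = borel_measurable_admissible_cost[OF u] borel_measurable_admissible_cost[OF v] borel_measurable_admissible_cost[OF w]
  have "2 * total_cost \<mu>0 w = (\<integral>\<^sup>+t. 2 * running_cost (trajectory \<mu>0 w t) (w t) \<partial>lebesgue_on {0..1})"
    unfolding total_cost_def using meas(3) by (simp add: nn_integral_cmult)
  also have "\<dots> \<le> (\<integral>\<^sup>+t. running_cost (trajectory \<mu>0 u t) (u t) + running_cost (trajectory \<mu>0 v t) (v t) \<partial>lebesgue_on {0..1})"
  proof (rule nn_integral_mono)
    fix t assume "t \<in> space (lebesgue_on {0..1::real})"
    then have t: "t \<in> {0..1}" by simp
    have "trajectory \<mu>0 w t = (\<lambda>x. (trajectory \<mu>0 u t x + trajectory \<mu>0 v t x) / 2)"
      unfolding w_def by (rule trajectory_midpoint[OF admissible_integrable[OF u] admissible_integrable[OF v] t])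
    then show "2 * running_cost (trajectory \<mu>0 w t) (w t) \<le>
        running_cost (trajectory \<mu>0 u t) (u t) + running_cost (trajectory \<mu>0 v t) (v t)"
      using running_cost_midpoint[of "trajectory \<mu>0 u t" "trajectory \<mu>0 v t" "u t" "v t"] u v t
      by (simp add: w_def admissible_def)
  qed
  also have "\<dots> = total_cost \<mu>0 u + total_cost \<mu>0 v"
    unfolding total_cost_def by (rule nn_integral_add[OF meas(1,2)])
  also have "\<dots> \<le> 2 * c" using assms(3,4) by (simp add: mult_2 add_mono)
  finally have "2 * total_cost \<mu>0 w \<le> 2 * c" .
  then have "total_cost \<mu>0 w \<le> c" by (simp add: ennreal_mult_le_mult_iff)
  then show ?thesis unfolding w_def .
qed

lemma running_cost_lower_semicontinuous:
  assumes z: "z \<longlonglongrightarrow> z0" and \<mu>: "\<And>x. (\<lambda>n. \<mu> n x) \<longlonglongrightarrow> \<mu>0 x" "\<And>n x. 0 \<le> \<mu> n x"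
  shows "running_cost \<mu>0 z0 \<le> liminf (\<lambda>n. running_cost (\<mu> n) (z n))"
proof -
  have flux: "(\<lambda>n. flux (z n) x y) \<longlonglongrightarrow> flux z0 x y" for x y
    unfolding flux_def using z by (intro tendsto_intros)
  have "(\<lambda>n. ennreal (a\<^sup>2) * ennreal ((snd (z n))\<^sup>2)) \<longlonglongrightarrow> ennreal (a\<^sup>2) * ennreal ((snd z0)\<^sup>2)"
    using z by (intro ennreal_tendsto_cmult tendsto_ennrealI tendsto_intros) auto
  then have h: "ennreal (a\<^sup>2) * ennreal ((snd z0)\<^sup>2) = liminf (\<lambda>n. ennreal (a\<^sup>2) * ennreal ((snd (z n))\<^sup>2))"
    by (intro lim_imp_Liminf[symmetric]) auto
  have "ennreal (b\<^sup>2) * flux_action K \<pi> \<mu>0 (flux z0) \<le> ennreal (b\<^sup>2) * liminf (\<lambda>n. flux_action K \<pi> (\<mu> n) (flux (z n)))"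
    by (intro mult_left_mono flux_action_lower_semicontinuous flux \<mu>) auto
  also have "\<dots> \<le> liminf (\<lambda>n. ennreal (b\<^sup>2) * flux_action K \<pi> (\<mu> n) (flux (z n)))"
    using sum_liminf_le_liminf_sum[of "\<lambda>_::unit. ennreal (b\<^sup>2)" "\<lambda>n _. flux_action K \<pi> (\<mu> n) (flux (z n))"]
    by (simp add: UNIV_unit)
  finally have "running_cost \<mu>0 z0 \<le> liminf (\<lambda>n. ennreal (a\<^sup>2) * ennreal ((snd (z n))\<^sup>2)) +
      liminf (\<lambda>n. ennreal (b\<^sup>2) * flux_action K \<pi> (\<mu> n) (flux (z n)))"
    unfolding running_cost_def h by (rule add_left_mono)
  also have "\<dots> \<le> liminf (\<lambda>n. running_cost (\<mu> n) (z n))"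
    unfolding running_cost_def by (rule liminf_add_ennreal)
  finally show ?thesis .
qed

text \<open>The velocity is a linear function on a finite-dimensional space, so it is dominated along with the
controls.\<close>

lemma trajectory_tendsto:
  assumes u: "\<And>n. integrable (lebesgue_on {0..1}) (u n)" and w: "w \<in> borel_measurable (lebesgue_on {0..1})"
    and g: "integrable (lebesgue_on {0..1}) g"
    and lim: "AE t in lebesgue_on {0..1}. (\<lambda>n. u n t) \<longlonglongrightarrow> w t"
    and dom: "AE t in lebesgue_on {0..1}. \<forall>n. norm (u n t) \<le> g t"
  shows "integrable (lebesgue_on {0..1}) w"
    and "\<And>t x. t \<in> {0..1} \<Longrightarrow> (\<lambda>n. trajectory \<mu>0 (u n) t x) \<longlonglongrightarrow> trajectory \<mu>0 w t x"
proof -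
  show wint: "integrable (lebesgue_on {0..1}) w"
    by (rule integrable_dominated_convergence[OF w _ g lim]) (use u dom in \<open>auto elim: eventually_mono\<close>)
  fix t x assume t: "t \<in> {0..1::real}"
  have sub: "AE s in lebesgue_on {0..t}. P s" if "AE s in lebesgue_on {0..1}. P s" for P
    using that t by (auto simp: AE_restrict_space_iff elim!: eventually_mono)
  have bl: "bounded_linear (\<lambda>z. velocity z x)"
    using linear_velocity by (simp add: linear_conv_bounded_linear)
  then obtain c where "0 \<le> c" and c: "\<And>z. norm (velocity z x) \<le> norm z * c"
    using bounded_linear.nonneg_bounded by blast
  note vel = integrable_lebesgue_on_subinterval[OF integrable_velocity[OF u], of 0 t]
    integrable_lebesgue_on_subinterval[OF integrable_velocity[OF wint], of 0 t]
  have "(\<lambda>n. \<integral>s. velocity (u n s) x \<partial>lebesgue_on {0..t}) \<longlonglongrightarrow> (\<integral>s. velocity (w s) x \<partial>lebesgue_on {0..t})"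
  proof (rule integral_dominated_convergence[where w="\<lambda>s. g s * c"])
    show "integrable (lebesgue_on {0..t}) (\<lambda>s. g s * c)"
      using integrable_lebesgue_on_subinterval(1)[OF g, of 0 t] t by simp
    show "AE s in lebesgue_on {0..t}. (\<lambda>n. velocity (u n s) x) \<longlonglongrightarrow> velocity (w s) x"
      using sub[OF lim] by eventually_elim (rule bounded_linear.tendsto[OF bl])
    show "AE s in lebesgue_on {0..t}. norm (velocity (u n s) x) \<le> g s * c" for n
      using sub[OF dom]
    proof eventually_elim
      fix s assume "\<forall>n. norm (u n s) \<le> g s"
      then have "norm (u n s) * c \<le> g s * c" using \<open>0 \<le> c\<close> by (intro mult_right_mono) auto
      with c[of "u n s"] show "norm (velocity (u n s) x) \<le> g s * c" by linarith
    qed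
  qed (use vel t in auto)
  then show "(\<lambda>n. trajectory \<mu>0 (u n) t x) \<longlonglongrightarrow> trajectory \<mu>0 w t x"
    unfolding trajectory_def using vel t by (intro tendsto_intros) auto
qed

text \<open>The controls whose energy exceeds \<open>m\<close> by at most \<open>1 / (n + 1)\<close> satisfy the hypotheses of
\<open>nested_midpoint_convex_L2_limit\<close>. Its limit is admissible by convergence of the curves and has
energy at most \<open>m\<close> by Fatou's lemma.\<close>

lemma exists_minimiser:
  assumes "0 \<le> m"
    and approx: "\<And>n. \<exists>u. admissible \<mu>0 \<mu>1 u \<and> (\<forall>t. edge_supported (u t)) \<and> total_cost \<mu>0 u \<le> ennreal (m + 1 / real (Suc n))"
  obtains w where "admissible \<mu>0 \<mu>1 w" "total_cost \<mu>0 w \<le> ennreal m"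
proof -
  define C where "C n = {u. admissible \<mu>0 \<mu>1 u \<and> (\<forall>t. edge_supported (u t)) \<and> total_cost \<mu>0 u \<le> ennreal (m + 1 / real (Suc n))}" for n
  have "0 \<le> m + 1" using assms(1) by simp
  then obtain B where B: "\<And>\<mu>1 u. \<lbrakk>admissible \<mu>0 \<mu>1 u; \<And>t. edge_supported (u t); total_cost \<mu>0 u \<le> ennreal (m + 1)\<rbrakk> \<Longrightarrow>
      (\<integral>\<^sup>+t. ennreal ((norm (u t))\<^sup>2) \<partial>lebesgue_on {0..1}) \<le> ennreal B"
    using uniform_square_bound[of "m + 1" \<mu>0] by blast
  obtain u w g where uC: "\<And>n. u n \<in> C n" and w: "w \<in> borel_measurable (lebesgue_on {0..1})"
    and g: "integrable (lebesgue_on {0..1}) g"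
    and lim: "AE t in lebesgue_on {0..1}. (\<lambda>n. u n t) \<longlonglongrightarrow> w t"
    and dom: "AE t in lebesgue_on {0..1}. \<forall>n. norm (u n t) \<le> g t"
  proof (rule nested_midpoint_convex_L2_limit[of "lebesgue_on {0..1}" C B])
    show "finite_measure (lebesgue_on {0..1::real})" by (rule finite_measure_lebesgue_on) auto
    show "C n \<noteq> {}" for n using approx[of n] by (auto simp: C_def)
    show "C (Suc n) \<subseteq> C n" for n
    proof
      fix u assume u: "u \<in> C (Suc n)"
      have "ennreal (m + 1 / real (Suc (Suc n))) \<le> ennreal (m + 1 / real (Suc n))"
        by (intro ennreal_leI add_left_mono divide_left_mono) auto
      with u show "u \<in> C n" unfolding C_def by (auto intro: order_trans)
    qed
    show "(\<lambda>t. (1/2) *\<^sub>R (u t + v t)) \<in> C n" if "u \<in> C n" "v \<in> C n" for n u v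
      using that by (auto simp: C_def edge_supported_def flux_def intro!: admissible_midpoint total_cost_midpoint)
    show "u \<in> borel_measurable (lebesgue_on {0..1})" if "u \<in> C 0" for u
      using that admissible_integrable by (auto simp: C_def)
    show "(\<integral>\<^sup>+t. ennreal ((norm (u t))\<^sup>2) \<partial>lebesgue_on {0..1}) \<le> ennreal B" if "u \<in> C 0" for u
      using that by (intro B[of \<mu>1]) (auto simp: C_def)
  qed blast
  have adm: "admissible \<mu>0 \<mu>1 (u n)" for n using uC[of n] by (simp add: C_def)
  note lims = trajectory_tendsto[OF admissible_integrable[OF adm] w g lim dom]
  have nonneg: "0 \<le> trajectory \<mu>0 (u n) t x" if "t \<in> {0..1}" for n t x
    using adm[of n] that by (simp add: admissible_def)
  have adm_w: "admissible \<mu>0 \<mu>1 w"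
    unfolding admissible_def
  proof (intro conjI ballI allI ext)
    show "integrable (lebesgue_on {0..1}) w" by (rule lims(1))
    show "0 \<le> trajectory \<mu>0 w t x" if "t \<in> {0..1}" for t x
      by (rule LIMSEQ_le_const[OF lims(2)[OF that]]) (use nonneg[OF that] in auto)
    show "trajectory \<mu>0 w 1 x = \<mu>1 x" for x
      using lims(2)[of 1 \<mu>0 x] adm by (intro LIMSEQ_unique[of "\<lambda>n. trajectory \<mu>0 (u n) 1 x"]) (auto simp: admissible_def)
  qed
  have space: "AE t in lebesgue_on {0..1}. t \<in> {0..1::real}" by (rule AE_I2) simp
  have "total_cost \<mu>0 w \<le> (\<integral>\<^sup>+t. liminf (\<lambda>n. running_cost (trajectory \<mu>0 (u n) t) (u n t)) \<partial>lebesgue_on {0..1})"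
    unfolding total_cost_def
  proof (rule nn_integral_mono_AE)
    show "AE t in lebesgue_on {0..1}. running_cost (trajectory \<mu>0 w t) (w t) \<le>
        liminf (\<lambda>n. running_cost (trajectory \<mu>0 (u n) t) (u n t))"
      using lim space
      by eventually_elim (intro running_cost_lower_semicontinuous lims(2) nonneg)
  qed
  also have "\<dots> \<le> liminf (\<lambda>n. total_cost \<mu>0 (u n))"
    unfolding total_cost_def by (intro nn_integral_liminf borel_measurable_admissible_cost[OF adm])
  also have "\<dots> \<le> liminf (\<lambda>n. ennreal (m + 1 / real (Suc n)))"
    using uC by (intro Liminf_mono always_eventually) (auto simp: C_def)
  also have "\<dots> = ennreal m"
  proof (rule lim_imp_Liminf)
    have "(\<lambda>n. m + 1 / real (Suc n)) \<longlonglongrightarrow> m + 0"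
      by (intro tendsto_intros LIMSEQ_Suc lim_1_over_n)
    then show "(\<lambda>n. ennreal (m + 1 / real (Suc n))) \<longlonglongrightarrow> ennreal m" by (intro tendsto_ennrealI) simp
  qed simp
  finally show thesis using adm_w by (rule that[rotated])
qed

text \<open>Densities can be interpolated linearly: the constant \<open>h\<close> accounts for the difference in mass, and what
is left has mean zero and is the divergence of a gradient.\<close>

lemma continuity_triples_nonempty:
  assumes "\<mu>0 \<in> nonneg_densities" "\<mu>1 \<in> nonneg_densities"
  shows "continuity_triples K p \<mu>0 \<mu>1 \<noteq> {}"
proof -
  define h where "h = (\<Sum>x\<in>UNIV. \<pi> x * (\<mu>1 x - \<mu>0 x))"
  have "(\<Sum>x\<in>UNIV. \<pi> x * (h * p x - (\<mu>1 x - \<mu>0 x))) = h * (\<Sum>x\<in>UNIV. p x * \<pi> x) - h"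
    unfolding h_def by (simp add: right_diff_distrib sum_subtractf sum_distrib_left mult_ac)
  then have "(\<Sum>x\<in>UNIV. \<pi> x * (h * p x - (\<mu>1 x - \<mu>0 x))) = 0" by (simp add: p_normalised)
  from exists_potential_with_divergence[OF this] obtain \<psi> where \<psi>: "\<And>x. discrete_divergence K (\<lambda>x y. \<psi> y - \<psi> x) x = h * p x - (\<mu>1 x - \<mu>0 x)"
    by blast
  define u :: "real \<Rightarrow> (real^'a^'a) \<times> real" where "u = (\<lambda>t. ((\<chi> x y. \<psi> y - \<psi> x), h))"
  have "flux (u t) = (\<lambda>x y. \<psi> y - \<psi> x)" for t by (simp add: fun_eq_iff flux_def u_def)
  then have vel: "velocity (u t) x = \<mu>1 x - \<mu>0 x" for t x
    using \<psi>[of x] by (simp add: velocity_def) (simp add: u_def)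
  have traj: "trajectory \<mu>0 u t x = (1 - t) * \<mu>0 x + t * \<mu>1 x" if "t \<in> {0..1}" for t x
    using that unfolding trajectory_def vel by (simp add: algebra_simps)
  have "admissible \<mu>0 \<mu>1 u"
    unfolding admissible_def
  proof (intro conjI ballI allI ext)
    show "integrable (lebesgue_on {0..1}) u"
      unfolding u_def by (rule finite_measure.integrable_const[OF finite_measure_lebesgue_on]) simp
    show "0 \<le> trajectory \<mu>0 u t x" if "t \<in> {0..1}" for t x
      using assms that by (simp add: traj nonneg_densities_def)
    show "trajectory \<mu>0 u 1 x = \<mu>1 x" for x by (simp add: traj)
  qed
  then show ?thesis using admissible_imp_continuity_triple(1) by blast
qed

lemma quad_energy_minimum_attained:
  assumes "\<mu>0 \<in> nonneg_densities" "\<mu>1 \<in> nonneg_densities"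
  obtains \<tau> where "\<tau> \<in> continuity_triples K p \<mu>0 \<mu>1"
    "\<And>\<sigma>. \<sigma> \<in> continuity_triples K p \<mu>0 \<mu>1 \<Longrightarrow> quad_energy K \<pi> a b \<tau> \<le> quad_energy K \<pi> a b \<sigma>"
proof -
  define I where "I = (INF \<sigma>\<in>continuity_triples K p \<mu>0 \<mu>1. quad_energy K \<pi> a b \<sigma>)"
  have I: "I \<le> quad_energy K \<pi> a b \<sigma>" if "\<sigma> \<in> continuity_triples K p \<mu>0 \<mu>1" for \<sigma>
    unfolding I_def using that by (rule INF_lower)
  obtain \<tau> where "\<tau> \<in> continuity_triples K p \<mu>0 \<mu>1" "quad_energy K \<pi> a b \<tau> \<le> I"
  proof (cases "I = \<infinity>")
    case True
    then show thesis using continuity_triples_nonempty[OF assms] that by auto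
  next
    case False
    then obtain m where m: "0 \<le> m" "I = ennreal m" by (metis ennreal_cases infinity_ennreal_def)
    have "\<exists>u. admissible \<mu>0 \<mu>1 u \<and> (\<forall>t. edge_supported (u t)) \<and> total_cost \<mu>0 u \<le> ennreal (m + 1 / real (Suc n))" for n
    proof -
      have "I < ennreal (m + 1 / real (Suc n))" using m by (simp add: ennreal_less_iff)
      then obtain \<sigma> where \<sigma>: "\<sigma> \<in> continuity_triples K p \<mu>0 \<mu>1" "quad_energy K \<pi> a b \<sigma> < ennreal (m + 1 / real (Suc n))"
        unfolding I_def INF_less_iff by blast
      obtain \<mu> V h where eq: "\<sigma> = (\<mu>, V, h)" by (cases \<sigma>) auto
      have "quad_energy K \<pi> a b (\<mu>, V, h) < \<infinity>" using \<sigma>(2) eq less_trans[OF _ ennreal_less_top] by simp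
      with continuity_triple_imp_admissible[of \<mu> V h \<mu>0 \<mu>1] \<sigma> eq obtain u where
        "admissible \<mu>0 \<mu>1 u" "\<And>t. edge_supported (u t)" "total_cost \<mu>0 u = quad_energy K \<pi> a b (\<mu>, V, h)" by blast
      then show ?thesis using \<sigma>(2) eq by (intro exI[of _ u]) (simp add: less_imp_le)
    qed
    from exists_minimiser[OF m(1) this] obtain w where w: "admissible \<mu>0 \<mu>1 w" "total_cost \<mu>0 w \<le> ennreal m" by blast
    show thesis
      by (rule that[OF admissible_imp_continuity_triple(1)[OF w(1)]])
         (simp add: admissible_imp_continuity_triple(2)[OF w(1)] w(2) m(2))
  qed
  then show thesis using I by (meson order_trans that)
qed

lemma transport_metric_eq_INF_quad_energy:
  "(transport_metric K \<pi> p a b \<mu>0 \<mu>1)\<^sup>2 = (INF \<sigma>\<in>continuity_triples K p \<mu>0 \<mu>1. quad_energy K \<pi> a b \<sigma>)"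
  unfolding transport_metric_power2
proof (rule antisym)
  show "(INF \<sigma>\<in>continuity_triples K p \<mu>0 \<mu>1. quad_energy K \<pi> a b \<sigma>) \<le>
      (INF \<tau>\<in>potential_triples K p \<mu>0 \<mu>1. potential_energy K \<pi> a b \<tau>)"
  proof (rule INF_greatest)
    fix \<tau> assume \<tau>: "\<tau> \<in> potential_triples K p \<mu>0 \<mu>1"
    obtain \<mu> \<psi> h where eq: "\<tau> = (\<mu>, \<psi>, h)" by (cases \<tau>) auto
    obtain V where "(\<mu>, V, h) \<in> continuity_triples K p \<mu>0 \<mu>1"
      "quad_energy K \<pi> a b (\<mu>, V, h) = potential_energy K \<pi> a b (\<mu>, \<psi>, h)"
      using potential_to_flux \<tau> eq by blast
    then show "(INF \<sigma>\<in>continuity_triples K p \<mu>0 \<mu>1. quad_energy K \<pi> a b \<sigma>) \<le> potential_energy K \<pi> a b \<tau>"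
      unfolding eq by (metis INF_lower)
  qed
  show "(INF \<tau>\<in>potential_triples K p \<mu>0 \<mu>1. potential_energy K \<pi> a b \<tau>) \<le>
      (INF \<sigma>\<in>continuity_triples K p \<mu>0 \<mu>1. quad_energy K \<pi> a b \<sigma>)"
  proof (rule INF_greatest)
    fix \<sigma> assume \<sigma>: "\<sigma> \<in> continuity_triples K p \<mu>0 \<mu>1"
    obtain \<mu> V h where eq: "\<sigma> = (\<mu>, V, h)" by (cases \<sigma>) auto
    show "(INF \<tau>\<in>potential_triples K p \<mu>0 \<mu>1. potential_energy K \<pi> a b \<tau>) \<le> quad_energy K \<pi> a b \<sigma>"
    proof (cases "quad_energy K \<pi> a b \<sigma> < \<infinity>")
      case True
      then obtain \<psi> where "(\<mu>, \<psi>, h) \<in> potential_triples K p \<mu>0 \<mu>1"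
        "potential_energy K \<pi> a b (\<mu>, \<psi>, h) \<le> quad_energy K \<pi> a b (\<mu>, V, h)"
        using flux_to_potential[OF _ _ b_pos] \<sigma> eq by blast
      then show ?thesis unfolding eq by (meson INF_lower2)
    next
      case False
      then have "quad_energy K \<pi> a b \<sigma> = top" by (simp add: less_top[symmetric])
      then show ?thesis by simp
    qed
  qed
qed

end

theorem theorem3p4:
  fixes K :: "'x::finite \<Rightarrow> 'x \<Rightarrow> real"
    and \<pi> p \<mu>0 \<mu>1 :: "'x \<Rightarrow> real"
    and a b :: real
  assumes "markov_kernel K"
    and "irreducible_kernel K"
    and "invariant_probability K \<pi>"
    and "reversible_kernel K \<pi>"
    and "0 < a" and "0 < b"
    and "p \<in> pos_densities"
    and "(\<Sum>x\<in>UNIV. p x * \<pi> x) = 1"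
    and "\<mu>0 \<in> nonneg_densities" and "\<mu>1 \<in> nonneg_densities"
  shows "\<exists>(\<mu>, V, h) \<in> continuity_triples K p \<mu>0 \<mu>1.
           (transport_metric K \<pi> p a b \<mu>0 \<mu>1)\<^sup>2 = quad_energy K \<pi> a b (\<mu>, V, h)"
proof -
  interpret transport_problem K \<pi> p a b
    by unfold_locales (fact assms)+
  obtain \<tau> where \<tau>: "\<tau> \<in> continuity_triples K p \<mu>0 \<mu>1"
    "\<And>\<sigma>. \<sigma> \<in> continuity_triples K p \<mu>0 \<mu>1 \<Longrightarrow> quad_energy K \<pi> a b \<tau> \<le> quad_energy K \<pi> a b \<sigma>"
    using quad_energy_minimum_attained[OF assms(9,10)] by blast
  have "(INF \<sigma>\<in>continuity_triples K p \<mu>0 \<mu>1. quad_energy K \<pi> a b \<sigma>) = quad_energy K \<pi> a b \<tau>"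
    by (intro antisym INF_lower INF_greatest \<tau>)
  then have "(transport_metric K \<pi> p a b \<mu>0 \<mu>1)\<^sup>2 = quad_energy K \<pi> a b \<tau>"
    by (simp add: transport_metric_eq_INF_quad_energy)
  then show ?thesis
    by (intro bexI[OF _ \<tau>(1)]) (simp add: split_beta)
qed

end
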